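(* Let $w\in L^1[0,1]$ be real with $w>0$ a.e. on $[0,1]$ and let $\mu\in\mathcal{M}_0^{\mathbb{R}}$. Then the eigenvalues of the measure eigenvalue problem $(\mathbf{E}_\mu)$ form a countably infinite sequence of algebraically simple eigenvalues $$-\infty<\lambda_1<\cdots<\lambda_n\to\infty,\qquad n\to\infty.$$
   Context: $\mathcal{M}_0^{\mathbb{R}}$ is the space of normalized real functions of bounded variation: functions $\mu:[0,1]\to\mathbb{R}$ with $\mu(0^+)=0$, $\mu(x^+)=\mu(x)$ for all $x\in(0,1)$, and finite total variation; they are identified with real Borel measures on $[0,1]$. $(\mathbf{E}_\mu)$ is the Dirichlet eigenvalue problem for the measure differential equation $$-\mathrm{d}y^\bullet(x)+y(x)\,\mathrm{d}\mu(x)=\lambda w(x)y(x)\,\mathrm{d}x,\quad x\in[0,1],\qquad y(0)=0=y(1),$$ with spectral parameter $\lambda\in\mathbb{C}$. A solution with initial values $(y_0,z_0)$ is a continuous $y$ with generalized derivative $y^\bullet$ such that $y(x)=y_0+\int_{[0,x]}y^\bullet(s)\,\mathrm{d}s$ for $x\in[0,1]$, $y^\bullet(0)=z_0$, and $y^\bullet(x)=z_0+\int_{[0,x]}y(s)\,\mathrm{d}\mu(s)-\lambda\int_{[0,x]}w(s)y(s)\,\mathrm{d}s$ for $x\in(0,1]$ (the $\mathrm{d}\mu$ integral being Riemann–Stieltjes); it exists and is unique. An eigenvalue is a $\lambda\in\mathbb{C}$ for which a nontrivial solution satisfying the Dirichlet conditions exists. Let $\psi(x,\lambda)$ be the solution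 with initial values $(\psi(0),\psi^\bullet(0))=(0,1)$. The discriminant function is $F(\lambda)=\psi(1,\lambda)$, a holomorphic function of $\lambda$ whose zeros are exactly the eigenvalues of $(\mathbf{E}_\mu)$. An eigenvalue is algebraically simple if it is a simple zero of $F$, i.e. $F'(\lambda)\ne0$ there. *)

theory Defs
  imports "HOL-Analysis.Analysis"
begin

definition bounded_variation_on :: "(real \<Rightarrow> real) \<Rightarrow> real \<Rightarrow> real \<Rightarrow> bool" where
  "bounded_variation_on \<mu> a b \<longleftrightarrow>
     (\<exists>B. \<forall>D. D division_of {a..b} \<longrightarrow> (\<Sum>K\<in>D. \<bar>\<mu> (Sup K) - \<mu> (Inf K)\<bar>) \<le> B)"

text \<open>Normalized functions of bounded variation on \<open>[0,1]\<close>. The value \<open>\<mu> 0\<close> is not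
  constrained: \<open>- \<mu> 0\<close> is the mass that the associated measure puts at \<open>0\<close>. Values outside
  \<open>[0,1]\<close> are irrelevant.\<close>

definition normalized_bv :: "(real \<Rightarrow> real) set" where
  "normalized_bv = {\<mu>. (\<mu> \<longlongrightarrow> 0) (at_right 0) \<and>
     (\<forall>x\<in>{0<..<1}. (\<mu> \<longlongrightarrow> \<mu> x) (at_right x)) \<and> bounded_variation_on \<mu> 0 1}"

text \<open>Riemann--Stieltjes integral of \<open>f\<close> with respect to \<open>\<mu>\<close> over \<open>[a,b]\<close>. The gauge is constant,
  so this is convergence as the mesh of the partition tends to zero. An atom of \<open>\<mu>\<close> at an
  endpoint of \<open>[a,b]\<close> is counted whenever the jump of \<open>\<mu>\<close> takes place inside \<open>[a,b]\<close>; in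
  particular \<open>f 0 * (- \<mu> 0)\<close> is included for a normalized \<open>\<mu>\<close> and \<open>a = 0 < b\<close>.\<close>

definition has_RS_integral ::
    "(real \<Rightarrow> complex) \<Rightarrow> (real \<Rightarrow> real) \<Rightarrow> real \<Rightarrow> real \<Rightarrow> complex \<Rightarrow> bool" where
  "has_RS_integral f \<mu> a b I \<longleftrightarrow>
     (\<forall>e>0. \<exists>d>0. \<forall>p. p tagged_division_of {a..b} \<and> (\<lambda>x. ball x d) fine p \<longrightarrow>
        cmod ((\<Sum>(t, K)\<in>p. f t * of_real (\<mu> (Sup K) - \<mu> (Inf K))) - I) < e)"

text \<open>\<open>mde_solution w \<mu> \<zeta> y\<^sub>0 z\<^sub>0 y v\<close>: the function \<open>y\<close>, with generalized derivative
  \<open>v = y\<^sup>\<bullet>\<close>, solves \<open>- dy\<^sup>\<bullet> + y d\<mu> = \<zeta> w y dx\<close> on \<open>[0,1]\<close> with initial values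
  \<open>(y\<^sub>0, z\<^sub>0)\<close>. At \<open>x = 0\<close> only \<open>v 0 = z\<^sub>0\<close> is required, the atom of \<open>\<mu>\<close> at \<open>0\<close> entering \<open>v x\<close>
  for \<open>x > 0\<close> only.\<close>

definition mde_solution :: "(real \<Rightarrow> real) \<Rightarrow> (real \<Rightarrow> real) \<Rightarrow> complex \<Rightarrow> complex \<Rightarrow> complex \<Rightarrow>
    (real \<Rightarrow> complex) \<Rightarrow> (real \<Rightarrow> complex) \<Rightarrow> bool" where
  "mde_solution w \<mu> \<zeta> y\<^sub>0 z\<^sub>0 y v \<longleftrightarrow>
     continuous_on {0..1} y \<and> set_integrable lebesgue {0..1} v \<and>
     (\<forall>x\<in>{0..1}. y x = y\<^sub>0 + (LINT s:{0..x}|lebesgue. v s)) \<and>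
     v 0 = z\<^sub>0 \<and>
     (\<forall>x\<in>{0<..1}. \<exists>I. has_RS_integral y \<mu> 0 x I \<and>
        v x = z\<^sub>0 + I - \<zeta> * (LINT s:{0..x}|lebesgue. of_real (w s) * y s))"

definition mde_eigenvalue :: "(real \<Rightarrow> real) \<Rightarrow> (real \<Rightarrow> real) \<Rightarrow> complex \<Rightarrow> bool" where
  "mde_eigenvalue w \<mu> \<zeta> \<longleftrightarrow>
     (\<exists>y\<^sub>0 z\<^sub>0 y v. mde_solution w \<mu> \<zeta> y\<^sub>0 z\<^sub>0 y v \<and> (\<exists>x\<in>{0..1}. y x \<noteq> 0) \<and> y 0 = 0 \<and> y 1 = 0)"

text \<open>A solution is determined by its initial values on \<open>[0,1]\<close> only, so the description
  operator is applied to its value at a point \<open>x\<close> rather than to the solution as a function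
  on the whole line.\<close>

definition mde_psi :: "(real \<Rightarrow> real) \<Rightarrow> (real \<Rightarrow> real) \<Rightarrow> real \<Rightarrow> complex \<Rightarrow> complex" where
  "mde_psi w \<mu> x \<zeta> = (THE c. \<exists>y v. mde_solution w \<mu> \<zeta> 0 1 y v \<and> y x = c)"

definition discriminant :: "(real \<Rightarrow> real) \<Rightarrow> (real \<Rightarrow> real) \<Rightarrow> complex \<Rightarrow> complex" where
  "discriminant w \<mu> \<zeta> = mde_psi w \<mu> 1 \<zeta>"

text \<open>Analyticity is stated explicitly because \<open>deriv\<close> carries no information where the
  function is not differentiable.\<close>

definition algebraically_simple :: "(real \<Rightarrow> real) \<Rightarrow> (real \<Rightarrow> real) \<Rightarrow> complex \<Rightarrow> bool" where
  "algebraically_simple w \<mu> \<zeta> \<longleftrightarrow>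
     discriminant w \<mu> analytic_on {\<zeta>} \<and> discriminant w \<mu> \<zeta> = 0 \<and> deriv (discriminant w \<mu>) \<zeta> \<noteq> 0"

end

theory Submission
  imports Defs
begin

text \<open>
  Why the theorem holds. The Riemann--Stieltjes integral of an absolutely continuous \<open>y\<close> against
  \<open>\<mu>\<close> can be integrated by parts (\<open>has_RS_integral_primitive\<close>). In terms of the quasi-derivative
  \<open>u = y\<^sup>\<bullet> - \<mu> y\<close>, which no longer jumps where \<open>\<mu>\<close> does, the measure equation therefore becomes the
  linear system \<open>y' = u + \<mu> y\<close>, \<open>u' = - \<mu> (u + \<mu> y) - \<zeta> w y\<close> with integrable coefficients
  (\<open>mde_solution_imp_quasi\<close>, \<open>quasi_imp_mde_solution\<close>). Picard iteration and Gronwall's inequality give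
  existence, uniqueness and Lipschitz dependence on \<open>\<zeta>\<close>, so the eigenvalues are the zeros of
  \<open>F \<zeta> = \<psi> \<zeta> 1\<close> (\<open>eigenvalue_iff\<close>).

  Everything about a single eigenvalue comes from the Lagrange identity
  \<open>(y u\<^sub>1 - u y\<^sub>1)' = (\<zeta> - \<zeta>\<^sub>1) w y y\<^sub>1\<close>. Comparing \<open>\<psi> \<zeta>\<close> with its conjugate shows that the zeros of
  \<open>F\<close> are real. Comparing \<open>\<psi> \<zeta>\<close> with a solution for a fixed \<open>\<kappa>\<close> that has prescribed data at \<open>1\<close>
  writes the difference quotient of \<open>F\<close> at \<open>\<kappa>\<close> as an integral depending continuously on \<open>\<zeta>\<close>, so \<open>F\<close> is entire. Comparing \<open>\<psi> \<zeta>\<close>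
  with \<open>\<psi> \<kappa>\<close> at a zero \<open>\<kappa>\<close> gives \<open>F' \<kappa> * u \<kappa> 1 = \<integral> w (\<psi> \<kappa>)\<^sup>2 > 0\<close>, where \<open>u \<kappa>\<close> is the
  quasi-derivative of \<open>\<psi> \<kappa>\<close>. Hence every zero is simple.

  That the eigenvalues form an infinite sequence tending to infinity is oscillation theory. For
  real \<open>l\<close> the curve \<open>x \<mapsto> u + \<i> y\<close> avoids the origin and its continuous argument, the Pruefer
  angle \<open>angle x l\<close>, starts at \<open>0\<close>; the eigenvalues are the \<open>l\<close> for which \<open>angle 1 l\<close> is an integer
  multiple of \<open>pi\<close>. In \<open>l\<close>, the function \<open>angle 1\<close> is continuous and, by the Lagrange identity once
  more, strictly increasing (\<open>angle_endpoint_strict_mono\<close>). In \<open>x\<close>, the angle can cross multiples of \<open>pi\<close> only upwards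
  (\<open>angle_crosses_upward\<close>). Hence \<open>angle 1 l > 0\<close>, and \<open>angle 1 l > N pi\<close> as soon as the solution has
  \<open>N\<close> zeros in the open interval. Picone's identity forces a zero in any given interval once \<open>l\<close> is large
  (\<open>picone_zero\<close>), so \<open>angle 1\<close> is unbounded above, and its levels \<open>k * pi\<close> are attained from some \<open>k\<close> on.
\<close>

section \<open>Absolutely continuous functions as primitives\<close>

definition bounded_measurable :: "real set \<Rightarrow> (real \<Rightarrow> 'a::euclidean_space) \<Rightarrow> bool" where
  "bounded_measurable S f \<longleftrightarrow> f \<in> borel_measurable (lebesgue_on S) \<and> bounded (f ` S)"

lemma bounded_measurable_continuous:
  fixes f :: "real \<Rightarrow> 'a::euclidean_space"
  assumes "continuous_on {a..b} f"
  shows "bounded_measurable {a..b} f"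
  unfolding bounded_measurable_def
  using assms compact_continuous_image[of "{a..b}" f]
  by (auto intro: continuous_imp_measurable_on_sets_lebesgue compact_imp_bounded)

text \<open>Integrands below are products of one integrable factor with factors that are merely
  bounded and measurable; this closure property supplies their integrability.\<close>
lemma abs_integrable_mult:
  fixes f g :: "real \<Rightarrow> 'a::{real_normed_algebra, euclidean_space}"
  assumes "bounded_measurable {a..b} f" "g absolutely_integrable_on {a..b}"
  shows "(\<lambda>x. f x * g x) absolutely_integrable_on {a..b}"
  using assms unfolding bounded_measurable_def
  by (intro absolutely_integrable_bounded_measurable_product[where h = "(*)"])
    (auto simp: bilinear_conv_bounded_bilinear intro: bounded_bilinear_mult)

lemma abs_integrable_continuous_mult:
  fixes f g :: "real \<Rightarrow> 'a::{real_normed_algebra, euclidean_space}"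
  assumes "continuous_on {a..b} f" "g absolutely_integrable_on {a..b}"
  shows "(\<lambda>x. f x * g x) absolutely_integrable_on {a..b}"
  by (intro abs_integrable_mult bounded_measurable_continuous assms)

lemma bounded_measurable_mult:
  fixes f g :: "real \<Rightarrow> 'a::{real_normed_field, euclidean_space}"
  assumes "bounded_measurable {a..b} f" "bounded_measurable {a..b} g"
  shows "bounded_measurable {a..b} (\<lambda>x. f x * g x)"
proof -
  obtain B where "\<And>x. x \<in> {a..b} \<Longrightarrow> norm (f x) \<le> B"
    using assms(1) unfolding bounded_measurable_def bounded_iff by fastforce
  moreover obtain C where "\<And>x. x \<in> {a..b} \<Longrightarrow> norm (g x) \<le> C"
    using assms(2) unfolding bounded_measurable_def bounded_iff by fastforce
  ultimately have "norm (f x * g x) \<le> B * C" if "x \<in> {a..b}" for x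
    using that by (simp add: norm_mult) (meson mult_mono norm_ge_zero order_trans)
  moreover have "(\<lambda>x. f x * g x) \<in> borel_measurable (lebesgue_on {a..b})"
    using assms unfolding bounded_measurable_def by (intro borel_measurable_times) auto
  ultimately show ?thesis
    unfolding bounded_measurable_def bounded_iff by (auto intro!: exI[of _ "B * C"])
qed

lemma bounded_measurable_imp_abs_integrable:
  fixes f :: "real \<Rightarrow> 'a::{real_normed_field, euclidean_space}"
  assumes "bounded_measurable {a..b} f"
  shows "f absolutely_integrable_on {a..b}"
  using abs_integrable_mult[OF assms, of "\<lambda>x. 1"] absolutely_integrable_continuous_real[of a b "\<lambda>x. 1::'a"]
  by (simp add: continuous_on_const)

text \<open>Absolute continuity with an explicit density: \<open>f\<close> is absolutely continuous on \<open>[a,b]\<close> with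
  \<open>f' = g\<close> almost everywhere. Carrying \<open>g\<close> along replaces pointwise differentiation by integral
  equations, so that no almost-everywhere differentiation theorem enters.\<close>
definition primitive_on :: "real \<Rightarrow> real \<Rightarrow> (real \<Rightarrow> 'a::euclidean_space) \<Rightarrow> (real \<Rightarrow> 'a) \<Rightarrow> bool" where
  "primitive_on a b f g \<longleftrightarrow>
     g absolutely_integrable_on {a..b} \<and> (\<forall>x\<in>{a..b}. f x = f a + integral {a..x} g)"

lemma primitive_onD:
  assumes "primitive_on a b f g"
  shows "g absolutely_integrable_on {a..b}" "x \<in> {a..b} \<Longrightarrow> f x = f a + integral {a..x} g"
  using assms unfolding primitive_on_def by blast+

lemma abs_integrable_subD:
  fixes g :: "real \<Rightarrow> 'a::euclidean_space"
  assumes "g absolutely_integrable_on {a..b}" "a \<le> s" "t \<le> b"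
  shows "g absolutely_integrable_on {s..t}" "g integrable_on {s..t}"
    "(\<lambda>x. norm (g x)) integrable_on {s..t}" "(\<lambda>x. norm (g x)) absolutely_integrable_on {s..t}"
proof -
  show 1: "g absolutely_integrable_on {s..t}"
    using assms by (auto intro: absolutely_integrable_on_subinterval)
  show "g integrable_on {s..t}" "(\<lambda>x. norm (g x)) integrable_on {s..t}"
    using 1 unfolding absolutely_integrable_on_def by auto
  show "(\<lambda>x. norm (g x)) absolutely_integrable_on {s..t}"
    using absolutely_integrable_norm[OF 1] by (simp add: o_def)
qed

lemma primitive_on_integral:
  fixes g :: "real \<Rightarrow> 'a::euclidean_space"
  assumes "g absolutely_integrable_on {a..b}"
  shows "primitive_on a b (\<lambda>x. c + integral {a..x} g) g"
  using assms unfolding primitive_on_def by (intro conjI ballI) simp_all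

lemma primitive_on_diff:
  assumes "primitive_on a b f g" "a \<le> s" "s \<le> t" "t \<le> b"
  shows "f t - f s = integral {s..t} g"
proof -
  have "integral {a..s} g + integral {s..t} g = integral {a..t} g"
    using assms(2-4) abs_integrable_subD(2)[OF primitive_onD(1)[OF assms(1)], of a t]
    by (intro Henstock_Kurzweil_Integration.integral_combine) auto
  moreover have "f t = f a + integral {a..t} g" "f s = f a + integral {a..s} g"
    using assms(2-4) by (intro primitive_onD(2)[OF assms(1)]; simp)+
  ultimately show ?thesis by (simp add: algebra_simps)
qed

lemma primitive_on_intro_diff:
  assumes "g absolutely_integrable_on {a..b}"
    "\<And>x. x \<in> {a..b} \<Longrightarrow> f x - f a = integral {a..x} g"
  shows "primitive_on a b f g"
  using assms unfolding primitive_on_def by (metis add.commute diff_add_cancel)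

lemma primitive_on_continuous:
  assumes "primitive_on a b f g"
  shows "continuous_on {a..b} f"
proof -
  have "g integrable_on {a..b}"
    using primitive_onD(1)[OF assms] unfolding absolutely_integrable_on_def by auto
  then have "continuous_on {a..b} (\<lambda>x. f a + integral {a..x} g)"
    by (intro continuous_on_add continuous_on_const indefinite_integral_continuous_1)
  then show ?thesis
    by (rule continuous_on_eq) (rule primitive_onD(2)[OF assms, symmetric])
qed

lemma primitive_on_subinterval:
  assumes "primitive_on a b f g" "a \<le> s" "t \<le> b"
  shows "primitive_on s t f g"
proof (rule primitive_on_intro_diff)
  show "g absolutely_integrable_on {s..t}"
    by (rule abs_integrable_subD(1)[OF primitive_onD(1)[OF assms(1)] assms(2,3)])
  show "f x - f s = integral {s..x} g" if "x \<in> {s..t}" for x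
    using that assms(2,3) by (intro primitive_on_diff[OF assms(1)]) auto
qed

lemma primitive_on_linear:
  assumes "primitive_on a b f g" "bounded_linear h"
  shows "primitive_on a b (\<lambda>x. h (f x)) (\<lambda>x. h (g x))"
proof (rule primitive_on_intro_diff)
  show "(\<lambda>x. h (g x)) absolutely_integrable_on {a..b}"
    using absolutely_integrable_linear[OF primitive_onD(1)[OF assms(1)] assms(2)] by (simp add: o_def)
next
  fix x assume x: "x \<in> {a..b}"
  then have "g integrable_on {a..x}"
    using abs_integrable_subD(2)[OF primitive_onD(1)[OF assms(1)], of a x] by auto
  then have "integral {a..x} (\<lambda>x. h (g x)) = h (integral {a..x} g)"
    using integral_linear[OF _ assms(2)] by (simp add: o_def)
  also have "integral {a..x} g = f x - f a"
    using primitive_on_diff[OF assms(1), of a x] x by auto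
  finally show "h (f x) - h (f a) = integral {a..x} (\<lambda>x. h (g x))"
    using bounded_linear.linear[OF assms(2)] by (simp add: linear_diff)
qed

lemma primitive_on_add:
  assumes "primitive_on a b f g" "primitive_on a b f' g'"
  shows "primitive_on a b (\<lambda>x. f x + f' x) (\<lambda>x. g x + g' x)"
proof (rule primitive_on_intro_diff)
  show "(\<lambda>x. g x + g' x) absolutely_integrable_on {a..b}"
    by (intro set_integral_add primitive_onD(1)[OF assms(1)] primitive_onD(1)[OF assms(2)])
next
  fix x assume x: "x \<in> {a..b}"
  then have "integral {a..x} (\<lambda>x. g x + g' x) = integral {a..x} g + integral {a..x} g'"
    using abs_integrable_subD(2)[OF primitive_onD(1)[OF assms(1)], of a x]
      abs_integrable_subD(2)[OF primitive_onD(1)[OF assms(2)], of a x]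
    by (intro Henstock_Kurzweil_Integration.integral_add) auto
  then show "f x + f' x - (f a + f' a) = integral {a..x} (\<lambda>x. g x + g' x)"
    using primitive_on_diff[OF assms(1), of a x] primitive_on_diff[OF assms(2), of a x] x
    by (auto simp: algebra_simps)
qed

lemma primitive_on_uminus:
  assumes "primitive_on a b f g"
  shows "primitive_on a b (\<lambda>x. - f x) (\<lambda>x. - g x)"
  by (rule primitive_on_linear[OF assms, of uminus]) (simp add: bounded_linear_minus bounded_linear_ident)

lemma primitive_on_minus:
  assumes "primitive_on a b f g" "primitive_on a b f' g'"
  shows "primitive_on a b (\<lambda>x. f x - f' x) (\<lambda>x. g x - g' x)"
  using primitive_on_add[OF assms(1) primitive_on_uminus[OF assms(2)]] by simp

lemma primitive_on_cong:
  assumes "primitive_on a b f g" "\<And>x. x \<in> {a..b} \<Longrightarrow> f x = f' x" "\<And>x. x \<in> {a..b} \<Longrightarrow> g x = g' x"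
  shows "primitive_on a b f' g'"
proof (rule primitive_on_intro_diff)
  show "g' absolutely_integrable_on {a..b}"
    using primitive_onD(1)[OF assms(1)] set_integrable_cong[of lebesgue lebesgue "{a..b}" "{a..b}" g g'] assms(3)
    by simp
next
  fix x assume x: "x \<in> {a..b}"
  have "integral {a..x} g' = integral {a..x} g"
    using x assms(3) by (intro Henstock_Kurzweil_Integration.integral_cong) auto
  then show "f' x - f' a = integral {a..x} g'"
    using primitive_on_diff[OF assms(1), of a x] x assms(2) by auto
qed

text \<open>The increments add up over a fine partition, whose existence is Cousin's lemma, to at most
  \<open>\<epsilon> * (B b - B a)\<close>. This is the one mechanism behind the product and the chain rule for primitives.\<close>

lemma small_increments_imp_constant:
  fixes H :: "real \<Rightarrow> 'a::real_normed_vector" and B :: "real \<Rightarrow> real"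
  assumes "a \<le> b"
    and small: "\<And>\<epsilon>. \<epsilon> > 0 \<Longrightarrow> \<exists>d>0. \<forall>s t. a \<le> s \<and> s \<le> t \<and> t \<le> b \<and> t - s < d \<longrightarrow>
                   norm (H t - H s) \<le> \<epsilon> * (B t - B s)"
  shows "H b = H a"
proof -
  have bound: "norm (H b - H a) \<le> \<epsilon> * (B b - B a)" if "\<epsilon> > 0" for \<epsilon>
  proof -
    obtain d where d: "d > 0" and
      H: "\<And>s t. a \<le> s \<Longrightarrow> s \<le> t \<Longrightarrow> t \<le> b \<Longrightarrow> t - s < d \<Longrightarrow> norm (H t - H s) \<le> \<epsilon> * (B t - B s)"
      using small[OF \<open>\<epsilon> > 0\<close>] by auto
    have "gauge (\<lambda>x. ball x (d/2))"
      using d by auto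
    then obtain p where p: "p tagged_division_of {a..b}" "(\<lambda>x. ball x (d/2)) fine p"
      by (rule fine_division_exists_real)
    have "norm (H b - H a) = norm (\<Sum>(x,K)\<in>p. H (Sup K) - H (Inf K))"
      using additive_tagged_division_1[OF \<open>a \<le> b\<close> p(1), of H] by simp
    also have "\<dots> \<le> (\<Sum>(x,K)\<in>p. \<epsilon> * (B (Sup K) - B (Inf K)))"
    proof (rule sum_norm_le, safe)
      fix x K assume xK: "(x, K) \<in> p"
      obtain s t where K: "K = {s..t}" "s \<le> t" "a \<le> s" "t \<le> b"
        using tagged_division_ofD(2-4)[OF p(1) xK] by fastforce
      have "K \<subseteq> ball x (d/2)"
        using p(2) xK unfolding fine_def by auto
      then have "dist x s < d/2" "dist x t < d/2"
        using K(2) unfolding K(1) by auto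
      then have "t - s < d"
        unfolding dist_real_def by linarith
      then show "norm (H (Sup K) - H (Inf K)) \<le> \<epsilon> * (B (Sup K) - B (Inf K))"
        using H K by simp
    qed
    also have "\<dots> = \<epsilon> * (B b - B a)"
      using additive_tagged_division_1[OF \<open>a \<le> b\<close> p(1), of B]
      by (simp add: sum_distrib_left[symmetric] case_prod_unfold)
    finally show ?thesis .
  qed
  have "norm (H b - H a) \<le> 0"
  proof (rule field_le_epsilon)
    fix e :: real assume "e > 0"
    define D where "D = \<bar>B b - B a\<bar> + 1"
    have "norm (H b - H a) \<le> e / D * (B b - B a)"
      using bound[of "e / D"] \<open>e > 0\<close> by (simp add: D_def add_nonneg_pos)
    also have "\<dots> \<le> e / D * D"
      using \<open>e > 0\<close> by (intro mult_left_mono) (auto simp: D_def)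
    also have "\<dots> = e"
      by (simp add: D_def add_nonneg_eq_0_iff)
    finally show "norm (H b - H a) \<le> 0 + e" by simp
  qed
  then show ?thesis by simp
qed

lemma primitive_on_small_increments:
  fixes f :: "real \<Rightarrow> 'a::euclidean_space"
  assumes g: "g absolutely_integrable_on {a..b}"
    and small: "\<And>\<epsilon>. \<epsilon> > 0 \<Longrightarrow> \<exists>d>0. \<forall>s t. a \<le> s \<and> s \<le> t \<and> t \<le> b \<and> t - s < d \<longrightarrow>
                   norm (f t - f s - integral {s..t} g) \<le> \<epsilon> * (B t - B s)"
  shows "primitive_on a b f g"
proof (rule primitive_on_intro_diff[OF g])
  fix x assume x: "x \<in> {a..b}"
  let ?H = "\<lambda>r. f r - integral {a..r} g"
  have H: "?H t - ?H s = f t - f s - integral {s..t} g" if "a \<le> s" "s \<le> t" "t \<le> b" for s t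
  proof -
    have "integral {s..t} g = integral {a..t} g - integral {a..s} g"
      using primitive_on_diff[OF primitive_on_integral[OF g, of 0] that] by simp
    then show ?thesis by (simp only: diff_diff_eq2) simp
  qed
  have "?H x = ?H a"
  proof (rule small_increments_imp_constant)
    fix \<epsilon> :: real assume "\<epsilon> > 0"
    then obtain d where "d > 0" "\<And>s t. a \<le> s \<Longrightarrow> s \<le> t \<Longrightarrow> t \<le> b \<Longrightarrow> t - s < d \<Longrightarrow>
                   norm (f t - f s - integral {s..t} g) \<le> \<epsilon> * (B t - B s)"
      using small by meson
    moreover have "norm (?H t - ?H s) = norm (f t - f s - integral {s..t} g)"
      if "a \<le> s" "s \<le> t" "t \<le> b" for s t
      unfolding H[OF that] ..
    ultimately show "\<exists>d>0. \<forall>s t. a \<le> s \<and> s \<le> t \<and> t \<le> x \<and> t - s < d \<longrightarrow>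
                   norm (?H t - ?H s) \<le> \<epsilon> * (B t - B s)"
      using x by (intro exI[of _ d]) force
  qed (use x in auto)
  then show "f x - f a = integral {a..x} g" by (simp add: algebra_simps)
qed

lemma uniform_continuityD:
  fixes f :: "real \<Rightarrow> 'a::real_normed_vector"
  assumes "continuous_on {a..b} f" "\<epsilon> > 0"
  obtains d where "d > 0" "\<And>s t. s \<in> {a..b} \<Longrightarrow> t \<in> {a..b} \<Longrightarrow> \<bar>t - s\<bar> < d \<Longrightarrow> norm (f t - f s) < \<epsilon>"
  using compact_uniformly_continuous[OF assms(1) compact_Icc] assms(2)
  unfolding uniformly_continuous_on_def dist_real_def dist_norm by metis

text \<open>On a short interval one may freeze the undifferentiated factor at an endpoint; the error is
  the oscillation of a continuous function times the increment of \<open>\<integral> \<bar>f'\<bar> + \<bar>g'\<bar>\<close>.\<close>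
lemma primitive_on_mult:
  fixes f g :: "real \<Rightarrow> 'a::{real_normed_field, euclidean_space}"
  assumes f: "primitive_on a b f f'" and g: "primitive_on a b g g'"
  shows "primitive_on a b (\<lambda>x. f x * g x) (\<lambda>x. f' x * g x + f x * g' x)"
proof (rule primitive_on_small_increments)
  note cf = primitive_on_continuous[OF f] and cg = primitive_on_continuous[OF g]
  have f': "f' absolutely_integrable_on {a..b}" and g': "g' absolutely_integrable_on {a..b}"
    using primitive_onD(1) f g by blast+
  have 1: "(\<lambda>x. g x * f' x) absolutely_integrable_on {a..b}"
    and 2: "(\<lambda>x. f x * g' x) absolutely_integrable_on {a..b}"
    by (intro abs_integrable_continuous_mult cf cg f' g')+
  show I: "(\<lambda>x. f' x * g x + f x * g' x) absolutely_integrable_on {a..b}"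
    using set_integral_add(1)[OF 1 2] by (simp add: mult.commute)
  define B where "B = (\<lambda>x. integral {a..x} (\<lambda>r. norm (f' r) + norm (g' r)))"
  have N: "(\<lambda>r. norm (f' r) + norm (g' r)) absolutely_integrable_on {a..b}"
    by (intro set_integral_add(1) abs_integrable_subD(4)[OF f'] abs_integrable_subD(4)[OF g']) auto
  fix \<epsilon> :: real assume "\<epsilon> > 0"
  obtain d1 where d1: "d1 > 0" "\<And>s t. s \<in> {a..b} \<Longrightarrow> t \<in> {a..b} \<Longrightarrow> \<bar>t - s\<bar> < d1 \<Longrightarrow> norm (f t - f s) < \<epsilon>"
    using uniform_continuityD[OF cf \<open>\<epsilon> > 0\<close>] by blast
  obtain d2 where d2: "d2 > 0" "\<And>s t. s \<in> {a..b} \<Longrightarrow> t \<in> {a..b} \<Longrightarrow> \<bar>t - s\<bar> < d2 \<Longrightarrow> norm (g t - g s) < \<epsilon>"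
    using uniform_continuityD[OF cg \<open>\<epsilon> > 0\<close>] by blast
  have "norm (f t * g t - f s * g s - integral {s..t} (\<lambda>x. f' x * g x + f x * g' x)) \<le> \<epsilon> * (B t - B s)"
    if st: "a \<le> s" "s \<le> t" "t \<le> b" "t - s < min d1 d2" for s t
  proof -
    have i: "f' integrable_on {s..t}" "g' integrable_on {s..t}"
      using abs_integrable_subD(2)[OF f', of s t] abs_integrable_subD(2)[OF g', of s t] st by auto
    have iI: "(\<lambda>x. f' x * g x + f x * g' x) integrable_on {s..t}"
      using abs_integrable_subD(2)[OF I] st by auto
    have iN: "(\<lambda>r. norm (f' r) + norm (g' r)) integrable_on {s..t}"
      using abs_integrable_subD(2)[OF N] st by auto
    have iJ: "(\<lambda>x. f' x * g t + f s * g' x) integrable_on {s..t}"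
      using i by (intro Henstock_Kurzweil_Integration.integrable_add integrable_on_mult_left integrable_on_mult_right)
    have "f t * g t - f s * g s = (f t - f s) * g t + f s * (g t - g s)"
      by (simp add: algebra_simps)
    also have "\<dots> = integral {s..t} f' * g t + f s * integral {s..t} g'"
      using primitive_on_diff[OF f] primitive_on_diff[OF g] st by simp
    also have "\<dots> = integral {s..t} (\<lambda>x. f' x * g t + f s * g' x)"
      using i by (simp add: Henstock_Kurzweil_Integration.integral_add integrable_on_mult_left integrable_on_mult_right)
    finally have "f t * g t - f s * g s = integral {s..t} (\<lambda>x. f' x * g t + f s * g' x)" .
    then have "f t * g t - f s * g s - integral {s..t} (\<lambda>x. f' x * g x + f x * g' x)
      = integral {s..t} (\<lambda>x. (f' x * g t + f s * g' x) - (f' x * g x + f x * g' x))"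
      using iI iJ by (simp add: Henstock_Kurzweil_Integration.integral_diff)
    also have "norm \<dots> \<le> integral {s..t} (\<lambda>x. \<epsilon> * (norm (f' x) + norm (g' x)))"
    proof (rule Henstock_Kurzweil_Integration.integral_norm_bound_integral)
      show "(\<lambda>x. (f' x * g t + f s * g' x) - (f' x * g x + f x * g' x)) integrable_on {s..t}"
        by (intro Henstock_Kurzweil_Integration.integrable_diff iI iJ)
      show "(\<lambda>x. \<epsilon> * (norm (f' x) + norm (g' x))) integrable_on {s..t}"
        using iN by (rule integrable_on_mult_right)
    next
      fix x assume x: "x \<in> {s..t}"
      have "norm (g t - g x) \<le> \<epsilon>" "norm (f x - f s) \<le> \<epsilon>"
        using d1(2)[of s x] d2(2)[of x t] x st by auto
      then have "norm (f' x) * norm (g t - g x) + norm (f s - f x) * norm (g' x) \<le> norm (f' x) * \<epsilon> + \<epsilon> * norm (g' x)"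
        by (intro add_mono mult_left_mono mult_right_mono) (auto simp: norm_minus_commute)
      moreover have "(f' x * g t + f s * g' x) - (f' x * g x + f x * g' x) = f' x * (g t - g x) + (f s - f x) * g' x"
        by (simp add: algebra_simps)
      ultimately show "norm ((f' x * g t + f s * g' x) - (f' x * g x + f x * g' x)) \<le> \<epsilon> * (norm (f' x) + norm (g' x))"
        using norm_triangle_ineq[of "f' x * (g t - g x)" "(f s - f x) * g' x"]
        by (simp only: norm_mult distrib_left mult.commute[of \<epsilon>])
    qed
    also have "\<dots> = \<epsilon> * (B t - B s)"
      using primitive_on_diff[OF primitive_on_integral[OF N, of 0], of s t] st
      by (simp add: B_def)
    finally show ?thesis .
  qed
  note bound = this
  show "\<exists>d>0. \<forall>s t. a \<le> s \<and> s \<le> t \<and> t \<le> b \<and> t - s < d \<longrightarrow>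
       norm (f t * g t - f s * g s - integral {s..t} (\<lambda>x. f' x * g x + f x * g' x)) \<le> \<epsilon> * (B t - B s)"
  proof (intro exI[of _ "min d1 d2"] conjI allI impI)
    show "0 < min d1 d2" using d1(1) d2(1) by simp
  qed (rule bound; simp)
qed

text \<open>By the mean value theorem and the intermediate value theorem, an increment of \<open>\<Phi> \<circ> f\<close> is
  \<open>\<Phi>' (f r)\<close> times that of \<open>f\<close> for some \<open>r\<close> in the interval, and \<open>\<Phi>' \<circ> f\<close> oscillates little on short
  intervals.\<close>
lemma primitive_on_chain:
  fixes f :: "real \<Rightarrow> real"
  assumes f: "primitive_on a b f g"
    and \<Phi>: "\<And>x. x \<in> f ` {a..b} \<Longrightarrow> (\<Phi> has_real_derivative \<Phi>' x) (at x)"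
    and c: "continuous_on (f ` {a..b}) \<Phi>'"
  shows "primitive_on a b (\<lambda>x. \<Phi> (f x)) (\<lambda>x. \<Phi>' (f x) * g x)"
proof (rule primitive_on_small_increments)
  note cf = primitive_on_continuous[OF f]
  have cc: "continuous_on {a..b} (\<lambda>x. \<Phi>' (f x))"
    using continuous_on_compose[OF cf c] by (simp add: o_def)
  have g: "g absolutely_integrable_on {a..b}"
    using primitive_onD(1) f by blast
  show I: "(\<lambda>x. \<Phi>' (f x) * g x) absolutely_integrable_on {a..b}"
    by (intro abs_integrable_continuous_mult cc g)
  define B where "B = (\<lambda>x. integral {a..x} (\<lambda>r. norm (g r)))"
  have N: "(\<lambda>r. norm (g r)) absolutely_integrable_on {a..b}"
    by (intro abs_integrable_subD(4)[OF g]) auto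
  fix \<epsilon> :: real assume "\<epsilon> > 0"
  obtain d where d: "d > 0" "\<And>s t. s \<in> {a..b} \<Longrightarrow> t \<in> {a..b} \<Longrightarrow> \<bar>t - s\<bar> < d \<Longrightarrow> norm (\<Phi>' (f t) - \<Phi>' (f s)) < \<epsilon>"
    using uniform_continuityD[OF cc \<open>\<epsilon> > 0\<close>] by blast
  have "norm (\<Phi> (f t) - \<Phi> (f s) - integral {s..t} (\<lambda>x. \<Phi>' (f x) * g x)) \<le> \<epsilon> * (B t - B s)"
    if st: "a \<le> s" "s \<le> t" "t \<le> b" "t - s < d" for s t
  proof -
    have "\<exists>r\<in>{s..t}. \<Phi> (f t) - \<Phi> (f s) = \<Phi>' (f r) * (f t - f s)"
    proof -
      have between: "\<exists>r\<in>{s..t}. f r = z" if "f s \<le> z \<and> z \<le> f t \<or> f t \<le> z \<and> z \<le> f s" for z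
      proof -
        have "connected (f ` {s..t})"
          using st by (intro connected_continuous_image continuous_on_subset[OF cf]) auto
        then have "z \<in> f ` {s..t}"
          using that st connectedD_interval[of "f ` {s..t}" "f s" "f t" z]
            connectedD_interval[of "f ` {s..t}" "f t" "f s" z]
          by auto
        then show ?thesis by auto
      qed
      have mvt: "\<exists>r\<in>{s..t}. \<Phi> y - \<Phi> x = (y - x) * \<Phi>' (f r)"
        if xy: "x < y" and im: "\<And>z. x \<le> z \<Longrightarrow> z \<le> y \<Longrightarrow> \<exists>r\<in>{s..t}. f r = z" for x y
      proof -
        have D: "(\<Phi> has_real_derivative \<Phi>' z) (at z)" if "x \<le> z" "z \<le> y" for z
          using im[OF that] st by (intro \<Phi>) force
        obtain z where z: "x < z" "z < y" "\<Phi> y - \<Phi> x = (y - x) * \<Phi>' z"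
          using MVT2[OF xy D] by blast
        obtain r where "r \<in> {s..t}" "f r = z"
          using im[of z] z by auto
        then show ?thesis using z(3) by (intro bexI[of _ r]) auto
      qed
      consider "f s = f t" | "f s < f t" | "f t < f s" by linarith
      then show ?thesis
      proof cases
        case 1 then show ?thesis using st by (intro bexI[of _ s]) auto
      next
        case 2
        obtain r where r: "r \<in> {s..t}" "\<Phi> (f t) - \<Phi> (f s) = (f t - f s) * \<Phi>' (f r)"
          using mvt[OF 2 between[OF disjI1[OF conjI]]] by metis
        show ?thesis
          by (rule bexI[OF _ r(1)]) (use r(2) in \<open>simp add: mult.commute\<close>)
      next
        case 3
        obtain r where r: "r \<in> {s..t}" "\<Phi> (f s) - \<Phi> (f t) = (f s - f t) * \<Phi>' (f r)"
          using mvt[OF 3 between[OF disjI2[OF conjI]]] by metis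
        have "\<Phi> (f t) - \<Phi> (f s) = - ((f s - f t) * \<Phi>' (f r))"
          unfolding r(2)[symmetric] by simp
        also have "\<dots> = \<Phi>' (f r) * (f t - f s)"
          by (simp add: algebra_simps)
        finally show ?thesis using r(1) by blast
      qed
    qed
    then obtain r where r: "r \<in> {s..t}" "\<Phi> (f t) - \<Phi> (f s) = \<Phi>' (f r) * (f t - f s)" by auto
    have i: "g integrable_on {s..t}"
      using abs_integrable_subD(2)[OF g, of s t] st by auto
    have iI: "(\<lambda>x. \<Phi>' (f x) * g x) integrable_on {s..t}"
      using abs_integrable_subD(2)[OF I] st by auto
    have iN: "(\<lambda>r. norm (g r)) integrable_on {s..t}"
      using abs_integrable_subD(2)[OF N] st by auto
    have "\<Phi> (f t) - \<Phi> (f s) = integral {s..t} (\<lambda>x. \<Phi>' (f r) * g x)"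
      using primitive_on_diff[OF f] st r(2) by simp
    then have "\<Phi> (f t) - \<Phi> (f s) - integral {s..t} (\<lambda>x. \<Phi>' (f x) * g x)
       = integral {s..t} (\<lambda>x. \<Phi>' (f r) * g x - \<Phi>' (f x) * g x)"
      using i iI by (subst Henstock_Kurzweil_Integration.integral_diff) (auto intro: integrable_on_mult_right)
    also have "norm \<dots> \<le> integral {s..t} (\<lambda>x. \<epsilon> * norm (g x))"
    proof (rule Henstock_Kurzweil_Integration.integral_norm_bound_integral)
      show "(\<lambda>x. \<Phi>' (f r) * g x - \<Phi>' (f x) * g x) integrable_on {s..t}"
        using i iI by (auto intro!: Henstock_Kurzweil_Integration.integrable_diff integrable_on_mult_right)
      show "(\<lambda>x. \<epsilon> * norm (g x)) integrable_on {s..t}"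
        using iN by (rule integrable_on_mult_right)
    next
      fix x assume x: "x \<in> {s..t}"
      have "\<bar>r - x\<bar> < d"
        using x r(1) st by auto
      then have "norm (\<Phi>' (f r) - \<Phi>' (f x)) \<le> \<epsilon>"
        using d(2)[of x r] x r(1) st by simp
      then have "norm ((\<Phi>' (f r) - \<Phi>' (f x)) * g x) \<le> \<epsilon> * norm (g x)"
        unfolding norm_mult by (rule mult_right_mono) simp
      then show "norm (\<Phi>' (f r) * g x - \<Phi>' (f x) * g x) \<le> \<epsilon> * norm (g x)"
        by (simp only: left_diff_distrib)
    qed
    also have "\<dots> = \<epsilon> * (B t - B s)"
      using primitive_on_diff[OF primitive_on_integral[OF N, of 0], of s t] st
      by (simp add: B_def)
    finally show ?thesis .
  qed
  note bound = this
  show "\<exists>d>0. \<forall>s t. a \<le> s \<and> s \<le> t \<and> t \<le> b \<and> t - s < d \<longrightarrow>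
       norm (\<Phi> (f t) - \<Phi> (f s) - integral {s..t} (\<lambda>x. \<Phi>' (f x) * g x)) \<le> \<epsilon> * (B t - B s)"
  proof (intro exI[of _ d] conjI allI impI)
    show "0 < d" by (rule d(1))
  qed (rule bound; simp)
qed

section \<open>Gronwall's inequality and Picard iteration\<close>

lemma integral_mono_on_Icc:
  fixes f g :: "real \<Rightarrow> real"
  assumes "f absolutely_integrable_on {a..b}" "g absolutely_integrable_on {a..b}"
    "\<And>x. x \<in> {a..b} \<Longrightarrow> f x \<le> g x"
  shows "integral {a..b} f \<le> integral {a..b} g"
  using assms unfolding absolutely_integrable_on_def
  by (intro Henstock_Kurzweil_Integration.integral_le) auto

lemma norm_integral_le:
  fixes f :: "real \<Rightarrow> 'a::euclidean_space"
  assumes "f absolutely_integrable_on {a..b}" "g absolutely_integrable_on {a..b}"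
    "\<And>x. x \<in> {a..b} \<Longrightarrow> norm (f x) \<le> g x"
  shows "norm (integral {a..b} f) \<le> integral {a..b} g"
  using assms unfolding absolutely_integrable_on_def
  by (intro Henstock_Kurzweil_Integration.integral_norm_bound_integral) auto

lemma primitive_on_exp:
  fixes f :: "real \<Rightarrow> real"
  assumes "primitive_on a b f g"
  shows "primitive_on a b (\<lambda>x. exp (f x)) (\<lambda>x. exp (f x) * g x)"
  by (rule primitive_on_chain[OF assms]) (auto intro: continuous_intros derivative_eq_intros)

text \<open>The right-hand side of the hypothesis, multiplied by \<open>exp (- \<integral> k)\<close>, is a primitive of a
  nonpositive function.\<close>
lemma gronwall:
  fixes f k :: "real \<Rightarrow> real"
  assumes k: "k absolutely_integrable_on {a..b}" "\<And>x. x \<in> {a..b} \<Longrightarrow> 0 \<le> k x"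
    and f: "continuous_on {a..b} f"
    and le: "\<And>x. x \<in> {a..b} \<Longrightarrow> f x \<le> c + integral {a..x} (\<lambda>s. k s * f s)"
    and x: "x \<in> {a..b}"
  shows "f x \<le> c * exp (integral {a..x} k)"
proof -
  define K where "K = (\<lambda>x. integral {a..x} k)"
  define G where "G = (\<lambda>x. c + integral {a..x} (\<lambda>s. k s * f s))"
  have kf: "(\<lambda>s. k s * f s) absolutely_integrable_on {a..b}"
    using abs_integrable_continuous_mult[OF f k(1)] by (simp add: mult.commute)
  have K: "primitive_on a b K k"
    using primitive_on_integral[OF k(1), of 0] by (simp add: K_def)
  have E: "primitive_on a b (\<lambda>x. exp (- K x)) (\<lambda>x. exp (- K x) * - k x)"
    by (rule primitive_on_exp[OF primitive_on_uminus[OF K]])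
  have G: "primitive_on a b G (\<lambda>s. k s * f s)"
    unfolding G_def by (rule primitive_on_integral[OF kf])
  have GE: "primitive_on a b (\<lambda>x. G x * exp (- K x))
      (\<lambda>x. k x * f x * exp (- K x) + G x * (exp (- K x) * - k x))"
    by (rule primitive_on_mult[OF G E])
  have "G x * exp (- K x) - G a * exp (- K a) = integral {a..x} (\<lambda>x. k x * f x * exp (- K x) + G x * (exp (- K x) * - k x))"
    using primitive_on_diff[OF GE, of a x] x by auto
  also have "\<dots> \<le> integral {a..x} (\<lambda>x. 0)"
  proof (rule integral_mono_on_Icc)
    show "(\<lambda>x. k x * f x * exp (- K x) + G x * (exp (- K x) * - k x)) absolutely_integrable_on {a..x}"
      using abs_integrable_subD(1)[OF primitive_onD(1)[OF GE], of a x] x by auto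
    fix s assume s: "s \<in> {a..x}"
    then have "k s * exp (- K s) * (f s - G s) \<le> 0"
      using le[of s] k(2)[of s] x by (intro mult_nonneg_nonpos) (auto simp: G_def)
    then show "k s * f s * exp (- K s) + G s * (exp (- K s) * - k s) \<le> 0"
      by (simp add: algebra_simps)
  qed auto
  finally have "G x * exp (- K x) \<le> c"
    by (simp add: G_def K_def)
  then have "G x \<le> c * exp (K x)"
    by (simp add: exp_minus field_simps)
  then show ?thesis
    using le[OF x] by (simp add: G_def K_def)
qed

text \<open>With an integrable Lipschitz rate \<open>k\<close>, Picard iteration contracts by \<open>1/2\<close> in the sup norm weighted with
  \<open>exp (- 2 \<integral> k)\<close>, because \<open>\<integral> k exp (2 \<integral> k) \<le> exp (2 \<integral> k) / 2\<close>. It therefore converges on the whole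
  interval at once. Measurability enters only through the integrability of the
  right-hand side along continuous curves.\<close>

lemma caratheodory_exists:
  fixes f :: "real \<Rightarrow> 'a::euclidean_space \<Rightarrow> 'a" and k :: "real \<Rightarrow> real"
  assumes ab: "a \<le> b" and k: "k absolutely_integrable_on {a..b}"
    and f: "\<And>X. continuous_on {a..b} X \<Longrightarrow> (\<lambda>s. f s (X s)) absolutely_integrable_on {a..b}"
    and lip: "\<And>s x y. s \<in> {a..b} \<Longrightarrow> norm (f s x - f s y) \<le> k s * norm (x - y)"
  shows "\<exists>X. X a = c \<and> primitive_on a b X (\<lambda>s. f s (X s))"
proof -
  define X where "X = rec_nat (\<lambda>_. c) (\<lambda>_ Y x. c + integral {a..x} (\<lambda>s. f s (Y s)))"
  have X0: "X 0 = (\<lambda>_. c)" and XSuc: "X (Suc n) = (\<lambda>x. c + integral {a..x} (\<lambda>s. f s (X n s)))" for n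
    by (auto simp: X_def)
  have Xc: "continuous_on {a..b} (X n)" for n
  proof (induction n)
    case (Suc n)
    show ?case
      unfolding XSuc by (rule primitive_on_continuous[OF primitive_on_integral[OF f[OF Suc]]])
  qed (simp add: X0)
  have Xp: "primitive_on a b (X (Suc n)) (\<lambda>s. f s (X n s))" for n
    unfolding XSuc by (rule primitive_on_integral[OF f[OF Xc]])
  define K where "K = (\<lambda>x. 2 * integral {a..x} k)"
  have Kp: "primitive_on a b K (\<lambda>x. 2 * k x)"
    using primitive_on_linear[OF primitive_on_integral[OF k, of 0] bounded_linear_mult_right[of 2]]
    by (simp add: K_def)
  have Ep: "primitive_on a b (\<lambda>x. exp (K x)) (\<lambda>x. exp (K x) * (2 * k x))"
    by (rule primitive_on_exp[OF Kp])
  have k0: "0 \<le> k s" if "s \<in> {a..b}" for s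
  proof -
    obtain u :: 'a where "norm u = 1" using norm_Basis nonempty_Basis by blast
    have "0 \<le> k s * norm (u - 0)"
      using lip[OF that, of u 0] norm_ge_zero order_trans by blast
    then show ?thesis by (simp add: \<open>norm u = 1\<close>)
  qed
  have "bounded ((\<lambda>x. X 1 x - X 0 x) ` {a..b})"
    by (intro compact_imp_bounded compact_continuous_image continuous_on_diff Xc) auto
  then obtain C where C: "\<And>x. x \<in> {a..b} \<Longrightarrow> norm (X 1 x - X 0 x) \<le> C" and C0: "C \<ge> 0"
    unfolding bounded_pos by fastforce
  have Kmono: "0 \<le> K x \<and> K x \<le> K b" if x: "x \<in> {a..b}" for x
  proof -
    have "0 \<le> integral {s..t} (\<lambda>x. 2 * k x)" if "a \<le> s" "t \<le> b" for s t
      using abs_integrable_subD(2)[OF primitive_onD(1)[OF Kp] that] k0 that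
      by (intro Henstock_Kurzweil_Integration.integral_nonneg) auto
    from this[of a x] this[of x b] show ?thesis
      using primitive_on_diff[OF Kp, of a x] primitive_on_diff[OF Kp, of x b] x
      by (auto simp: K_def)
  qed
  have est: "norm (X (Suc n) x - X n x) \<le> C * (1/2)^n * exp (K x)" if "x \<in> {a..b}" for n x
    using that
  proof (induction n arbitrary: x)
    case 0
    have "C * 1 \<le> C * exp (K x)"
      using Kmono[OF 0] C0 by (intro mult_left_mono) auto
    then show ?case using C[OF 0] by simp
  next
    case (Suc n)
    have i: "(\<lambda>s. f s (X m s)) absolutely_integrable_on {a..x}" for m
      using abs_integrable_subD(1)[OF f[OF Xc], of a x] Suc.prems by auto
    have iE: "(\<lambda>s. C * (1/2)^Suc n * (exp (K s) * (2 * k s))) absolutely_integrable_on {a..x}"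
      using abs_integrable_subD(1)[OF primitive_onD(1)[OF Ep], of a x] Suc.prems
      by (intro set_integrable_mult_right) auto
    have "X (Suc (Suc n)) x - X (Suc n) x = integral {a..x} (\<lambda>s. f s (X (Suc n) s) - f s (X n s))"
      using i[of n] i[of "Suc n"] unfolding XSuc[of "Suc n"] XSuc[of n] absolutely_integrable_on_def
      by (simp add: Henstock_Kurzweil_Integration.integral_diff)
    also have "norm \<dots> \<le> integral {a..x} (\<lambda>s. C * (1/2)^Suc n * (exp (K s) * (2 * k s)))"
    proof (rule norm_integral_le[OF _ iE])
      show "(\<lambda>s. f s (X (Suc n) s) - f s (X n s)) absolutely_integrable_on {a..x}"
        by (intro set_integral_diff(1) i)
      fix s assume s: "s \<in> {a..x}"
      then have s': "s \<in> {a..b}" using Suc.prems by auto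
      have "norm (f s (X (Suc n) s) - f s (X n s)) \<le> k s * norm (X (Suc n) s - X n s)"
        by (rule lip[OF s'])
      also have "\<dots> \<le> k s * (C * (1/2)^n * exp (K s))"
        by (intro mult_left_mono Suc.IH s' k0)
      finally show "norm (f s (X (Suc n) s) - f s (X n s)) \<le> C * (1/2)^Suc n * (exp (K s) * (2 * k s))"
        by (simp add: algebra_simps)
    qed
    also have "\<dots> = C * (1/2)^Suc n * integral {a..x} (\<lambda>s. exp (K s) * (2 * k s))"
      by (rule Henstock_Kurzweil_Integration.integral_mult_right)
    also have "\<dots> = C * (1/2)^Suc n * (exp (K x) - exp (K a))"
      using primitive_on_diff[OF Ep, of a x] Suc.prems by auto
    also have "\<dots> \<le> C * (1/2)^Suc n * exp (K x)"
      using C0 by (intro mult_left_mono) auto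
    finally show ?case .
  qed
  have "uniform_limit {a..b} (\<lambda>n x. \<Sum>i<n. X (Suc i) x - X i x) (\<lambda>x. \<Sum>i. X (Suc i) x - X i x) sequentially"
  proof (rule Weierstrass_m_test)
    show "summable (\<lambda>n. C * (1/2)^n * exp (K b))"
      by (intro summable_mult summable_mult2 summable_geometric) auto
    fix n x assume x: "x \<in> {a..b}"
    have "C * (1/2)^n * exp (K x) \<le> C * (1/2)^n * exp (K b)"
      using Kmono[OF x] C0 by (intro mult_left_mono) auto
    then show "norm (X (Suc n) x - X n x) \<le> C * (1/2)^n * exp (K b)"
      using est[OF x, of n] by linarith
  qed
  moreover have "(\<Sum>i<n. X (Suc i) x - X i x) = X n x - c" for n x
    using sum_lessThan_telescope[of "\<lambda>i. X i x" n] by (simp add: X0)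
  ultimately have "uniform_limit {a..b} (\<lambda>n x. X n x - c) (\<lambda>x. \<Sum>i. X (Suc i) x - X i x) sequentially"
    by simp
  then have U: "uniform_limit {a..b} (\<lambda>n x. (X n x - c) + c) (\<lambda>x. (\<Sum>i. X (Suc i) x - X i x) + c) sequentially"
    by (intro uniform_limit_add uniform_limit_const)
  define Y where "Y = (\<lambda>x. (\<Sum>i. X (Suc i) x - X i x) + c)"
  have U: "uniform_limit {a..b} X Y sequentially"
    using U by (simp add: Y_def)
  have Yc: "continuous_on {a..b} Y"
    by (rule uniform_limit_theorem[OF _ U]) (auto simp: Xc)
  have "Y x = c + integral {a..x} (\<lambda>s. f s (Y s))" if x: "x \<in> {a..b}" for x
  proof -
    have i: "(\<lambda>s. f s (Z s)) absolutely_integrable_on {a..x}" if "continuous_on {a..b} Z" for Z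
      using abs_integrable_subD(1)[OF f[OF that], of a x] x by auto
    have kx: "k absolutely_integrable_on {a..x}"
      using abs_integrable_subD(1)[OF k, of a x] x by auto
    have "(\<lambda>n. integral {a..x} (\<lambda>s. f s (X n s))) \<longlonglongrightarrow> integral {a..x} (\<lambda>s. f s (Y s))"
    proof (rule LIMSEQ_I)
      fix e :: real assume "e > 0"
      define D where "D = integral {a..x} k + 1"
      have "0 \<le> integral {a..x} k"
        using kx k0 x unfolding absolutely_integrable_on_def
        by (intro Henstock_Kurzweil_Integration.integral_nonneg) auto
      then have D: "D > 0" "integral {a..x} k < D" by (auto simp: D_def)
      obtain N where N: "\<And>n s. n \<ge> N \<Longrightarrow> s \<in> {a..b} \<Longrightarrow> dist (X n s) (Y s) < e / D"
        using uniform_limitD[OF U divide_pos_pos[OF \<open>e > 0\<close> D(1)]]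
        unfolding eventually_sequentially by blast
      have "norm (integral {a..x} (\<lambda>s. f s (X n s)) - integral {a..x} (\<lambda>s. f s (Y s))) < e" if "n \<ge> N" for n
      proof -
        have "integral {a..x} (\<lambda>s. f s (X n s)) - integral {a..x} (\<lambda>s. f s (Y s)) = integral {a..x} (\<lambda>s. f s (X n s) - f s (Y s))"
          using i[OF Xc, of n] i[OF Yc] unfolding absolutely_integrable_on_def
          by (simp add: Henstock_Kurzweil_Integration.integral_diff)
        also have "norm \<dots> \<le> integral {a..x} (\<lambda>s. e / D * k s)"
        proof (rule norm_integral_le)
          show "(\<lambda>s. f s (X n s) - f s (Y s)) absolutely_integrable_on {a..x}"
            by (intro set_integral_diff(1) i Xc Yc)
          show "(\<lambda>s. e / D * k s) absolutely_integrable_on {a..x}"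
            using kx by (intro set_integrable_mult_right) auto
          fix s assume s: "s \<in> {a..x}"
          then have s': "s \<in> {a..b}" using x by auto
          have "norm (f s (X n s) - f s (Y s)) \<le> k s * norm (X n s - Y s)"
            by (rule lip[OF s'])
          also have "\<dots> \<le> k s * (e / D)"
            using N[OF \<open>n \<ge> N\<close> s'] k0[OF s'] by (intro mult_left_mono) (auto simp: dist_norm)
          finally show "norm (f s (X n s) - f s (Y s)) \<le> e / D * k s"
            by (simp add: mult.commute)
        qed
        also have "\<dots> = e / D * integral {a..x} k" by simp
        also have "\<dots> < e / D * D"
          using D \<open>e > 0\<close> by (intro mult_strict_left_mono) auto
        also have "\<dots> = e" using D by simp
        finally show ?thesis .
      qed
      then show "\<exists>N. \<forall>n\<ge>N. norm (integral {a..x} (\<lambda>s. f s (X n s)) - integral {a..x} (\<lambda>s. f s (Y s))) < e"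
        by blast
    qed
    then have "(\<lambda>n. X (Suc n) x) \<longlonglongrightarrow> c + integral {a..x} (\<lambda>s. f s (Y s))"
      unfolding XSuc by (intro tendsto_add tendsto_const)
    moreover have "(\<lambda>n. X (Suc n) x) \<longlonglongrightarrow> Y x"
      by (rule LIMSEQ_Suc[OF tendsto_uniform_limitI[OF U x]])
    ultimately show ?thesis
      using LIMSEQ_unique by blast
  qed
  note eq = this
  have "Y a = c" using eq[of a] ab by simp
  moreover have "primitive_on a b Y (\<lambda>s. f s (Y s))"
    by (rule primitive_on_intro_diff[OF f[OF Yc]]) (simp add: \<open>Y a = c\<close> eq)
  ultimately show ?thesis by blast
qed

section \<open>Riemann--Stieltjes integrals against functions of bounded variation\<close>

definition variation :: "(real \<Rightarrow> real) \<Rightarrow> real \<Rightarrow> real \<Rightarrow> real" where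
  "variation \<mu> a x = (SUP D\<in>{D. D division_of {a..x}}. \<Sum>K\<in>D. \<bar>\<mu> (Sup K) - \<mu> (Inf K)\<bar>)"

lemma division_of_append:
  fixes a b c :: real
  assumes "D division_of {a..b}" "a \<le> b" "b < c"
  shows "insert {b..c} D division_of {a..c}" "{b..c} \<notin> D"
proof -
  have D: "\<Union>D = {a..b}" "finite D"
    "\<And>K. K \<in> D \<Longrightarrow> K \<subseteq> {a..b} \<and> K \<noteq> {} \<and> (\<exists>s t. K = cbox s t)"
    "\<And>K L. K \<in> D \<Longrightarrow> L \<in> D \<Longrightarrow> K \<noteq> L \<Longrightarrow> interior K \<inter> interior L = {}"
    using division_ofD[OF assms(1)] by (simp, simp, metis, metis)
  have "c \<notin> \<Union>D"
    using D(1) assms(3) by simp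
  moreover have "c \<in> {b..c}" using assms(3) by simp
  ultimately show "{b..c} \<notin> D" by blast
  have int: "interior {b..c} \<inter> interior K = {}" if "K \<in> D" for K
  proof -
    have "interior K \<subseteq> interior {a..b}"
      using D(3)[OF that] by (intro interior_mono) auto
    then show ?thesis by (auto simp: interior_atLeastAtMost_real)
  qed
  show "insert {b..c} D division_of {a..c}"
  proof (rule division_ofI)
    show "finite (insert {b..c} D)" using D(2) by simp
    show "\<Union>(insert {b..c} D) = {a..c}"
      using D(1) assms(2,3) by auto
  next
    fix K assume K: "K \<in> insert {b..c} D"
    have sub: "{b..c} \<subseteq> {a..c}" "{a..b} \<subseteq> {a..c}" "{b..c} \<noteq> {}"
      using assms(2,3) by auto
    show "K \<subseteq> {a..c}" "K \<noteq> {}"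
      using K D(3)[of K] sub by blast+
    show "\<exists>s t. K = cbox s t"
      using K D(3)[of K] unfolding insert_iff by (metis box_real(2))
  next
    fix K L assume "K \<in> insert {b..c} D" "L \<in> insert {b..c} D" "K \<noteq> L"
    then show "interior K \<inter> interior L = {}"
      using int D(4)[of K L] by blast
  qed
qed

lemma bounded_variation_sum_le:
  fixes \<mu> :: "real \<Rightarrow> real"
  assumes B: "\<And>D. D division_of {a..b} \<Longrightarrow> (\<Sum>K\<in>D. \<bar>\<mu> (Sup K) - \<mu> (Inf K)\<bar>) \<le> B"
    and D: "D division_of {a..x}" "a \<le> x" "x \<le> b"
  shows "(\<Sum>K\<in>D. \<bar>\<mu> (Sup K) - \<mu> (Inf K)\<bar>) \<le> (B::real)"
proof (cases "x = b")
  case False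
  then have xb: "x < b" using D(3) by linarith
  have "(\<Sum>K\<in>D. \<bar>\<mu> (Sup K) - \<mu> (Inf K)\<bar>) \<le> (\<Sum>K\<in>insert {x..b} D. \<bar>\<mu> (Sup K) - \<mu> (Inf K)\<bar>)"
    using division_of_append(2)[OF D(1,2) xb] division_of_finite[OF D(1)] by simp
  also have "\<dots> \<le> B"
    by (rule B[OF division_of_append(1)[OF D(1,2) xb]])
  finally show ?thesis .
qed (use B D in simp)

text \<open>A division of \<open>[a,s]\<close> extends by \<open>[s,t]\<close> to a division of \<open>[a,t]\<close>. So the increments of \<open>\<mu>\<close> are
  dominated by those of the monotone function \<open>variation \<mu> a\<close>.\<close>
lemma variation_step:
  assumes "bounded_variation_on \<mu> a b" "a \<le> s" "s \<le> t" "t \<le> b"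
  shows "\<bar>\<mu> t - \<mu> s\<bar> \<le> variation \<mu> a t - variation \<mu> a s"
proof (cases "s = t")
  case False
  then have st: "s < t" using assms by simp
  define S where "S = (\<lambda>D. \<Sum>K\<in>D. \<bar>\<mu> (Sup K) - \<mu> (Inf K)\<bar>)"
  obtain B where B: "\<And>D. D division_of {a..b} \<Longrightarrow> S D \<le> B"
    using assms(1) unfolding bounded_variation_on_def S_def by blast
  have bdd: "bdd_above (S ` {D. D division_of {a..t}})"
  proof (rule bdd_aboveI2)
    fix D assume "D \<in> {D. D division_of {a..t}}"
    then show "S D \<le> B"
      using bounded_variation_sum_le[of a b \<mu> B D t] B assms unfolding S_def by auto
  qed
  have "variation \<mu> a s \<le> variation \<mu> a t - \<bar>\<mu> t - \<mu> s\<bar>"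
    unfolding variation_def
  proof (rule cSUP_least)
    show "{D. D division_of {a..s}} \<noteq> {}"
      using elementary_interval[of a s] assms by (auto simp: box_real)
  next
    fix D assume "D \<in> {D. D division_of {a..s}}"
    then have D: "D division_of {a..s}" by simp
    have "S D + \<bar>\<mu> t - \<mu> s\<bar> = S (insert {s..t} D)"
      unfolding S_def using division_of_append(2)[OF D _ st] division_of_finite[OF D] assms st by simp
    also have "\<dots> \<le> (SUP D\<in>{D. D division_of {a..t}}. S D)"
      using division_of_append(1)[OF D _ st] assms by (intro cSUP_upper bdd) auto
    finally show "(\<Sum>K\<in>D. \<bar>\<mu> (Sup K) - \<mu> (Inf K)\<bar>) \<le> (SUP D\<in>{D. D division_of {a..t}}. \<Sum>K\<in>D. \<bar>\<mu> (Sup K) - \<mu> (Inf K)\<bar>) - \<bar>\<mu> t - \<mu> s\<bar>"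
      unfolding S_def by simp
  qed
  then show ?thesis by simp
qed simp

text \<open>By the Jordan decomposition into \<open>variation \<mu> a\<close> and \<open>variation \<mu> a - \<mu>\<close>, both monotone.\<close>
lemma bounded_variation_bounded_measurable:
  assumes "bounded_variation_on \<mu> a b"
  shows "bounded_measurable {a..b} \<mu>"
proof -
  let ?V = "variation \<mu> a"
  have step: "\<bar>\<mu> t - \<mu> s\<bar> \<le> ?V t - ?V s" if "s \<in> {a..b}" "t \<in> {a..b}" "s \<le> t" for s t
    using variation_step[OF assms] that by auto
  have "mono_on {a..b} ?V" "mono_on {a..b} (\<lambda>x. ?V x - \<mu> x)"
    using step by (auto intro!: mono_onI) (smt (verit) atLeastAtMost_iff step)+
  then have "integrable (lebesgue_on {a..b}) ?V" "integrable (lebesgue_on {a..b}) (\<lambda>x. ?V x - \<mu> x)"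
    by (simp_all add: integrable_mono_on)
  then have "(\<lambda>x. ?V x - (?V x - \<mu> x)) \<in> borel_measurable (lebesgue_on {a..b})"
    by (intro borel_measurable_diff borel_measurable_integrable)
  moreover have "bounded (\<mu> ` {a..b})"
    unfolding bounded_iff
  proof (rule exI[of _ "\<bar>\<mu> a\<bar> + (?V b - ?V a)"], safe)
    fix x assume x: "x \<in> {a..b}"
    then show "norm (\<mu> x) \<le> \<bar>\<mu> a\<bar> + (?V b - ?V a)"
      using step[of a x] step[of x b] by auto
  qed
  ultimately show ?thesis
    unfolding bounded_measurable_def by simp
qed

lemma bounded_measurable_of_real:
  assumes "bounded_measurable {a..b} (f :: real \<Rightarrow> real)"
  shows "bounded_measurable {a..b} (\<lambda>x. complex_of_real (f x))"
  using assms unfolding bounded_measurable_def bounded_iff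
  by (auto intro!: borel_measurable_of_real)

text \<open>Integration by parts. On a piece \<open>[s,t]\<close> with tag \<open>\<tau>\<close>, the Riemann--Stieltjes term differs from the
  increment of \<open>J = \<mu> y - \<integral> \<mu> v\<close> by \<open>\<integral> (\<mu> - \<mu> s) v\<close> over \<open>[s,\<tau>]\<close> plus \<open>\<integral> (\<mu> - \<mu> t) v\<close> over \<open>[\<tau>,t]\<close>.
  This is at most the variation of \<open>\<mu>\<close> on \<open>[s,t]\<close> times \<open>\<integral> \<bar>v\<bar>\<close> over \<open>[s,t]\<close>, and the second factor
  is uniformly small when the mesh is. So a constant gauge suffices, and jumps of \<open>\<mu>\<close>, at the endpoints or
  inside, do no harm.\<close>

lemma has_RS_integral_primitive:
  fixes y v :: "real \<Rightarrow> complex"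
  assumes ab: "a \<le> b" and \<mu>: "bounded_variation_on \<mu> a b" and y: "primitive_on a b y v"
  shows "has_RS_integral y \<mu> a b (\<mu> b * y b - \<mu> a * y a - integral {a..b} (\<lambda>s. \<mu> s * v s))"
proof -
  let ?V = "variation \<mu> a"
  define \<nu> where "\<nu> = (\<lambda>x. complex_of_real (\<mu> x))"
  have step: "norm (\<nu> t - \<nu> s) \<le> ?V t - ?V s" if "a \<le> s" "s \<le> t" "t \<le> b" for s t
    using variation_step[OF \<mu> that] by (simp add: \<nu>_def of_real_diff[symmetric] del: of_real_diff)
  have \<nu>v: "(\<lambda>s. \<nu> s * v s) absolutely_integrable_on {a..b}"
    unfolding \<nu>_def
    by (intro abs_integrable_mult bounded_measurable_of_real bounded_variation_bounded_measurable \<mu> primitive_onD(1)[OF y])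
  have v: "v absolutely_integrable_on {a..b}"
    by (rule primitive_onD(1)[OF y])
  define N where "N = (\<lambda>x. integral {a..x} (\<lambda>s. norm (v s)))"
  have Np: "primitive_on a b N (\<lambda>s. norm (v s))"
    using primitive_on_integral[OF abs_integrable_subD(4)[OF v order_refl order_refl], of 0] by (simp add: N_def)
  note Nc = primitive_on_continuous[OF Np]
  define J where "J = (\<lambda>x. \<nu> x * y x - integral {a..x} (\<lambda>s. \<nu> s * v s))"
  have Jp: "primitive_on a b (\<lambda>x. integral {a..x} (\<lambda>s. \<nu> s * v s)) (\<lambda>s. \<nu> s * v s)"
    using primitive_on_integral[OF \<nu>v, of 0] by simp
  have local: "norm (y \<tau> * (\<nu> t - \<nu> s) - (J t - J s)) \<le> (N t - N s) * (?V t - ?V s)"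
    if st: "a \<le> s" "s \<le> \<tau>" "\<tau> \<le> t" "t \<le> b" for s \<tau> t
  proof -
    have iv: "(\<lambda>s. c * v s) absolutely_integrable_on {p..q}" "(\<lambda>s. \<nu> s * v s) absolutely_integrable_on {p..q}"
      if "a \<le> p" "q \<le> b" for c p q
      using abs_integrable_subD(1)[OF v that] abs_integrable_subD(1)[OF \<nu>v that] by (auto intro: set_integrable_mult_right)
    have I: "norm (integral {p..q} (\<lambda>r. (\<nu> r - c) * v r)) \<le> (N q - N p) * (?V t - ?V s)"
      if pq: "s \<le> p" "p \<le> q" "q \<le> t" and c: "\<And>r. r \<in> {p..q} \<Longrightarrow> norm (\<nu> r - c) \<le> ?V t - ?V s" for p q c
    proof -
      have "norm (integral {p..q} (\<lambda>r. (\<nu> r - c) * v r)) \<le> integral {p..q} (\<lambda>r. norm (v r) * (?V t - ?V s))"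
      proof (rule norm_integral_le)
        show "(\<lambda>r. (\<nu> r - c) * v r) absolutely_integrable_on {p..q}"
          using set_integral_diff(1)[OF iv(2)[of p q] iv(1)[of p q c]] pq st by (simp add: left_diff_distrib)
        show "(\<lambda>r. norm (v r) * (?V t - ?V s)) absolutely_integrable_on {p..q}"
          using abs_integrable_subD(4)[OF v, of p q] pq st by (intro set_integrable_mult_left) auto
        show "norm ((\<nu> r - c) * v r) \<le> norm (v r) * (?V t - ?V s)" if "r \<in> {p..q}" for r
          using mult_right_mono[OF c[OF that], of "norm (v r)"] by (simp add: norm_mult mult.commute)
      qed
      also have "\<dots> = integral {p..q} (\<lambda>r. norm (v r)) * (?V t - ?V s)"
        by (rule Henstock_Kurzweil_Integration.integral_mult_left)
      also have "\<dots> = (N q - N p) * (?V t - ?V s)"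
        using primitive_on_diff[OF Np, of p q] pq st by auto
      finally show ?thesis .
    qed
    have D: "integral {p..q} (\<lambda>r. (\<nu> r - c) * v r) = integral {p..q} (\<lambda>r. \<nu> r * v r) - c * integral {p..q} v"
      if "a \<le> p" "q \<le> b" for p q c
    proof -
      have "integral {p..q} (\<lambda>r. \<nu> r * v r - c * v r) = integral {p..q} (\<lambda>r. \<nu> r * v r) - integral {p..q} (\<lambda>r. c * v r)"
        using iv[OF that] unfolding absolutely_integrable_on_def
        by (intro Henstock_Kurzweil_Integration.integral_diff) auto
      then show ?thesis by (simp add: left_diff_distrib)
    qed
    have "y \<tau> * (\<nu> t - \<nu> s) - (J t - J s)
        = integral {s..\<tau>} (\<lambda>r. \<nu> r * v r) - \<nu> s * (y \<tau> - y s) + (integral {\<tau>..t} (\<lambda>r. \<nu> r * v r) - \<nu> t * (y t - y \<tau>))"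
      using primitive_on_diff[OF Jp, of s \<tau>] primitive_on_diff[OF Jp, of \<tau> t] st
      by (simp add: J_def algebra_simps)
    also have "\<dots> = integral {s..\<tau>} (\<lambda>r. (\<nu> r - \<nu> s) * v r) + integral {\<tau>..t} (\<lambda>r. (\<nu> r - \<nu> t) * v r)"
      using D[of s \<tau>] D[of \<tau> t] primitive_on_diff[OF y, of s \<tau>] primitive_on_diff[OF y, of \<tau> t] st by simp
    also have "norm \<dots> \<le> (N \<tau> - N s) * (?V t - ?V s) + (N t - N \<tau>) * (?V t - ?V s)"
    proof (intro order_trans[OF norm_triangle_ineq] add_mono I)
      fix r assume r: "r \<in> {s..\<tau>}"
      show "norm (\<nu> r - \<nu> s) \<le> ?V t - ?V s"
        using step[of s r] step[of r t] norm_ge_zero[of "\<nu> t - \<nu> r"] r st by (auto simp del: norm_ge_zero)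
    next
      fix r assume r: "r \<in> {\<tau>..t}"
      show "norm (\<nu> r - \<nu> t) \<le> ?V t - ?V s"
        using step[of s r] step[of r t] norm_ge_zero[of "\<nu> r - \<nu> s"] r st by (auto simp: norm_minus_commute simp del: norm_ge_zero)
    qed (use st in auto)
    finally show ?thesis by (simp add: algebra_simps)
  qed
  have "\<exists>d>0. \<forall>p. p tagged_division_of {a..b} \<and> (\<lambda>x. ball x d) fine p \<longrightarrow>
        cmod ((\<Sum>(t, K)\<in>p. y t * of_real (\<mu> (Sup K) - \<mu> (Inf K))) - (J b - J a)) < e" if "e > 0" for e
  proof -
    define e' where "e' = e / (?V b - ?V a + 1)"
    have Vab: "0 \<le> ?V b - ?V a" using step[of a b] ab norm_ge_zero order_trans by blast
    have e': "e' > 0" using \<open>e > 0\<close> Vab by (simp add: e'_def)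
    obtain d where d: "d > 0" "\<And>s t. s \<in> {a..b} \<Longrightarrow> t \<in> {a..b} \<Longrightarrow> \<bar>t - s\<bar> < d \<Longrightarrow> norm (N t - N s) < e'"
      using uniform_continuityD[OF Nc e'] by blast
    have "cmod ((\<Sum>(t, K)\<in>p. y t * of_real (\<mu> (Sup K) - \<mu> (Inf K))) - (J b - J a)) < e"
      if p: "p tagged_division_of {a..b}" "(\<lambda>x. ball x (d/2)) fine p" for p
    proof -
      have "(\<Sum>(t, K)\<in>p. y t * of_real (\<mu> (Sup K) - \<mu> (Inf K))) - (J b - J a)
          = (\<Sum>(t, K)\<in>p. y t * (\<nu> (Sup K) - \<nu> (Inf K)) - (J (Sup K) - J (Inf K)))"
        unfolding additive_tagged_division_1[OF ab p(1), of J, symmetric] sum_subtractf[symmetric]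
        by (intro sum.cong) (auto simp: \<nu>_def)
      also have "norm \<dots> \<le> (\<Sum>(t, K)\<in>p. e' * (?V (Sup K) - ?V (Inf K)))"
      proof (rule sum_norm_le, safe)
        fix x K assume xK: "(x, K) \<in> p"
        obtain s t where K: "K = {s..t}" "s \<le> t" "a \<le> s" "t \<le> b" "s \<le> x" "x \<le> t"
          using tagged_division_ofD(2-4)[OF p(1) xK] by fastforce
        have "K \<subseteq> ball x (d/2)"
          using p(2) xK unfolding fine_def by auto
        then have "dist x s < d/2" "dist x t < d/2"
          using K(2) unfolding K(1) by auto
        then have "\<bar>t - s\<bar> < d"
          unfolding dist_real_def by linarith
        then have "N t - N s \<le> e'"
          using d(2)[of s t] K by auto
        moreover have "0 \<le> ?V t - ?V s"
          using step[of s t] K norm_ge_zero order_trans by blast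
        ultimately have "(N t - N s) * (?V t - ?V s) \<le> e' * (?V t - ?V s)"
          by (rule mult_right_mono)
        then show "norm (y x * (\<nu> (Sup K) - \<nu> (Inf K)) - (J (Sup K) - J (Inf K))) \<le> e' * (?V (Sup K) - ?V (Inf K))"
          using local[of s x t] K by simp
      qed
      also have "\<dots> = e' * (?V b - ?V a)"
        using additive_tagged_division_1[OF ab p(1), of ?V]
        by (simp add: sum_distrib_left[symmetric] case_prod_unfold)
      also have "\<dots> < e' * (?V b - ?V a + 1)"
        using e' by (intro mult_strict_left_mono) auto
      also have "\<dots> = e" using Vab by (simp add: e'_def)
      finally show ?thesis .
    qed
    then show ?thesis using d(1) by (intro exI[of _ "d/2"]) auto
  qed
  note main = this
  have eq: "J b - J a = \<mu> b * y b - \<mu> a * y a - integral {a..b} (\<lambda>s. \<mu> s * v s)"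
    by (simp add: J_def \<nu>_def)
  show ?thesis
    unfolding has_RS_integral_def eq[symmetric] by (intro allI impI) (rule main)
qed

lemma has_RS_integral_unique:
  assumes "has_RS_integral f \<mu> a b I" "has_RS_integral f \<mu> a b J"
  shows "I = J"
proof (rule ccontr)
  assume "I \<noteq> J"
  define e where "e = cmod (I - J) / 2"
  have e: "e > 0" using \<open>I \<noteq> J\<close> by (simp add: e_def)
  define S where "S = (\<lambda>p. \<Sum>(t, K)\<in>p. f t * complex_of_real (\<mu> (Sup K) - \<mu> (Inf K)))"
  obtain d1 where d1: "d1 > 0" "\<forall>p. p tagged_division_of {a..b} \<and> (\<lambda>x. ball x d1) fine p \<longrightarrow> cmod (S p - I) < e"
    using assms(1)[unfolded has_RS_integral_def, rule_format, OF e]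
    by (elim exE conjE) (rule that, assumption, simp only: S_def)
  obtain d2 where d2: "d2 > 0" "\<forall>p. p tagged_division_of {a..b} \<and> (\<lambda>x. ball x d2) fine p \<longrightarrow> cmod (S p - J) < e"
    using assms(2)[unfolded has_RS_integral_def, rule_format, OF e]
    by (elim exE conjE) (rule that, assumption, simp only: S_def)
  have "gauge (\<lambda>x::real. ball x (min d1 d2))" using d1 d2 by auto
  then obtain p where p: "p tagged_division_of {a..b}" "(\<lambda>x. ball x (min d1 d2)) fine p"
    by (rule fine_division_exists_real)
  have "(\<lambda>x. ball x d1) fine p" "(\<lambda>x. ball x d2) fine p"
    using p(2) ball_min_Int unfolding fine_def by blast+
  then have "cmod (S p - I) < e" "cmod (S p - J) < e"
    using d1(2) d2(2) p(1) by blast+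
  then have "cmod ((S p - J) - (S p - I)) < e + e"
    using norm_triangle_ineq4[of "S p - J" "S p - I"] by linarith
  then show False by (simp add: e_def)
qed

section \<open>The quasi-derivative system\<close>

lemma abs_integrable_Pair:
  fixes g :: "real \<Rightarrow> 'a::euclidean_space" and h :: "real \<Rightarrow> 'b::euclidean_space"
  assumes "g absolutely_integrable_on S" "h absolutely_integrable_on S"
  shows "(\<lambda>x. (g x, h x)) absolutely_integrable_on S"
proof -
  have "(\<lambda>x. (g x, 0::'b)) absolutely_integrable_on S" "(\<lambda>x. (0::'a, h x)) absolutely_integrable_on S"
    using absolutely_integrable_linear[OF assms(1), of "\<lambda>z. (z, 0::'b)"]
      absolutely_integrable_linear[OF assms(2), of "\<lambda>z. (0::'a, z)"]
    by (simp_all add: o_def bounded_linear_Pair bounded_linear_ident bounded_linear_zero)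
  from set_integral_add(1)[OF this] show ?thesis by simp
qed

locale measure_sturm_liouville =
  fixes w \<mu> :: "real \<Rightarrow> real"
  assumes w_integrable: "w absolutely_integrable_on {0..1}"
    and w_pos: "AE x in lebesgue. x \<in> {0..1} \<longrightarrow> w x > 0"
    and \<mu>_bv: "bounded_variation_on \<mu> 0 1"
begin

text \<open>The variable \<open>u\<close> is the quasi-derivative \<open>y\<^sup>\<bullet> - \<mu> y\<close>. The first equation reads \<open>y' = y\<^sup>\<bullet>\<close>; the second
  is the measure equation after integration by parts.\<close>
definition quasi_solution :: "complex \<Rightarrow> (real \<Rightarrow> complex) \<Rightarrow> (real \<Rightarrow> complex) \<Rightarrow> bool" where
  "quasi_solution \<zeta> y u \<longleftrightarrow>
     primitive_on 0 1 y (\<lambda>s. u s + of_real (\<mu> s) * y s) \<and>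
     primitive_on 0 1 u (\<lambda>s. - (of_real (\<mu> s) * (u s + of_real (\<mu> s) * y s)) - \<zeta> * (of_real (w s) * y s))"

lemma quasi_solutionD:
  assumes "quasi_solution \<zeta> y u"
  shows "primitive_on 0 1 y (\<lambda>s. u s + of_real (\<mu> s) * y s)"
    "primitive_on 0 1 u (\<lambda>s. - (of_real (\<mu> s) * (u s + of_real (\<mu> s) * y s)) - \<zeta> * (of_real (w s) * y s))"
    "continuous_on {0..1} y" "continuous_on {0..1} u"
  using assms primitive_on_continuous unfolding quasi_solution_def by blast+

lemma \<mu>_measurable: "bounded_measurable {0..1} \<mu>" "bounded_measurable {0..1} (\<lambda>s. complex_of_real (\<mu> s))"
  using bounded_variation_bounded_measurable[OF \<mu>_bv] bounded_measurable_of_real by blast+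

lemma wc_integrable: "(\<lambda>s. complex_of_real (w s)) absolutely_integrable_on {0..1}"
  using absolutely_integrable_linear[OF w_integrable bounded_linear_of_real] by (simp add: o_def)

lemma w_mult_integrable:
  assumes "continuous_on {0..1} y"
  shows "(\<lambda>s. complex_of_real (w s) * y s) absolutely_integrable_on {0..1}"
  using abs_integrable_continuous_mult[OF assms wc_integrable] by (simp add: mult.commute)

lemma rhs_integrable:
  assumes y: "continuous_on {0..1} y" and u: "continuous_on {0..1} u"
  shows "(\<lambda>s. u s + of_real (\<mu> s) * y s :: complex) absolutely_integrable_on {0..1}" (is ?A)
    and "(\<lambda>s. - (of_real (\<mu> s) * (u s + of_real (\<mu> s) * y s)) - \<zeta> * (of_real (w s) * y s)) absolutely_integrable_on {0..1}"
proof -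
  show ?A
    by (intro set_integral_add(1) abs_integrable_mult \<mu>_measurable absolutely_integrable_continuous_real y u)
  from abs_integrable_mult[OF \<mu>_measurable(2) this]
  have "(\<lambda>s. - 1 * (of_real (\<mu> s) * (u s + of_real (\<mu> s) * y s))) absolutely_integrable_on {0..1}"
    by (intro set_integrable_mult_right) auto
  moreover have "(\<lambda>s. \<zeta> * (of_real (w s) * y s)) absolutely_integrable_on {0..1}"
    by (intro set_integrable_mult_right w_mult_integrable y)
  ultimately show "(\<lambda>s. - (of_real (\<mu> s) * (u s + of_real (\<mu> s) * y s)) - \<zeta> * (of_real (w s) * y s)) absolutely_integrable_on {0..1}"
    using set_integral_diff(1) by fastforce
qed

text \<open>The Lipschitz rate of the system, uniform over the parameters with \<open>\<bar>\<zeta>\<bar> \<le> R\<close>.\<close>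
definition rate :: "real \<Rightarrow> real \<Rightarrow> real" where
  "rate R s = (1 + \<bar>\<mu> s\<bar>) * (1 + \<bar>\<mu> s\<bar>) + R * \<bar>w s\<bar>"

lemma rate_integrable: "rate R absolutely_integrable_on {0..1}"
proof -
  obtain B where B: "\<And>s. s \<in> {0..1} \<Longrightarrow> \<bar>\<mu> s\<bar> \<le> B"
    using \<mu>_measurable(1) unfolding bounded_measurable_def bounded_iff by fastforce
  have "bounded_measurable {0..1} (\<lambda>s. 1 + \<bar>\<mu> s\<bar>)"
    unfolding bounded_measurable_def bounded_iff
  proof (intro conjI exI[of _ "1 + B"] ballI)
    show "(\<lambda>s. 1 + \<bar>\<mu> s\<bar>) \<in> borel_measurable (lebesgue_on {0..1})"
      using \<mu>_measurable(1) unfolding bounded_measurable_def by (intro borel_measurable_add borel_measurable_abs) auto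
  qed (use B in auto)
  then have 1: "(\<lambda>s. (1 + \<bar>\<mu> s\<bar>) * (1 + \<bar>\<mu> s\<bar>)) absolutely_integrable_on {0..1}"
    by (intro bounded_measurable_imp_abs_integrable bounded_measurable_mult)
  have "(\<lambda>s. R * \<bar>w s\<bar>) absolutely_integrable_on {0..1}"
    using absolutely_integrable_norm[OF w_integrable] by (intro set_integrable_mult_right) (auto simp: o_def)
  from set_integral_add(1)[OF 1 this] show ?thesis
    unfolding rate_def .
qed

lemma rate_nonneg: "R \<ge> 0 \<Longrightarrow> rate R s \<ge> 0"
  unfolding rate_def by (intro add_nonneg_nonneg mult_nonneg_nonneg) auto

lemma rhs_bound:
  assumes "cmod \<zeta> \<le> R"
  shows "cmod (q + of_real (\<mu> s) * p) + cmod (- (of_real (\<mu> s) * (q + of_real (\<mu> s) * p)) - \<zeta> * (of_real (w s) * p))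
    \<le> rate R s * (cmod p + cmod q)"
proof -
  let ?m = "\<bar>\<mu> s\<bar>"
  have 1: "cmod (q + of_real (\<mu> s) * p) \<le> (1 + ?m) * (cmod p + cmod q)"
  proof -
    have "cmod (q + of_real (\<mu> s) * p) \<le> cmod q + ?m * cmod p"
      using norm_triangle_ineq[of q "of_real (\<mu> s) * p"] by (simp add: norm_mult)
    also have "\<dots> \<le> (1 + ?m) * (cmod p + cmod q)"
      by (simp add: algebra_simps)
    finally show ?thesis .
  qed
  have 2: "cmod (\<zeta> * (of_real (w s) * p)) \<le> R * \<bar>w s\<bar> * (cmod p + cmod q)"
    using assms unfolding norm_mult norm_of_real mult.assoc
    by (intro mult_mono) (auto intro: order_trans[OF norm_ge_zero])
  have "cmod (- (of_real (\<mu> s) * (q + of_real (\<mu> s) * p)) - \<zeta> * (of_real (w s) * p))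
      \<le> ?m * cmod (q + of_real (\<mu> s) * p) + cmod (\<zeta> * (of_real (w s) * p))"
    using norm_triangle_ineq4[of "- (of_real (\<mu> s) * (q + of_real (\<mu> s) * p))" "\<zeta> * (of_real (w s) * p)"]
    by (simp add: norm_mult)
  then have "cmod (q + of_real (\<mu> s) * p) + cmod (- (of_real (\<mu> s) * (q + of_real (\<mu> s) * p)) - \<zeta> * (of_real (w s) * p))
      \<le> (1 + ?m) * cmod (q + of_real (\<mu> s) * p) + cmod (\<zeta> * (of_real (w s) * p))"
    by (simp add: algebra_simps)
  also have "\<dots> \<le> (1 + ?m) * ((1 + ?m) * (cmod p + cmod q)) + R * \<bar>w s\<bar> * (cmod p + cmod q)"
    by (intro add_mono mult_left_mono 1 2) auto
  also have "\<dots> = rate R s * (cmod p + cmod q)"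
    by (simp add: rate_def algebra_simps)
  finally show ?thesis .
qed

lemma quasi_solution_exists: "\<exists>y u. quasi_solution \<zeta> y u \<and> y 0 = c \<and> u 0 = d"
proof -
  define f where "f = (\<lambda>s z. (snd z + of_real (\<mu> s) * fst z,
      - (of_real (\<mu> s) * (snd z + of_real (\<mu> s) * fst z)) - \<zeta> * (of_real (w s) * fst z)) :: complex \<times> complex)"
  have "\<exists>X. X 0 = (c, d) \<and> primitive_on 0 1 X (\<lambda>s. f s (X s))"
  proof (rule caratheodory_exists)
    \<comment> \<open>The factor 2 passes from the sum of the moduli of the components to the norm of the pair.\<close>
    show "(\<lambda>s. 2 * rate (cmod \<zeta>) s) absolutely_integrable_on {0..1}"
      by (intro set_integrable_mult_right rate_integrable)
  next
    fix X :: "real \<Rightarrow> complex \<times> complex" assume X: "continuous_on {0..1} X"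
    show "(\<lambda>s. f s (X s)) absolutely_integrable_on {0..1}"
      unfolding f_def by (intro abs_integrable_Pair rhs_integrable continuous_intros X)
  next
    fix s :: real and x y :: "complex \<times> complex"
    let ?p = "fst x - fst y" and ?q = "snd x - snd y"
    have "f s x - f s y = (?q + of_real (\<mu> s) * ?p, - (of_real (\<mu> s) * (?q + of_real (\<mu> s) * ?p)) - \<zeta> * (of_real (w s) * ?p))"
      by (simp add: f_def algebra_simps)
    then have "norm (f s x - f s y) \<le> cmod (?q + of_real (\<mu> s) * ?p) + cmod (- (of_real (\<mu> s) * (?q + of_real (\<mu> s) * ?p)) - \<zeta> * (of_real (w s) * ?p))"
      by (simp only: norm_Pair_le)
    also have "\<dots> \<le> rate (cmod \<zeta>) s * (cmod ?p + cmod ?q)"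
      by (rule rhs_bound) simp
    also have "\<dots> \<le> rate (cmod \<zeta>) s * (norm (x - y) + norm (x - y))"
      using norm_fst_le[of "?p" "?q"] norm_snd_le[of "?q" "?p"]
      by (intro mult_left_mono add_mono rate_nonneg) (auto simp: minus_prod_def)
    finally show "norm (f s x - f s y) \<le> 2 * rate (cmod \<zeta>) s * norm (x - y)"
      by simp
  qed simp
  then obtain X where X: "X 0 = (c, d)" "primitive_on 0 1 X (\<lambda>s. f s (X s))" by blast
  have "quasi_solution \<zeta> (\<lambda>s. fst (X s)) (\<lambda>s. snd (X s))"
    using primitive_on_linear[OF X(2) bounded_linear_fst] primitive_on_linear[OF X(2) bounded_linear_snd]
    unfolding quasi_solution_def by (simp add: f_def)
  then show ?thesis using X(1) by (intro exI[of _ "\<lambda>s. fst (X s)"] exI[of _ "\<lambda>s. snd (X s)"]) simp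
qed

text \<open>The difference of the two solutions satisfies the system for \<open>\<zeta>'\<close> with the additional forcing term
  \<open>- (\<zeta>' - \<zeta>) w y\<close>, so Gronwall's inequality applies to the sum of the moduli.\<close>
lemma quasi_solution_dependence:
  assumes s: "quasi_solution \<zeta> y u" and s': "quasi_solution \<zeta>' y' u'"
    and init: "y' 0 = y 0" "u' 0 = u 0"
    and R: "cmod \<zeta>' \<le> R" and M: "\<And>s. s \<in> {0..1} \<Longrightarrow> cmod (y s) \<le> M"
    and x: "x \<in> {0..1}"
  shows "cmod (y' x - y x) + cmod (u' x - u x)
     \<le> cmod (\<zeta>' - \<zeta>) * (M * integral {0..1} (\<lambda>s. \<bar>w s\<bar>)) * exp (integral {0..1} (rate R))"
proof -
  define p where "p = (\<lambda>x. y' x - y x)"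
  define q where "q = (\<lambda>x. u' x - u x)"
  define c where "c = cmod (\<zeta>' - \<zeta>) * (M * integral {0..1} (\<lambda>s. \<bar>w s\<bar>))"
  have R0: "R \<ge> 0" using R norm_ge_zero order_trans by blast
  have "cmod (y 0) \<le> M" by (rule M) simp
  then have M0: "M \<ge> 0" by (rule order_trans[OF norm_ge_zero])
  have w': "(\<lambda>s. \<bar>w s\<bar>) absolutely_integrable_on {0..1}"
    using absolutely_integrable_norm[OF w_integrable] by (simp add: o_def)
  have P: "primitive_on 0 1 p (\<lambda>s. q s + of_real (\<mu> s) * p s)"
    using primitive_on_minus[OF quasi_solutionD(1)[OF s'] quasi_solutionD(1)[OF s]]
    unfolding p_def q_def by (rule primitive_on_cong) (simp_all add: algebra_simps)
  have Q: "primitive_on 0 1 q (\<lambda>s. (- (of_real (\<mu> s) * (q s + of_real (\<mu> s) * p s)) - \<zeta>' * (of_real (w s) * p s)) - (\<zeta>' - \<zeta>) * (of_real (w s) * y s))"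
    using primitive_on_minus[OF quasi_solutionD(2)[OF s'] quasi_solutionD(2)[OF s]]
    unfolding p_def q_def by (rule primitive_on_cong) (simp_all add: algebra_simps)
  have pc: "continuous_on {0..1} (\<lambda>x. cmod (p x) + cmod (q x))"
    using primitive_on_continuous[OF P] primitive_on_continuous[OF Q] by (intro continuous_intros)
  have "cmod (p x) + cmod (q x) \<le> c * exp (integral {0..x} (rate R))"
  proof (rule gronwall[OF rate_integrable _ pc _ x])
    show "0 \<le> rate R x" for x by (rule rate_nonneg[OF R0])
    fix x :: real assume x: "x \<in> {0..1}"
    let ?g = "\<lambda>s. cmod (q s + of_real (\<mu> s) * p s)"
    let ?h = "\<lambda>s. cmod ((- (of_real (\<mu> s) * (q s + of_real (\<mu> s) * p s)) - \<zeta>' * (of_real (w s) * p s)) - (\<zeta>' - \<zeta>) * (of_real (w s) * y s))"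
    have ig: "?g absolutely_integrable_on {0..x}" and ih: "?h absolutely_integrable_on {0..x}"
      using abs_integrable_subD(4)[OF primitive_onD(1)[OF P], of 0 x] abs_integrable_subD(4)[OF primitive_onD(1)[OF Q], of 0 x] x
      by auto
    have ik: "(\<lambda>s. rate R s * (cmod (p s) + cmod (q s))) absolutely_integrable_on {0..x}"
      using abs_integrable_subD(1)[OF abs_integrable_continuous_mult[OF pc rate_integrable], of 0 x R] x
      by (simp add: mult.commute)
    have iw: "(\<lambda>s. cmod (\<zeta>' - \<zeta>) * M * \<bar>w s\<bar>) absolutely_integrable_on {0..x}"
      using abs_integrable_subD(1)[OF w', of 0 x] x by (intro set_integrable_mult_right) auto
    have "cmod (p x) \<le> integral {0..x} ?g"
    proof -
      have "p x = integral {0..x} (\<lambda>s. q s + of_real (\<mu> s) * p s)"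
        using primitive_on_diff[OF P, of 0 x] x init by (simp add: p_def)
      then show ?thesis
        using norm_integral_le[OF abs_integrable_subD(1)[OF primitive_onD(1)[OF P], of 0 x] ig] x by simp
    qed
    moreover have "cmod (q x) \<le> integral {0..x} ?h"
    proof -
      have "q x = integral {0..x} (\<lambda>s. (- (of_real (\<mu> s) * (q s + of_real (\<mu> s) * p s)) - \<zeta>' * (of_real (w s) * p s)) - (\<zeta>' - \<zeta>) * (of_real (w s) * y s))"
        using primitive_on_diff[OF Q, of 0 x] x init by (simp add: q_def)
      then show ?thesis
        using norm_integral_le[OF abs_integrable_subD(1)[OF primitive_onD(1)[OF Q], of 0 x] ih] x by simp
    qed
    moreover have "integral {0..x} ?g + integral {0..x} ?h = integral {0..x} (\<lambda>s. ?g s + ?h s)"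
      using ig ih unfolding absolutely_integrable_on_def
      by (intro Henstock_Kurzweil_Integration.integral_add[symmetric]) auto
    moreover have "\<dots> \<le> integral {0..x} (\<lambda>s. rate R s * (cmod (p s) + cmod (q s)) + cmod (\<zeta>' - \<zeta>) * M * \<bar>w s\<bar>)"
    proof (rule integral_mono_on_Icc)
      show "(\<lambda>s. ?g s + ?h s) absolutely_integrable_on {0..x}"
        by (intro set_integral_add(1) ig ih)
      show "(\<lambda>s. rate R s * (cmod (p s) + cmod (q s)) + cmod (\<zeta>' - \<zeta>) * M * \<bar>w s\<bar>) absolutely_integrable_on {0..x}"
        by (intro set_integral_add(1) ik iw)
      fix s assume s: "s \<in> {0..x}"
      have "cmod ((\<zeta>' - \<zeta>) * (of_real (w s) * y s)) \<le> cmod (\<zeta>' - \<zeta>) * M * \<bar>w s\<bar>"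
        using M[of s] s x mult_left_mono[of "cmod (y s)" M "cmod (\<zeta>' - \<zeta>) * \<bar>w s\<bar>"]
        by (simp add: norm_mult mult.assoc mult.commute[of M])
      then show "?g s + ?h s \<le> rate R s * (cmod (p s) + cmod (q s)) + cmod (\<zeta>' - \<zeta>) * M * \<bar>w s\<bar>"
        using rhs_bound[OF R, of "q s" s "p s"]
          norm_triangle_ineq4[of "- (of_real (\<mu> s) * (q s + of_real (\<mu> s) * p s)) - \<zeta>' * (of_real (w s) * p s)" "(\<zeta>' - \<zeta>) * (of_real (w s) * y s)"]
        by linarith
    qed
    moreover have "\<dots> = integral {0..x} (\<lambda>s. rate R s * (cmod (p s) + cmod (q s))) + integral {0..x} (\<lambda>s. cmod (\<zeta>' - \<zeta>) * M * \<bar>w s\<bar>)"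
      using ik iw unfolding absolutely_integrable_on_def
      by (intro Henstock_Kurzweil_Integration.integral_add) auto
    moreover have "integral {0..x} (\<lambda>s. cmod (\<zeta>' - \<zeta>) * M * \<bar>w s\<bar>) \<le> c"
    proof -
      have "integral {0..x} (\<lambda>s. \<bar>w s\<bar>) \<le> integral {0..1} (\<lambda>s. \<bar>w s\<bar>)"
        using abs_integrable_subD(2)[OF w', of 0 x] abs_integrable_subD(2)[OF w', of 0 1] x
        by (intro integral_subset_le) auto
      then have "cmod (\<zeta>' - \<zeta>) * M * integral {0..x} (\<lambda>s. \<bar>w s\<bar>) \<le> c"
        unfolding c_def mult.assoc using M0 by (intro mult_left_mono) auto
      then show ?thesis by simp
    qed
    ultimately show "cmod (p x) + cmod (q x) \<le> c + integral {0..x} (\<lambda>s. rate R s * (cmod (p s) + cmod (q s)))"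
      by linarith
  qed
  also have "\<dots> \<le> c * exp (integral {0..1} (rate R))"
  proof -
    have "integral {0..x} (rate R) \<le> integral {0..1} (rate R)"
      using abs_integrable_subD(2)[OF rate_integrable, of 0 x] abs_integrable_subD(2)[OF rate_integrable, of 0 1] x rate_nonneg[OF R0]
      by (intro integral_subset_le) auto
    moreover have "0 \<le> integral {0..1} (\<lambda>s. \<bar>w s\<bar>)"
      using w' unfolding absolutely_integrable_on_def by (intro Henstock_Kurzweil_Integration.integral_nonneg) auto
    ultimately show ?thesis
      using M0 by (intro mult_left_mono) (auto simp: c_def)
  qed
  finally show ?thesis by (simp add: p_def q_def c_def)
qed

lemma quasi_solution_unique:
  assumes "quasi_solution \<zeta> y u" "quasi_solution \<zeta> y' u'" "y' 0 = y 0" "u' 0 = u 0" "x \<in> {0..1}"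
  shows "y' x = y x" "u' x = u x"
proof -
  have "bounded (y ` {0..1})"
    by (intro compact_imp_bounded compact_continuous_image quasi_solutionD(3)[OF assms(1)]) auto
  then obtain M where "\<And>s. s \<in> {0..1} \<Longrightarrow> cmod (y s) \<le> M" unfolding bounded_iff by blast
  then have "cmod (y' x - y x) + cmod (u' x - u x) \<le> 0"
    using quasi_solution_dependence[OF assms(1-4) order_refl _ assms(5), of M] by simp
  then show "y' x = y x" "u' x = u x"
    using norm_ge_zero[of "y' x - y x"] norm_ge_zero[of "u' x - u x"]
    by (smt (verit) norm_eq_zero eq_iff_diff_eq_0)+
qed

lemma quasi_solution_linear:
  assumes "quasi_solution \<zeta> y u" "quasi_solution \<zeta> y' u'"
  shows "quasi_solution \<zeta> (\<lambda>x. c * y x + d * y' x) (\<lambda>x. c * u x + d * u' x)"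
proof -
  note lin = primitive_on_linear[OF _ bounded_linear_mult_right]
  show ?thesis
    unfolding quasi_solution_def
    using primitive_on_add[OF lin[OF quasi_solutionD(1)[OF assms(1)]] lin[OF quasi_solutionD(1)[OF assms(2)]], of c d]
      primitive_on_add[OF lin[OF quasi_solutionD(2)[OF assms(1)]] lin[OF quasi_solutionD(2)[OF assms(2)]], of c d]
    by (simp add: algebra_simps)
qed

lemma quasi_solution_cnj:
  assumes "quasi_solution \<zeta> y u"
  shows "quasi_solution (cnj \<zeta>) (\<lambda>x. cnj (y x)) (\<lambda>x. cnj (u x))"
  unfolding quasi_solution_def
proof
  show "primitive_on 0 1 (\<lambda>x. cnj (y x)) (\<lambda>s. cnj (u s) + of_real (\<mu> s) * cnj (y s))"
    using primitive_on_linear[OF quasi_solutionD(1)[OF assms] bounded_linear_cnj] by simp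
  show "primitive_on 0 1 (\<lambda>x. cnj (u x)) (\<lambda>s. - (of_real (\<mu> s) * (cnj (u s) + of_real (\<mu> s) * cnj (y s)))
      - cnj \<zeta> * (of_real (w s) * cnj (y s)))"
    using primitive_on_linear[OF quasi_solutionD(2)[OF assms] bounded_linear_cnj] by simp
qed

text \<open>All terms without a spectral parameter cancel, since the system is Hamiltonian with a symmetric
  coefficient matrix.\<close>
lemma lagrange_identity:
  assumes "quasi_solution \<zeta> y u" "quasi_solution \<zeta>' y' u'"
  shows "primitive_on 0 1 (\<lambda>x. y x * u' x - u x * y' x) (\<lambda>x. (\<zeta> - \<zeta>') * (of_real (w x) * (y x * y' x)))"
  by (rule primitive_on_cong[OF primitive_on_minus[OF
        primitive_on_mult[OF quasi_solutionD(1)[OF assms(1)] quasi_solutionD(2)[OF assms(2)]]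
        primitive_on_mult[OF quasi_solutionD(2)[OF assms(1)] quasi_solutionD(1)[OF assms(2)]]]])
    (simp_all add: algebra_simps)

lemma \<mu>_bv_sub:
  assumes "0 \<le> x" "x \<le> 1"
  shows "bounded_variation_on \<mu> 0 x"
proof -
  obtain B where "\<And>D. D division_of {0..1} \<Longrightarrow> (\<Sum>K\<in>D. \<bar>\<mu> (Sup K) - \<mu> (Inf K)\<bar>) \<le> B"
    using \<mu>_bv unfolding bounded_variation_on_def by blast
  then show ?thesis
    unfolding bounded_variation_on_def using bounded_variation_sum_le[of 0 1 \<mu> B _ x] assms
    by (intro exI[of _ B]) simp
qed

text \<open>An atom of \<open>\<mu>\<close> at \<open>0\<close> enters \<open>v x\<close> for \<open>x > 0\<close> only, and correspondingly \<open>v 0 - \<mu> 0 * y 0\<close> is the right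
  initial value of the continuous quasi-derivative: the boundary term \<open>- \<mu> 0 * y 0\<close> of the integration by
  parts is exactly the contribution of that atom.\<close>
lemma mde_solution_imp_quasi:
  assumes "mde_solution w \<mu> \<zeta> y\<^sub>0 z\<^sub>0 y v"
  shows "quasi_solution \<zeta> y (\<lambda>x. v x - of_real (\<mu> x) * y x)" "y 0 = y\<^sub>0" "v 0 = z\<^sub>0"
proof -
  have yc: "continuous_on {0..1} y" and v: "v absolutely_integrable_on {0..1}"
    and yv: "\<And>x. x \<in> {0..1} \<Longrightarrow> y x = y\<^sub>0 + (LINT s:{0..x}|lebesgue. v s)"
    and v0: "v 0 = z\<^sub>0"
    and vx: "\<And>x. x \<in> {0<..1} \<Longrightarrow> \<exists>I. has_RS_integral y \<mu> 0 x I \<and>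
        v x = z\<^sub>0 + I - \<zeta> * (LINT s:{0..x}|lebesgue. of_real (w s) * y s)"
    using assms unfolding mde_solution_def by blast+
  have yv': "y x = y\<^sub>0 + integral {0..x} v" if "x \<in> {0..1}" for x
    using yv[OF that] set_lebesgue_integral_eq_integral(2)[OF abs_integrable_subD(1)[OF v, of 0 x]] that by simp
  show y0: "y 0 = y\<^sub>0" using yv'[of 0] by simp
  show "v 0 = z\<^sub>0" by (rule v0)
  have Y: "primitive_on 0 1 y v"
    by (rule primitive_on_intro_diff[OF v]) (simp add: y0 yv')
  define u where "u = (\<lambda>x. v x - of_real (\<mu> x) * y x)"
  have \<mu>v: "(\<lambda>s. of_real (\<mu> s) * v s) absolutely_integrable_on {0..1}"
    by (intro abs_integrable_mult \<mu>_measurable v)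
  have wy: "(\<lambda>s. \<zeta> * (of_real (w s) * y s)) absolutely_integrable_on {0..1}"
    by (intro set_integrable_mult_right w_mult_integrable yc)
  have "- (of_real (\<mu> s) * v s) = - 1 * (of_real (\<mu> s) * v s)" for s by simp
  then have "(\<lambda>s. - (of_real (\<mu> s) * v s)) absolutely_integrable_on {0..1}"
    using set_integrable_mult_right[of "- 1" lebesgue "{0..1}" "\<lambda>s. of_real (\<mu> s) * v s"] \<mu>v by simp
  then have i: "(\<lambda>s. - (of_real (\<mu> s) * v s) - \<zeta> * (of_real (w s) * y s)) absolutely_integrable_on {0..1}"
    by (intro set_integral_diff(1) wy)
  have U: "primitive_on 0 1 u (\<lambda>s. - (of_real (\<mu> s) * v s) - \<zeta> * (of_real (w s) * y s))"
  proof (rule primitive_on_intro_diff[OF i])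
    fix x :: real assume x: "x \<in> {0..1}"
    show "u x - u 0 = integral {0..x} (\<lambda>s. - (of_real (\<mu> s) * v s) - \<zeta> * (of_real (w s) * y s))"
    proof (cases "x = 0")
      case False
      then have x': "x \<in> {0<..1}" using x by auto
      obtain I where I: "has_RS_integral y \<mu> 0 x I" "v x = z\<^sub>0 + I - \<zeta> * (LINT s:{0..x}|lebesgue. of_real (w s) * y s)"
        using vx[OF x'] by blast
      have "has_RS_integral y \<mu> 0 x (\<mu> x * y x - \<mu> 0 * y 0 - integral {0..x} (\<lambda>s. \<mu> s * v s))"
        using x by (intro has_RS_integral_primitive \<mu>_bv_sub primitive_on_subinterval[OF Y]) auto
      then have I': "I = \<mu> x * y x - \<mu> 0 * y 0 - integral {0..x} (\<lambda>s. \<mu> s * v s)"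
        using has_RS_integral_unique I(1) by blast
      have L: "(LINT s:{0..x}|lebesgue. of_real (w s) * y s) = integral {0..x} (\<lambda>s. of_real (w s) * y s)"
        using abs_integrable_subD(1)[OF w_mult_integrable[OF yc], of 0 x] x
        by (intro set_lebesgue_integral_eq_integral(2)) auto
      have "integral {0..x} (\<lambda>s. - (of_real (\<mu> s) * v s) - \<zeta> * (of_real (w s) * y s))
          = integral {0..x} (\<lambda>s. - (of_real (\<mu> s) * v s)) - integral {0..x} (\<lambda>s. \<zeta> * (of_real (w s) * y s))"
        using abs_integrable_subD(2)[OF \<mu>v, of 0 x] abs_integrable_subD(2)[OF wy, of 0 x] x
        by (intro Henstock_Kurzweil_Integration.integral_diff integrable_neg) auto
      then show ?thesis
        using I(2) by (simp add: u_def I' L v0)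
    qed simp
  qed
  have "quasi_solution \<zeta> y u"
    unfolding quasi_solution_def using Y U by (simp add: u_def)
  then show "quasi_solution \<zeta> y (\<lambda>x. v x - of_real (\<mu> x) * y x)"
    by (simp add: u_def)
qed

lemma quasi_imp_mde_solution:
  assumes q: "quasi_solution \<zeta> y u"
  shows "mde_solution w \<mu> \<zeta> (y 0) (u 0 + of_real (\<mu> 0) * y 0) y (\<lambda>x. u x + of_real (\<mu> x) * y x)"
proof -
  define v where "v = (\<lambda>x. u x + of_real (\<mu> x) * y x)"
  have Y: "primitive_on 0 1 y v" and U: "primitive_on 0 1 u (\<lambda>s. - (of_real (\<mu> s) * v s) - \<zeta> * (of_real (w s) * y s))"
    using quasi_solutionD(1,2)[OF q] by (simp_all add: v_def)
  note yc = primitive_on_continuous[OF Y] and v = primitive_onD(1)[OF Y]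
  have \<mu>v: "(\<lambda>s. of_real (\<mu> s) * v s) absolutely_integrable_on {0..1}"
    by (intro abs_integrable_mult \<mu>_measurable v)
  have wy: "(\<lambda>s. \<zeta> * (of_real (w s) * y s)) absolutely_integrable_on {0..1}"
    by (intro set_integrable_mult_right w_mult_integrable yc)
  have "mde_solution w \<mu> \<zeta> (y 0) (u 0 + of_real (\<mu> 0) * y 0) y v"
    unfolding mde_solution_def
  proof (intro conjI ballI yc v)
    fix x :: real assume x: "x \<in> {0..1}"
    then have "(LINT s:{0..x}|lebesgue. v s) = integral {0..x} v"
      by (intro set_lebesgue_integral_eq_integral(2) abs_integrable_subD(1)[OF v]) auto
    with primitive_onD(2)[OF Y x] show "y x = y 0 + (LINT s:{0..x}|lebesgue. v s)"
      by (simp only:)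
  next
    show "v 0 = u 0 + of_real (\<mu> 0) * y 0" by (simp add: v_def)
  next
    fix x :: real assume "x \<in> {0<..1}"
    then have x: "x \<in> {0..1}" by simp
    have RS: "has_RS_integral y \<mu> 0 x (\<mu> x * y x - \<mu> 0 * y 0 - integral {0..x} (\<lambda>s. \<mu> s * v s))"
      using x by (intro has_RS_integral_primitive \<mu>_bv_sub primitive_on_subinterval[OF Y]) auto
    have L: "(LINT s:{0..x}|lebesgue. of_real (w s) * y s) = integral {0..x} (\<lambda>s. of_real (w s) * y s)"
      using abs_integrable_subD(1)[OF w_mult_integrable[OF yc], of 0 x] x
      by (intro set_lebesgue_integral_eq_integral(2)) auto
    have "integral {0..x} (\<lambda>s. - (of_real (\<mu> s) * v s) - \<zeta> * (of_real (w s) * y s))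
        = integral {0..x} (\<lambda>s. - (of_real (\<mu> s) * v s)) - integral {0..x} (\<lambda>s. \<zeta> * (of_real (w s) * y s))"
      using abs_integrable_subD(2)[OF \<mu>v, of 0 x] abs_integrable_subD(2)[OF wy, of 0 x] x
      by (intro Henstock_Kurzweil_Integration.integral_diff integrable_neg) auto
    moreover have "u x - u 0 = integral {0..x} (\<lambda>s. - (of_real (\<mu> s) * v s) - \<zeta> * (of_real (w s) * y s))"
      using primitive_on_diff[OF U, of 0 x] x by auto
    moreover have "integral {0..x} (\<lambda>s. - (of_real (\<mu> s) * v s)) = - integral {0..x} (\<lambda>s. of_real (\<mu> s) * v s)"
      by (rule Henstock_Kurzweil_Integration.integral_neg)
    moreover have "integral {0..x} (\<lambda>s. \<zeta> * (of_real (w s) * y s)) = \<zeta> * integral {0..x} (\<lambda>s. of_real (w s) * y s)"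
      by (rule Henstock_Kurzweil_Integration.integral_mult_right)
    moreover have "v x = u x + of_real (\<mu> x) * y x" by (simp add: v_def)
    ultimately have "v x = u 0 + of_real (\<mu> 0) * y 0 + (\<mu> x * y x - \<mu> 0 * y 0 - integral {0..x} (\<lambda>s. \<mu> s * v s))
       - \<zeta> * (LINT s:{0..x}|lebesgue. of_real (w s) * y s)"
      unfolding L by (simp only: diff_eq_eq) simp
    then show "\<exists>I. has_RS_integral y \<mu> 0 x I \<and> v x = u 0 + of_real (\<mu> 0) * y 0 + I - \<zeta> * (LINT s:{0..x}|lebesgue. of_real (w s) * y s)"
      using RS by blast
  qed
  then show ?thesis by (simp add: v_def)
qed

section \<open>The discriminant\<close>

definition fundamental :: "complex \<Rightarrow> complex \<Rightarrow> complex \<Rightarrow> (real \<Rightarrow> complex) \<times> (real \<Rightarrow> complex)" where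
  "fundamental c d \<zeta> = (SOME p. quasi_solution \<zeta> (fst p) (snd p) \<and> fst p 0 = c \<and> snd p 0 = d)"

lemma fundamental:
  "quasi_solution \<zeta> (fst (fundamental c d \<zeta>)) (snd (fundamental c d \<zeta>))"
  "fst (fundamental c d \<zeta>) 0 = c" "snd (fundamental c d \<zeta>) 0 = d"
proof -
  have "\<exists>p. quasi_solution \<zeta> (fst p) (snd p) \<and> fst p 0 = c \<and> snd p 0 = d"
    using quasi_solution_exists[of \<zeta> c d] by (metis fst_conv snd_conv)
  from someI_ex[OF this] show "quasi_solution \<zeta> (fst (fundamental c d \<zeta>)) (snd (fundamental c d \<zeta>))"
    "fst (fundamental c d \<zeta>) 0 = c" "snd (fundamental c d \<zeta>) 0 = d"
    unfolding fundamental_def by simp_all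
qed

definition \<psi> :: "complex \<Rightarrow> real \<Rightarrow> complex" where "\<psi> \<zeta> = fst (fundamental 0 1 \<zeta>)"
text \<open>The quasi-derivative of \<open>\<psi> \<zeta>\<close>.\<close>
definition \<psi>q :: "complex \<Rightarrow> real \<Rightarrow> complex" where "\<psi>q \<zeta> = snd (fundamental 0 1 \<zeta>)"

lemma \<psi>: "quasi_solution \<zeta> (\<psi> \<zeta>) (\<psi>q \<zeta>)" "\<psi> \<zeta> 0 = 0" "\<psi>q \<zeta> 0 = 1"
  unfolding \<psi>_def \<psi>q_def by (rule fundamental)+

lemmas \<psi>_cont = quasi_solutionD(3)[OF \<psi>(1)]

lemma quasi_solution_eq_\<psi>:
  assumes "quasi_solution \<zeta> y u" "y 0 = 0" "x \<in> {0..1}"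
  shows "y x = u 0 * \<psi> \<zeta> x" "u x = u 0 * \<psi>q \<zeta> x"
  using quasi_solution_unique[OF quasi_solution_linear[OF \<psi>(1) \<psi>(1), where c = "u 0" and d = 0] assms(1) _ _ assms(3)]
    assms(2) by (simp_all add: \<psi>)

lemma mde_psi_eq_\<psi>:
  assumes "x \<in> {0..1}"
  shows "mde_psi w \<mu> x \<zeta> = \<psi> \<zeta> x"
  unfolding mde_psi_def
proof (rule the_equality)
  show "\<exists>y v. mde_solution w \<mu> \<zeta> 0 1 y v \<and> y x = \<psi> \<zeta> x"
    using quasi_imp_mde_solution[OF \<psi>(1), of \<zeta>] by (auto simp: \<psi>)
next
  fix c assume "\<exists>y v. mde_solution w \<mu> \<zeta> 0 1 y v \<and> y x = c"
  then obtain y v where y: "mde_solution w \<mu> \<zeta> 0 1 y v" "y x = c" by blast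
  show "c = \<psi> \<zeta> x"
    using quasi_solution_eq_\<psi>(1)[OF mde_solution_imp_quasi(1)[OF y(1)] _ assms] mde_solution_imp_quasi(2,3)[OF y(1)] y(2)
    by simp
qed

lemma discriminant_eq: "discriminant w \<mu> = (\<lambda>\<zeta>. \<psi> \<zeta> 1)"
  unfolding discriminant_def using mde_psi_eq_\<psi>[of 1] by auto

text \<open>If \<open>y\<close> vanishes identically, the first equation leaves \<open>\<integral> u = 0\<close> over every \<open>[0,x]\<close>, whence \<open>u 0 = 0\<close> by
  continuity of \<open>u\<close>.\<close>
lemma quasi_solution_nontrivial:
  assumes q: "quasi_solution \<zeta> y u" and "u 0 \<noteq> 0"
  shows "\<exists>x\<in>{0..1}. y x \<noteq> 0"
proof (rule ccontr)
  assume "\<not> ?thesis"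
  then have y0: "y x = 0" if "x \<in> {0..1}" for x using that by blast
  have "integral {0..x} u = 0" if x: "x \<in> {0..1}" for x
  proof -
    have "integral {0..x} u = integral {0..x} (\<lambda>s. u s + of_real (\<mu> s) * y s)"
      using x y0 by (intro Henstock_Kurzweil_Integration.integral_cong) auto
    also have "\<dots> = y x - y 0"
      using primitive_on_diff[OF quasi_solutionD(1)[OF q], of 0 x] x by auto
    finally show ?thesis using y0[of 0] y0[OF x] by simp
  qed
  moreover have "((\<lambda>x. integral {0..x} u) has_vector_derivative u 0) (at 0 within {0..1})"
    by (rule integral_has_vector_derivative[OF quasi_solutionD(4)[OF q]]) simp
  ultimately have "((\<lambda>x. 0) has_vector_derivative u 0) (at 0 within {0..1})"
    using has_vector_derivative_transform[of 0 "{0..1}" "\<lambda>x. 0" "\<lambda>x. integral {0..x} u" "u 0"] by simp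
  moreover have "((\<lambda>x. 0::complex) has_vector_derivative 0) (at (0::real) within {0..1})"
    by (rule has_vector_derivative_const)
  moreover have "at (0::real) within {0..1} \<noteq> bot"
    by (simp add: trivial_limit_within islimpt_Icc)
  ultimately have "u 0 = 0"
    using vector_derivative_unique_within by blast
  then show False using \<open>u 0 \<noteq> 0\<close> by simp
qed

lemma eigenvalue_iff: "mde_eigenvalue w \<mu> \<zeta> \<longleftrightarrow> \<psi> \<zeta> 1 = 0"
proof
  assume "mde_eigenvalue w \<mu> \<zeta>"
  then obtain y\<^sub>0 z\<^sub>0 y v where s: "mde_solution w \<mu> \<zeta> y\<^sub>0 z\<^sub>0 y v" and nz: "\<exists>x\<in>{0..1}. y x \<noteq> 0"
    and y: "y 0 = 0" "y 1 = 0"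
    unfolding mde_eigenvalue_def by blast
  define u where "u = (\<lambda>x. v x - of_real (\<mu> x) * y x)"
  have "y x = u 0 * \<psi> \<zeta> x" if "x \<in> {0..1}" for x
    using quasi_solution_eq_\<psi>(1)[OF mde_solution_imp_quasi(1)[OF s] y(1) that] by (simp add: u_def)
  then show "\<psi> \<zeta> 1 = 0"
    using nz y(2) by force
next
  assume "\<psi> \<zeta> 1 = 0"
  moreover have "\<exists>x\<in>{0..1}. \<psi> \<zeta> x \<noteq> 0"
    by (rule quasi_solution_nontrivial[OF \<psi>(1)]) (simp add: \<psi>)
  ultimately show "mde_eigenvalue w \<mu> \<zeta>"
    unfolding mde_eigenvalue_def using quasi_imp_mde_solution[OF \<psi>(1)] \<psi>(2) by blast
qed

text \<open>This is where positivity of \<open>w\<close> almost everywhere enters: a vanishing integral would make the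
  continuous \<open>f\<close> zero almost everywhere, hence everywhere.\<close>
lemma weighted_integral_pos:
  fixes f :: "real \<Rightarrow> real"
  assumes ab: "0 \<le> a" "a < b" "b \<le> 1"
    and f: "continuous_on {a..b} f" "\<And>x. x \<in> {a..b} \<Longrightarrow> 0 \<le> f x"
    and c: "c \<in> {a..b}" "f c \<noteq> 0"
  shows "0 < integral {a..b} (\<lambda>x. w x * f x)"
proof -
  have wf: "(\<lambda>x. w x * f x) absolutely_integrable_on {a..b}"
    using abs_integrable_continuous_mult[OF f(1) abs_integrable_subD(1)[OF w_integrable ab(1,3)]]
    by (simp add: mult.commute)
  define g where "g = (\<lambda>x. indicator {a..b} x *\<^sub>R (w x * f x))"
  have g: "integrable lebesgue g"
    using wf unfolding set_integrable_def g_def .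
  have eq: "integral {a..b} (\<lambda>x. w x * f x) = integral\<^sup>L lebesgue g"
    using set_lebesgue_integral_eq_integral(2)[OF wf] unfolding set_lebesgue_integral_def g_def by simp
  have pos: "AE x in lebesgue. 0 \<le> g x"
    using w_pos by eventually_elim (use f(2) ab in \<open>auto simp: g_def indicator_def\<close>)
  have "integral\<^sup>L lebesgue g \<noteq> 0"
  proof
    assume "integral\<^sup>L lebesgue g = 0"
    then have "AE x in lebesgue. g x = 0"
      using integral_nonneg_eq_0_iff_AE[OF g pos] by simp
    then have "AE x in lebesgue. x \<in> {a..b} \<longrightarrow> f x = 0"
      using w_pos by eventually_elim (use ab in \<open>auto simp: g_def indicator_def\<close>)
    then obtain N where N: "negligible N" "{x. \<not> (x \<in> {a..b} \<longrightarrow> f x = 0)} \<subseteq> N"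
      unfolding eventually_ae_filter_negligible by blast
    have "integral {a..b} f = integral {a..b} (\<lambda>x. 0)"
      by (rule integral_spike[OF N(1)]) (use N(2) in auto)
    then have "integral {a..b} f = 0" by simp
    then show False
      using integral_eq_0_iff[OF f(1) ab(2) f(2)] c by blast
  qed
  then show ?thesis
    using integral_nonneg_AE[OF pos] eq by simp
qed

lemma weighted_integral_of_real:
  fixes f :: "real \<Rightarrow> real"
  assumes "continuous_on {0..1} f"
  shows "integral {0..1} (\<lambda>x. complex_of_real (w x) * of_real (f x)) = of_real (integral {0..1} (\<lambda>x. w x * f x))"
proof -
  have "(\<lambda>x. w x * f x) integrable_on {0..1}"
    using abs_integrable_continuous_mult[OF assms w_integrable]
    by (simp add: mult.commute absolutely_integrable_on_def)
  from integral_linear[OF this, of complex_of_real] show ?thesis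
    by (simp add: o_def bounded_linear_of_real)
qed

lemma lagrange_integral:
  assumes "quasi_solution \<zeta> y u" "quasi_solution \<zeta>' y' u'" and x: "x \<in> {0..1}"
  shows "y x * u' x - u x * y' x - (y 0 * u' 0 - u 0 * y' 0) = (\<zeta> - \<zeta>') * integral {0..x} (\<lambda>x. of_real (w x) * (y x * y' x))"
  using primitive_on_diff[OF lagrange_identity[OF assms(1,2)], of 0 x] x by simp

text \<open>The Lagrange identity for \<open>\<psi> \<zeta>\<close> and its conjugate, whose boundary terms vanish, reads
  \<open>(\<zeta> - cnj \<zeta>) * \<integral> w \<bar>\<psi> \<zeta>\<bar>\<^sup>2 = 0\<close>.\<close>
lemma discriminant_zero_real:
  assumes "\<psi> \<zeta> 1 = 0"
  shows "\<zeta> \<in> \<real>"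
proof -
  let ?f = "\<lambda>x. (cmod (\<psi> \<zeta> x))\<^sup>2"
  have c: "continuous_on {0..1} ?f"
    by (intro continuous_intros \<psi>_cont)
  obtain x where x: "x \<in> {0..1}" "\<psi> \<zeta> x \<noteq> 0"
    using quasi_solution_nontrivial[OF \<psi>(1), of \<zeta>] by (auto simp: \<psi>)
  have "0 < integral {0..1} (\<lambda>x. w x * ?f x)"
    by (rule weighted_integral_pos[OF _ _ _ c _ x(1)]) (use x in auto)
  moreover have "(\<zeta> - cnj \<zeta>) * integral {0..1} (\<lambda>x. of_real (w x) * (\<psi> \<zeta> x * cnj (\<psi> \<zeta> x))) = 0"
    using lagrange_integral[OF \<psi>(1) quasi_solution_cnj[OF \<psi>(1)], of 1 \<zeta> \<zeta>] assms by (simp add: \<psi>)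
  moreover have "integral {0..1} (\<lambda>x. of_real (w x) * (\<psi> \<zeta> x * cnj (\<psi> \<zeta> x))) = of_real (integral {0..1} (\<lambda>x. w x * ?f x))"
    using weighted_integral_of_real[OF c] by (simp only: complex_norm_square)
  ultimately have "\<zeta> = cnj \<zeta>" by simp
  then show ?thesis by (simp add: complex_is_Real_iff complex_eq_iff)
qed

lemma \<psi>_lipschitz:
  "\<exists>C\<ge>0. \<forall>\<zeta>. cmod (\<zeta> - \<kappa>) \<le> 1 \<longrightarrow> (\<forall>x\<in>{0..1}.
      cmod (\<psi> \<zeta> x - \<psi> \<kappa> x) + cmod (\<psi>q \<zeta> x - \<psi>q \<kappa> x) \<le> C * cmod (\<zeta> - \<kappa>))"
proof -
  have "bounded (\<psi> \<kappa> ` {0..1})"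
    by (intro compact_imp_bounded compact_continuous_image \<psi>_cont) auto
  then obtain M where M: "\<And>s. s \<in> {0..1} \<Longrightarrow> cmod (\<psi> \<kappa> s) \<le> M" unfolding bounded_iff by blast
  define C where "C = M * integral {0..1} (\<lambda>s. \<bar>w s\<bar>) * exp (integral {0..1} (rate (cmod \<kappa> + 1)))"
  have est: "cmod (\<psi> \<zeta> x - \<psi> \<kappa> x) + cmod (\<psi>q \<zeta> x - \<psi>q \<kappa> x) \<le> C * cmod (\<zeta> - \<kappa>)"
    if "cmod (\<zeta> - \<kappa>) \<le> 1" "x \<in> {0..1}" for \<zeta> x
  proof -
    have "cmod \<zeta> \<le> cmod \<kappa> + 1"
      using that(1) norm_triangle_ineq2[of \<zeta> \<kappa>] by simp
    then show ?thesis
      using quasi_solution_dependence[OF \<psi>(1) \<psi>(1), of \<zeta> \<kappa> "cmod \<kappa> + 1" M x] M that by (simp add: \<psi> C_def mult_ac)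
  qed
  have "C \<ge> 0"
    using est[of "\<kappa> + 1" 0] by (simp add: \<psi>)
  then show ?thesis using est by (intro exI[of _ C]) simp
qed

lemma weighted_integral_tendsto:
  assumes \<eta>: "continuous_on {0..1} \<eta>"
  shows "((\<lambda>\<zeta>. integral {0..1} (\<lambda>x. of_real (w x) * (\<psi> \<zeta> x * \<eta> x))) \<longlongrightarrow>
     integral {0..1} (\<lambda>x. of_real (w x) * (\<psi> \<kappa> x * \<eta> x))) (at \<kappa>)"
proof -
  obtain C where C: "C \<ge> 0" "\<And>\<zeta> x. cmod (\<zeta> - \<kappa>) \<le> 1 \<Longrightarrow> x \<in> {0..1} \<Longrightarrow>
      cmod (\<psi> \<zeta> x - \<psi> \<kappa> x) + cmod (\<psi>q \<zeta> x - \<psi>q \<kappa> x) \<le> C * cmod (\<zeta> - \<kappa>)"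
    using \<psi>_lipschitz[of \<kappa>] by blast
  have "bounded (\<eta> ` {0..1})"
    by (intro compact_imp_bounded compact_continuous_image \<eta>) auto
  then obtain M where M: "\<And>s. s \<in> {0..1} \<Longrightarrow> cmod (\<eta> s) \<le> M" unfolding bounded_iff by blast
  let ?G = "\<lambda>\<zeta>. integral {0..1} (\<lambda>x. of_real (w x) * (\<psi> \<zeta> x * \<eta> x))"
  have w': "(\<lambda>s. \<bar>w s\<bar>) absolutely_integrable_on {0..1}"
    using absolutely_integrable_norm[OF w_integrable] by (simp add: o_def)
  have i: "(\<lambda>x. of_real (w x) * (\<psi> \<zeta> x * \<eta> x)) absolutely_integrable_on {0..1}" for \<zeta>
    by (intro w_mult_integrable continuous_intros \<psi>_cont \<eta>)
  have "cmod (?G \<zeta> - ?G \<kappa>) \<le> C * M * integral {0..1} (\<lambda>s. \<bar>w s\<bar>) * cmod (\<zeta> - \<kappa>)" if \<zeta>: "cmod (\<zeta> - \<kappa>) \<le> 1" for \<zeta>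
  proof -
    have "?G \<zeta> - ?G \<kappa> = integral {0..1} (\<lambda>x. of_real (w x) * (\<psi> \<zeta> x * \<eta> x) - of_real (w x) * (\<psi> \<kappa> x * \<eta> x))"
      using i[of \<zeta>] i[of \<kappa>] unfolding absolutely_integrable_on_def
      by (intro Henstock_Kurzweil_Integration.integral_diff[symmetric]) auto
    also have "cmod \<dots> \<le> integral {0..1} (\<lambda>s. C * M * cmod (\<zeta> - \<kappa>) * \<bar>w s\<bar>)"
    proof (rule norm_integral_le)
      show "(\<lambda>x. of_real (w x) * (\<psi> \<zeta> x * \<eta> x) - of_real (w x) * (\<psi> \<kappa> x * \<eta> x)) absolutely_integrable_on {0..1}"
        by (intro set_integral_diff(1) i)
      show "(\<lambda>s. C * M * cmod (\<zeta> - \<kappa>) * \<bar>w s\<bar>) absolutely_integrable_on {0..1}"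
        by (intro set_integrable_mult_right w')
      fix s :: real assume s: "s \<in> {0..1}"
      have "cmod (\<psi> \<zeta> s - \<psi> \<kappa> s) * cmod (\<eta> s) \<le> (C * cmod (\<zeta> - \<kappa>)) * M"
        using C(2)[OF \<zeta> s] M[OF s] C(1) norm_ge_zero[of "\<psi>q \<zeta> s - \<psi>q \<kappa> s"]
        by (intro mult_mono mult_nonneg_nonneg norm_ge_zero) (linarith | simp)+
      then have "\<bar>w s\<bar> * (cmod (\<psi> \<zeta> s - \<psi> \<kappa> s) * cmod (\<eta> s)) \<le> \<bar>w s\<bar> * ((C * cmod (\<zeta> - \<kappa>)) * M)"
        by (intro mult_left_mono) auto
      moreover have "of_real (w s) * (\<psi> \<zeta> s * \<eta> s) - of_real (w s) * (\<psi> \<kappa> s * \<eta> s) = of_real (w s) * ((\<psi> \<zeta> s - \<psi> \<kappa> s) * \<eta> s)"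
        by (simp add: algebra_simps)
      ultimately show "cmod (of_real (w s) * (\<psi> \<zeta> s * \<eta> s) - of_real (w s) * (\<psi> \<kappa> s * \<eta> s)) \<le> C * M * cmod (\<zeta> - \<kappa>) * \<bar>w s\<bar>"
        by (simp add: norm_mult mult_ac)
    qed
    also have "\<dots> = C * M * integral {0..1} (\<lambda>s. \<bar>w s\<bar>) * cmod (\<zeta> - \<kappa>)"
      by (simp add: mult_ac)
    finally show ?thesis .
  qed
  note bound = this
  have "eventually (\<lambda>\<zeta>. dist \<zeta> \<kappa> < 1) (at \<kappa>)"
    unfolding eventually_at by (intro exI[of _ 1]) auto
  then have "eventually (\<lambda>\<zeta>. norm (?G \<zeta> - ?G \<kappa>) \<le> C * M * integral {0..1} (\<lambda>s. \<bar>w s\<bar>) * cmod (\<zeta> - \<kappa>)) (at \<kappa>)"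
    by eventually_elim (rule bound, simp add: dist_norm)
  moreover have "((\<lambda>\<zeta>. C * M * integral {0..1} (\<lambda>s. \<bar>w s\<bar>) * cmod (\<zeta> - \<kappa>)) \<longlongrightarrow> 0) (at \<kappa>)"
    by (rule tendsto_eq_intros refl | simp)+
  ultimately have "((\<lambda>\<zeta>. ?G \<zeta> - ?G \<kappa>) \<longlongrightarrow> 0) (at \<kappa>)"
    by (rule Lim_null_comparison)
  then show ?thesis by (rule LIM_zero_cancel)
qed

text \<open>A solution \<open>\<eta>\<close> for the parameter \<open>\<kappa>\<close> with \<open>\<eta> 1 = 0\<close> and quasi-derivative \<open>1\<close> at \<open>1\<close> turns the Lagrange
  identity into \<open>\<psi> \<zeta> 1 - \<psi> \<kappa> 1 = (\<zeta> - \<kappa>) * \<integral> w (\<psi> \<zeta>) \<eta>\<close>, and the integral is continuous at \<open>\<zeta> = \<kappa>\<close>.\<close>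
lemma \<psi>_right_endpoint_derivative:
  "\<exists>D. ((\<lambda>\<zeta>. \<psi> \<zeta> 1) has_field_derivative D) (at \<kappa>)"
proof -
  define \<theta> where "\<theta> = fst (fundamental 1 0 \<kappa>)"
  define \<theta>q where "\<theta>q = snd (fundamental 1 0 \<kappa>)"
  have \<theta>: "quasi_solution \<kappa> \<theta> \<theta>q" "\<theta> 0 = 1" "\<theta>q 0 = 0"
    unfolding \<theta>_def \<theta>q_def by (rule fundamental)+
  \<comment> \<open>The Wronskian of \<open>\<theta>\<close> and \<open>\<psi> \<kappa>\<close> is constantly 1, which gives \<open>\<eta>\<close> the data (0, 1) at the right endpoint.\<close>
  define \<eta> where "\<eta> = (\<lambda>x. \<theta> 1 * \<psi> \<kappa> x + (- \<psi> \<kappa> 1) * \<theta> x)"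
  define \<eta>q where "\<eta>q = (\<lambda>x. \<theta> 1 * \<psi>q \<kappa> x + (- \<psi> \<kappa> 1) * \<theta>q x)"
  have \<eta>: "quasi_solution \<kappa> \<eta> \<eta>q"
    unfolding \<eta>_def \<eta>q_def by (rule quasi_solution_linear[OF \<psi>(1) \<theta>(1)])
  have "\<theta> 1 * \<psi>q \<kappa> 1 - \<theta>q 1 * \<psi> \<kappa> 1 = 1"
    using lagrange_integral[OF \<theta>(1) \<psi>(1)[of \<kappa>], of 1] by (simp add: \<theta> \<psi>)
  then have \<eta>1: "\<eta> 1 = 0" "\<eta>q 1 = 1" "\<eta> 0 = - \<psi> \<kappa> 1"
    by (simp_all add: \<eta>_def \<eta>q_def \<psi> \<theta> algebra_simps)
  let ?G = "\<lambda>\<zeta>. integral {0..1} (\<lambda>x. of_real (w x) * (\<psi> \<zeta> x * \<eta> x))"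
  have "\<psi> \<zeta> 1 - \<psi> \<kappa> 1 = (\<zeta> - \<kappa>) * ?G \<zeta>" for \<zeta>
    using lagrange_integral[OF \<psi>(1)[of \<zeta>] \<eta>, of 1] by (simp add: \<eta>1 \<psi>)
  then have "eventually (\<lambda>\<zeta>. ?G \<zeta> = (\<psi> \<zeta> 1 - \<psi> \<kappa> 1) / (\<zeta> - \<kappa>)) (at \<kappa>)"
    unfolding eventually_at_filter by simp
  then have "((\<lambda>\<zeta>. (\<psi> \<zeta> 1 - \<psi> \<kappa> 1) / (\<zeta> - \<kappa>)) \<longlongrightarrow> ?G \<kappa>) (at \<kappa>)"
    by (rule Lim_transform_eventually[OF weighted_integral_tendsto[OF quasi_solutionD(3)[OF \<eta>]]])
  then show ?thesis
    unfolding has_field_derivative_iff by blast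
qed

lemma discriminant_analytic: "discriminant w \<mu> analytic_on S"
proof -
  have "discriminant w \<mu> holomorphic_on UNIV"
    unfolding discriminant_eq holomorphic_on_def field_differentiable_def
    using \<psi>_right_endpoint_derivative by simp
  then have "discriminant w \<mu> analytic_on UNIV"
    by (simp add: analytic_on_open)
  then show ?thesis
    using analytic_on_subset by blast
qed

lemma \<psi>_real:
  assumes "\<kappa> \<in> \<real>" "x \<in> {0..1}"
  shows "of_real (Re (\<psi> \<kappa> x)) = \<psi> \<kappa> x" "of_real (Re (\<psi>q \<kappa> x)) = \<psi>q \<kappa> x"
proof -
  have "cnj \<kappa> = \<kappa>" using assms(1) by (simp add: Reals_cnj_iff)
  then have q: "quasi_solution \<kappa> (\<lambda>x. cnj (\<psi> \<kappa> x)) (\<lambda>x. cnj (\<psi>q \<kappa> x))"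
    using quasi_solution_cnj[OF \<psi>(1), of \<kappa>] by simp
  have "cnj (\<psi> \<kappa> x) = \<psi> \<kappa> x" "cnj (\<psi>q \<kappa> x) = \<psi>q \<kappa> x"
    using quasi_solution_unique[OF \<psi>(1) q _ _ assms(2)] by (simp_all add: \<psi>)
  then show "of_real (Re (\<psi> \<kappa> x)) = \<psi> \<kappa> x" "of_real (Re (\<psi>q \<kappa> x)) = \<psi>q \<kappa> x"
    by (simp_all add: complex_eq_iff)
qed

lemma weighted_\<psi>_square_pos:
  assumes "\<kappa> \<in> \<real>"
  shows "\<exists>I>0. integral {0..1} (\<lambda>x. of_real (w x) * (\<psi> \<kappa> x * \<psi> \<kappa> x)) = complex_of_real I"
proof -
  let ?f = "\<lambda>x. Re (\<psi> \<kappa> x) * Re (\<psi> \<kappa> x)"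
  have c: "continuous_on {0..1} ?f"
    by (intro continuous_intros \<psi>_cont)
  obtain x where x: "x \<in> {0..1}" "\<psi> \<kappa> x \<noteq> 0"
    using quasi_solution_nontrivial[OF \<psi>(1), of \<kappa>] by (auto simp: \<psi>)
  have "Re (\<psi> \<kappa> x) \<noteq> 0"
    using \<psi>_real(1)[OF assms x(1)] x(2) by auto
  then have "0 < integral {0..1} (\<lambda>x. w x * ?f x)"
    by (intro weighted_integral_pos[OF _ _ _ c _ x(1)]) auto
  moreover have "integral {0..1} (\<lambda>x. of_real (w x) * (\<psi> \<kappa> x * \<psi> \<kappa> x)) = integral {0..1} (\<lambda>x. complex_of_real (w x) * of_real (?f x))"
    by (intro Henstock_Kurzweil_Integration.integral_cong) (simp add: \<psi>_real(1)[OF assms])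
  moreover have "\<dots> = of_real (integral {0..1} (\<lambda>x. w x * ?f x))"
    by (rule weighted_integral_of_real[OF c])
  ultimately show ?thesis by metis
qed

text \<open>For \<open>\<psi> \<kappa> 1 = 0\<close> the Lagrange identity for \<open>\<psi> \<zeta>\<close> and \<open>\<psi> \<kappa>\<close> shows that the derivative of \<open>\<zeta> \<mapsto> \<psi> \<zeta> 1\<close> at \<open>\<kappa>\<close>,
  times \<open>\<psi>q \<kappa> 1\<close>, equals \<open>\<integral> w (\<psi> \<kappa>)\<^sup>2\<close>. This is positive because \<open>\<kappa>\<close>, and with it \<open>\<psi> \<kappa>\<close>, is real.\<close>
lemma eigenvalue_algebraically_simple:
  assumes z: "\<psi> \<kappa> 1 = 0"
  shows "algebraically_simple w \<mu> \<kappa>"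
proof -
  let ?G = "\<lambda>\<zeta>. integral {0..1} (\<lambda>x. of_real (w x) * (\<psi> \<zeta> x * \<psi> \<kappa> x))"
  obtain D where D: "((\<lambda>\<zeta>. \<psi> \<zeta> 1) has_field_derivative D) (at \<kappa>)"
    using \<psi>_right_endpoint_derivative by blast
  have "\<psi> \<zeta> 1 * \<psi>q \<kappa> 1 = (\<zeta> - \<kappa>) * ?G \<zeta>" for \<zeta>
    using lagrange_integral[OF \<psi>(1)[of \<zeta>] \<psi>(1)[of \<kappa>], of 1] z by (simp add: \<psi>)
  then have "eventually (\<lambda>\<zeta>. ?G \<zeta> = (\<psi> \<zeta> 1 - \<psi> \<kappa> 1) / (\<zeta> - \<kappa>) * \<psi>q \<kappa> 1) (at \<kappa>)"
    unfolding eventually_at_filter z by simp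
  then have "((\<lambda>\<zeta>. (\<psi> \<zeta> 1 - \<psi> \<kappa> 1) / (\<zeta> - \<kappa>) * \<psi>q \<kappa> 1) \<longlongrightarrow> ?G \<kappa>) (at \<kappa>)"
    by (rule Lim_transform_eventually[OF weighted_integral_tendsto[OF \<psi>_cont]])
  moreover have "((\<lambda>\<zeta>. (\<psi> \<zeta> 1 - \<psi> \<kappa> 1) / (\<zeta> - \<kappa>) * \<psi>q \<kappa> 1) \<longlongrightarrow> D * \<psi>q \<kappa> 1) (at \<kappa>)"
    using D unfolding has_field_derivative_iff by (intro tendsto_mult tendsto_const)
  ultimately have "D * \<psi>q \<kappa> 1 = ?G \<kappa>"
    using tendsto_unique[OF _ _ , of "at \<kappa>"] trivial_limit_at by blast
  then have "D \<noteq> 0"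
    using weighted_\<psi>_square_pos[OF discriminant_zero_real[OF z]] by auto
  then show ?thesis
    unfolding algebraically_simple_def using discriminant_analytic z DERIV_imp_deriv[OF D] by (simp add: discriminant_eq)
qed

end

section \<open>The Pruefer angle\<close>

lemma continuous_on_prod_of_lipschitz:
  fixes f :: "real \<Rightarrow> real \<Rightarrow> 'a::real_normed_vector"
  assumes cont: "\<And>l. continuous_on S (f l)"
    and lip: "\<And>l. \<exists>C\<ge>0. \<forall>l'. \<bar>l' - l\<bar> \<le> 1 \<longrightarrow> (\<forall>x\<in>S. norm (f l' x - f l x) \<le> C * \<bar>l' - l\<bar>)"
  shows "continuous_on (S \<times> UNIV) (\<lambda>z. f (snd z) (fst z))"
  unfolding continuous_on_iff
proof (intro ballI allI impI)
  fix z :: "real \<times> real" and e :: real assume z: "z \<in> S \<times> UNIV" and e: "e > 0"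
  obtain x l where zxl: "z = (x, l)" "x \<in> S" using z by auto
  obtain C where C: "C \<ge> 0" "\<And>l' x. \<bar>l' - l\<bar> \<le> 1 \<Longrightarrow> x \<in> S \<Longrightarrow> norm (f l' x - f l x) \<le> C * \<bar>l' - l\<bar>"
    using lip[of l] by blast
  obtain d where d: "d > 0" "\<And>x'. x' \<in> S \<Longrightarrow> dist x' x < d \<Longrightarrow> dist (f l x') (f l x) < e / 2"
    using cont[of l] zxl(2) e unfolding continuous_on_iff by (meson half_gt_zero)
  define d' where "d' = min d (min 1 (e / 2 / (C + 1)))"
  have d': "d' > 0" using d(1) e C(1) by (simp add: d'_def)
  moreover have "dist (f (snd z') (fst z')) (f (snd z) (fst z)) < e"
    if z': "z' \<in> S \<times> UNIV" "dist z' z < d'" for z'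
  proof -
    obtain x' l' where z'xl: "z' = (x', l')" "x' \<in> S" using z'(1) by auto
    have "dist x' x < d'" "\<bar>l' - l\<bar> < d'"
      using z'(2) dist_fst_le[of z' z] dist_snd_le[of z' z] by (auto simp: z'xl zxl dist_real_def)
    then have 1: "dist x' x < d" and 2: "\<bar>l' - l\<bar> \<le> 1" and 3: "\<bar>l' - l\<bar> < e / 2 / (C + 1)"
      by (auto simp: d'_def)
    have "norm (f l' x' - f l x') \<le> C * \<bar>l' - l\<bar>" by (rule C(2)[OF 2 z'xl(2)])
    also have "\<dots> \<le> (C + 1) * (e / 2 / (C + 1))"
      using 3 C(1) by (intro mult_mono) auto
    also have "\<dots> = e / 2"
    proof -
      have "C + 1 \<noteq> 0" using C(1) by linarith
      then show ?thesis by (metis nonzero_mult_div_cancel_left times_divide_eq_right)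
    qed
    finally have "dist (f l' x') (f l x') \<le> e / 2" by (simp add: dist_norm)
    moreover have "dist (f l x') (f l x) < e / 2" by (rule d(2)[OF z'xl(2) 1])
    ultimately have "dist (f l' x') (f l x) < e"
      using dist_triangle[of "f l' x'" "f l x" "f l x'"] by linarith
    then show ?thesis by (simp add: zxl z'xl)
  qed
  ultimately show "\<exists>d>0. \<forall>z'\<in>S \<times> UNIV. dist z' z < d \<longrightarrow> dist (f (snd z') (fst z')) (f (snd z) (fst z)) < e"
    by blast
qed

text \<open>At the first point after \<open>s\<close> where \<open>a\<close> failed to be positive it would have a zero approached
  from positive values.\<close>
lemma positive_after_upward_zero:
  fixes a :: "real \<Rightarrow> real"
  assumes cont: "continuous_on {s..b} a" and a0: "a s = 0"
    and up: "\<And>x. x \<in> {s..b} \<Longrightarrow> a x = 0 \<Longrightarrow>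
       \<exists>d>0. \<forall>t\<in>{s..b}. (x < t \<and> t < x + d \<longrightarrow> 0 < a t) \<and> (x - d < t \<and> t < x \<longrightarrow> a t < 0)"
    and u: "u \<in> {s<..b}"
  shows "0 < a u"
proof (rule ccontr)
  assume "\<not> 0 < a u"
  obtain d where d: "d > 0" "\<And>t. t \<in> {s..b} \<Longrightarrow> s < t \<Longrightarrow> t < s + d \<Longrightarrow> 0 < a t"
    using up[of s] a0 u by auto
  define t0 where "t0 = min (s + d / 2) u"
  have "t0 \<noteq> u"
  proof
    assume "t0 = u"
    then have "0 < a u" using d(2)[of u] u d(1) by (auto simp: t0_def min_def split: if_splits)
    with \<open>\<not> 0 < a u\<close> show False by simp
  qed
  then have t0: "s < t0" "t0 < u" "0 < a t0"
    using d u by (auto simp: t0_def min_def split: if_splits)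
  define Z where "Z = {x \<in> {t0..u}. a x \<le> 0}"
  have cont': "continuous_on {t0..u} a"
    using t0 u by (intro continuous_on_subset[OF cont]) auto
  have "closed Z"
    unfolding Z_def by (intro continuous_closed_preimage_constant continuous_on_closed_Collect_le cont' continuous_on_const closed_atLeastAtMost)
  moreover have "u \<in> Z" using t0 \<open>\<not> 0 < a u\<close> by (auto simp: Z_def)
  moreover have "bdd_below Z" by (rule bdd_belowI[of _ t0]) (auto simp: Z_def)
  ultimately have m: "Inf Z \<in> Z"
    using closed_contains_Inf by blast
  define m where "m = Inf Z"
  have mZ: "t0 \<le> m" "m \<le> u" "a m \<le> 0" using m by (auto simp: m_def Z_def)
  have pos: "0 < a t" if "t0 \<le> t" "t < m" for t
  proof (rule ccontr)
    assume "\<not> 0 < a t"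
    then have "t \<in> Z" using that mZ by (auto simp: Z_def)
    then have "m \<le> t" unfolding m_def using \<open>bdd_below Z\<close> by (rule cInf_lower)
    then show False using that by simp
  qed
  have "t0 < m" using mZ t0 by (cases "t0 = m") auto
  have "a m = 0"
  proof (rule ccontr)
    assume "a m \<noteq> 0"
    have "\<exists>x\<ge>t0. x \<le> m \<and> a x = 0"
      using mZ t0 by (intro IVT2' continuous_on_subset[OF cont']) auto
    then obtain x where "t0 \<le> x" "x \<le> m" "a x = 0" by blast
    then show False using pos[of x] \<open>a m \<noteq> 0\<close> by (cases "x = m") auto
  qed
  moreover have "m \<in> {s..b}" using mZ t0 u by auto
  ultimately obtain d2 where d2: "d2 > 0" "\<And>t. t \<in> {s..b} \<Longrightarrow> m - d2 < t \<Longrightarrow> t < m \<Longrightarrow> a t < 0"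
    using up by blast
  define t where "t = max t0 (m - d2 / 2)"
  have "t0 \<le> t" "t < m" "m - d2 < t" using \<open>t0 < m\<close> d2(1) by (auto simp: t_def)
  moreover have "t \<in> {s..b}" using \<open>m \<in> {s..b}\<close> t0 calculation by auto
  ultimately show False using pos[of t] d2(2)[of t] by force
qed

text \<open>On \<open>[a,b]\<close> the maximum is attained, and only at \<open>b\<close>, because larger values occur directly to the right of
  any earlier point, in particular of \<open>a\<close>.\<close>
lemma strict_mono_of_locally_increasing:
  fixes f :: "real \<Rightarrow> real"
  assumes cont: "continuous_on UNIV f"
    and loc: "\<And>x. \<exists>d>0. \<forall>y. x < y \<and> y < x + d \<longrightarrow> f x < f y"
  shows "strict_mono f"
proof (rule strict_monoI, rule ccontr)
  fix a b :: real assume ab: "a < b" "\<not> f a < f b"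
  obtain c where c: "c \<in> {a..b}" "\<And>x. x \<in> {a..b} \<Longrightarrow> f x \<le> f c"
    using continuous_attains_sup[of "{a..b}" f] ab continuous_on_subset[OF cont] by auto
  show False
  proof (cases "c = b")
    case True
    obtain d where d: "d > 0" "\<And>y. a < y \<Longrightarrow> y < a + d \<Longrightarrow> f a < f y" using loc by blast
    define y where "y = min (a + d / 2) b"
    have "f a < f y" using d ab by (intro d(2)) (auto simp: y_def)
    moreover have "f y \<le> f b" using c(2)[of y] True d(1) ab by (auto simp: y_def)
    ultimately show False using ab by simp
  next
    case False
    obtain d where d: "d > 0" "\<And>y. c < y \<Longrightarrow> y < c + d \<Longrightarrow> f c < f y" using loc by blast
    define y where "y = min (c + d / 2) b"
    have "f c < f y" using d False c(1) by (intro d(2)) (auto simp: y_def)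
    moreover have "f y \<le> f c" using c(2)[of y] c(1) False d(1) by (auto simp: y_def)
    ultimately show False by simp
  qed
qed

context measure_sturm_liouville
begin

text \<open>The solution and its quasi-derivative for a real parameter, as real functions; their values lose
  nothing by \<open>\<psi>_of_real\<close>.\<close>
definition \<psi>r :: "real \<Rightarrow> real \<Rightarrow> real" where "\<psi>r l x = Re (\<psi> (of_real l) x)"
definition \<psi>qr :: "real \<Rightarrow> real \<Rightarrow> real" where "\<psi>qr l x = Re (\<psi>q (of_real l) x)"

lemma \<psi>_of_real:
  assumes "x \<in> {0..1}"
  shows "\<psi> (of_real l) x = of_real (\<psi>r l x)" "\<psi>q (of_real l) x = of_real (\<psi>qr l x)"
  using \<psi>_real[OF Reals_of_real assms] by (simp_all add: \<psi>r_def \<psi>qr_def)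

lemma \<psi>r_initial: "\<psi>r l 0 = 0" "\<psi>qr l 0 = 1"
  by (simp_all add: \<psi>r_def \<psi>qr_def \<psi>)

lemma \<psi>r_primitive: "primitive_on 0 1 (\<psi>r l) (\<lambda>s. \<psi>qr l s + \<mu> s * \<psi>r l s)"
  using primitive_on_linear[OF quasi_solutionD(1)[OF \<psi>(1)] bounded_linear_Re, of "of_real l"]
  by (simp add: \<psi>r_def[abs_def] \<psi>qr_def)

lemma \<psi>qr_primitive: "primitive_on 0 1 (\<psi>qr l) (\<lambda>s. - (\<mu> s * (\<psi>qr l s + \<mu> s * \<psi>r l s)) - l * (w s * \<psi>r l s))"
  using primitive_on_linear[OF quasi_solutionD(2)[OF \<psi>(1)] bounded_linear_Re, of "of_real l"]
  by (simp add: \<psi>r_def \<psi>qr_def[abs_def])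

lemma \<psi>r_nonvanishing:
  assumes x: "x \<in> {0..1}"
  shows "\<psi>r l x \<noteq> 0 \<or> \<psi>qr l x \<noteq> 0"
proof -
  have "fst (fundamental 1 0 (of_real l)) x * \<psi>q (of_real l) x - snd (fundamental 1 0 (of_real l)) x * \<psi> (of_real l) x = 1"
    using lagrange_integral[OF fundamental(1) \<psi>(1) x, of 1 0 "of_real l" "of_real l"] by (simp add: \<psi> fundamental)
  then show ?thesis by (auto simp: \<psi>_of_real[OF x])
qed

lemma \<psi>r_jointly_continuous:
  "continuous_on ({0..1} \<times> UNIV) (\<lambda>z. \<psi>r (snd z) (fst z))"
  "continuous_on ({0..1} \<times> UNIV) (\<lambda>z. \<psi>qr (snd z) (fst z))"
proof -
  have "\<exists>C\<ge>0. \<forall>l'. \<bar>l' - l\<bar> \<le> 1 \<longrightarrow> (\<forall>x\<in>{0..1}. \<bar>\<psi>r l' x - \<psi>r l x\<bar> + \<bar>\<psi>qr l' x - \<psi>qr l x\<bar> \<le> C * \<bar>l' - l\<bar>)" for l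
  proof -
    obtain C where C: "C \<ge> 0" "\<And>\<zeta> x. cmod (\<zeta> - of_real l) \<le> 1 \<Longrightarrow> x \<in> {0..1} \<Longrightarrow>
      cmod (\<psi> \<zeta> x - \<psi> (of_real l) x) + cmod (\<psi>q \<zeta> x - \<psi>q (of_real l) x) \<le> C * cmod (\<zeta> - of_real l)"
      using \<psi>_lipschitz[of "of_real l"] by blast
    have "\<bar>\<psi>r l' x - \<psi>r l x\<bar> + \<bar>\<psi>qr l' x - \<psi>qr l x\<bar> \<le> C * \<bar>l' - l\<bar>" if "\<bar>l' - l\<bar> \<le> 1" "x \<in> {0..1}" for l' x
    proof -
      have E: "cmod (of_real l' - of_real l) = \<bar>l' - l\<bar>"
        by (simp only: of_real_diff[symmetric] norm_of_real)
      have "\<bar>\<psi>r l' x - \<psi>r l x\<bar> \<le> cmod (\<psi> (of_real l') x - \<psi> (of_real l) x)"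
        "\<bar>\<psi>qr l' x - \<psi>qr l x\<bar> \<le> cmod (\<psi>q (of_real l') x - \<psi>q (of_real l) x)"
        unfolding \<psi>r_def \<psi>qr_def minus_complex.sel(1)[symmetric] by (rule abs_Re_le_cmod)+
      then show ?thesis
        using C(2)[of "of_real l'" x] that unfolding E by linarith
    qed
    then show ?thesis using C(1) by blast
  qed
  note L = this
  have pc: "continuous_on {0..1} (\<psi>r l)" "continuous_on {0..1} (\<psi>qr l)" for l
    by (rule primitive_on_continuous[OF \<psi>r_primitive] primitive_on_continuous[OF \<psi>qr_primitive])+
  show "continuous_on ({0..1} \<times> UNIV) (\<lambda>z. \<psi>r (snd z) (fst z))"
  proof (rule continuous_on_prod_of_lipschitz[OF pc(1)])
    fix l
    obtain C where C: "C \<ge> 0" "\<And>l' x. \<bar>l' - l\<bar> \<le> 1 \<Longrightarrow> x \<in> {0..1} \<Longrightarrow> \<bar>\<psi>r l' x - \<psi>r l x\<bar> + \<bar>\<psi>qr l' x - \<psi>qr l x\<bar> \<le> C * \<bar>l' - l\<bar>"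
      using L[of l] by blast
    show "\<exists>C\<ge>0. \<forall>l'. \<bar>l' - l\<bar> \<le> 1 \<longrightarrow> (\<forall>x\<in>{0..1}. norm (\<psi>r l' x - \<psi>r l x) \<le> C * \<bar>l' - l\<bar>)"
    proof (intro exI[of _ C] conjI allI impI ballI C(1))
      fix l' x assume "\<bar>l' - l\<bar> \<le> 1" "x \<in> {0..1::real}"
      from C(2)[OF this] show "norm (\<psi>r l' x - \<psi>r l x) \<le> C * \<bar>l' - l\<bar>" unfolding real_norm_def by linarith
    qed
  qed
  show "continuous_on ({0..1} \<times> UNIV) (\<lambda>z. \<psi>qr (snd z) (fst z))"
  proof (rule continuous_on_prod_of_lipschitz[OF pc(2)])
    fix l
    obtain C where C: "C \<ge> 0" "\<And>l' x. \<bar>l' - l\<bar> \<le> 1 \<Longrightarrow> x \<in> {0..1} \<Longrightarrow> \<bar>\<psi>r l' x - \<psi>r l x\<bar> + \<bar>\<psi>qr l' x - \<psi>qr l x\<bar> \<le> C * \<bar>l' - l\<bar>"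
      using L[of l] by blast
    show "\<exists>C\<ge>0. \<forall>l'. \<bar>l' - l\<bar> \<le> 1 \<longrightarrow> (\<forall>x\<in>{0..1}. norm (\<psi>qr l' x - \<psi>qr l x) \<le> C * \<bar>l' - l\<bar>)"
    proof (intro exI[of _ C] conjI allI impI ballI C(1))
      fix l' x assume "\<bar>l' - l\<bar> \<le> 1" "x \<in> {0..1::real}"
      from C(2)[OF this] show "norm (\<psi>qr l' x - \<psi>qr l x) \<le> C * \<bar>l' - l\<bar>" unfolding real_norm_def by linarith
    qed
  qed
qed

text \<open>The set \<open>[0,1] \<times> \<real>\<close> is contractible, so the nonvanishing function \<open>\<psi>qr + \<i> \<psi>r\<close> has a continuous logarithm there,
  jointly in the point and the parameter. Lifting in both variables at once makes the angle continuous in the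
  parameter without a differential equation for it.\<close>
lemma prufer_angle_exists:
  "\<exists>\<theta>. continuous_on ({0..1} \<times> UNIV) (\<lambda>z. \<theta> (fst z) (snd z)) \<and> (\<forall>l. \<theta> 0 l = 0) \<and>
     (\<forall>x\<in>{0..1}. \<forall>l. \<exists>\<rho>>0. \<psi>r l x = \<rho> * sin (\<theta> x l) \<and> \<psi>qr l x = \<rho> * cos (\<theta> x l))"
proof -
  let ?S = "{0..1::real} \<times> (UNIV :: real set)"
  define h where "h = (\<lambda>z::real\<times>real. Complex (\<psi>qr (snd z) (fst z)) (\<psi>r (snd z) (fst z)))"
  have hc: "continuous_on ?S h"
    unfolding h_def Complex_eq by (intro continuous_intros \<psi>r_jointly_continuous)
  have "contractible ?S"
    by (intro convex_imp_contractible convex_Times convex_UNIV) simp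
  moreover have "h z \<noteq> 0" if "z \<in> ?S" for z
    using \<psi>r_nonvanishing[of "fst z" "snd z"] that by (auto simp: h_def complex_eq_iff)
  ultimately obtain g where g: "continuous_on ?S g" "\<And>z. z \<in> ?S \<Longrightarrow> h z = exp (g z)"
    using continuous_logarithm_on_contractible[OF hc] by blast
  \<comment> \<open>At \<open>x = 0\<close> the curve is at 1, so subtracting \<open>g (0, l)\<close> changes the exponent by a multiple of \<open>2 * pi * \<i>\<close>.\<close>
  define \<theta> where "\<theta> = (\<lambda>x l. Im (g (x, l)) - Im (g (0, l)))"
  have "continuous_on ?S (\<lambda>z. Im (g (fst z, snd z)) - Im (g (0, snd z)))"
    by (intro continuous_intros continuous_on_compose2[OF g(1)]) auto
  moreover have "\<exists>\<rho>>0. \<psi>r l x = \<rho> * sin (\<theta> x l) \<and> \<psi>qr l x = \<rho> * cos (\<theta> x l)" if x: "x \<in> {0..1}" for x l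
  proof -
    have "exp (g (0, l)) = 1"
      using g(2)[of "(0, l)"] by (simp add: h_def \<psi>r_initial complex_eq_iff)
    then have "h (x, l) = exp (g (x, l) - g (0, l))"
      using g(2)[of "(x, l)"] x by (simp add: exp_diff)
    moreover have "g (x, l) - g (0, l) = Complex (Re (g (x, l) - g (0, l))) (\<theta> x l)"
      by (simp add: \<theta>_def complex_eq_iff)
    ultimately have "h (x, l) = exp (Complex (Re (g (x, l) - g (0, l))) (\<theta> x l))" by simp
    then have "\<psi>qr l x = exp (Re (g (x, l) - g (0, l))) * cos (\<theta> x l)" "\<psi>r l x = exp (Re (g (x, l) - g (0, l))) * sin (\<theta> x l)"
      by (simp_all add: h_def exp_eq_polar complex_eq_iff Re_exp Im_exp)
    then show ?thesis by (intro exI[of _ "exp (Re (g (x, l) - g (0, l)))"]) simp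
  qed
  ultimately show ?thesis
    by (intro exI[of _ \<theta>]) (simp add: \<theta>_def)
qed

definition angle :: "real \<Rightarrow> real \<Rightarrow> real" where
  "angle = (SOME \<theta>. continuous_on ({0..1} \<times> UNIV) (\<lambda>z. \<theta> (fst z) (snd z)) \<and> (\<forall>l. \<theta> 0 l = 0) \<and>
     (\<forall>x\<in>{0..1}. \<forall>l. \<exists>\<rho>>0. \<psi>r l x = \<rho> * sin (\<theta> x l) \<and> \<psi>qr l x = \<rho> * cos (\<theta> x l)))"

lemma angle:
  "continuous_on ({0..1} \<times> UNIV) (\<lambda>z. angle (fst z) (snd z))"
  "angle 0 l = 0"
  "x \<in> {0..1} \<Longrightarrow> \<exists>\<rho>>0. \<psi>r l x = \<rho> * sin (angle x l) \<and> \<psi>qr l x = \<rho> * cos (angle x l)"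
  using someI_ex[OF prufer_angle_exists] unfolding angle_def[symmetric] by blast+

lemma angle_cont_x: "continuous_on {0..1} (\<lambda>x. angle x l)"
proof -
  have "continuous_on {0..1} (\<lambda>x. (x, l))" by (intro continuous_intros)
  from continuous_on_compose2[OF angle(1) this] show ?thesis by auto
qed

lemma angle_cont_l:
  assumes "x \<in> {0..1}"
  shows "continuous_on UNIV (\<lambda>l. angle x l)"
proof -
  have "continuous_on UNIV (\<lambda>l. (x, l))" by (intro continuous_intros)
  from continuous_on_compose2[OF angle(1) this] show ?thesis using assms by (simp add: image_subset_iff)
qed

lemma \<psi>r_zero_iff:
  assumes "x \<in> {0..1}"
  shows "\<psi>r l x = 0 \<longleftrightarrow> (\<exists>k::int. angle x l = of_int k * pi)"
  using angle(3)[OF assms, of l] sin_zero_iff_int2[of "angle x l"] by auto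

text \<open>The derivative \<open>\<psi>qr + \<mu> \<psi>r\<close> is in general discontinuous, but at a zero of \<open>\<psi>r\<close> the discontinuous part is
  damped, since \<open>\<mu>\<close> is bounded. The derivative is thus close to the nonzero number \<open>\<psi>qr l x0\<close> nearby.\<close>
lemma \<psi>r_increment_at_zero:
  assumes x0: "x0 \<in> {0..1}" and z: "\<psi>r l x0 = 0"
  shows "\<exists>d>0. \<forall>s t. 0 \<le> s \<and> s < t \<and> t \<le> 1 \<and> \<bar>s - x0\<bar> < d \<and> \<bar>t - x0\<bar> < d \<longrightarrow> 0 < (\<psi>r l t - \<psi>r l s) * \<psi>qr l x0"
proof -
  let ?c = "\<bar>\<psi>qr l x0\<bar>"
  have c: "?c > 0" using \<psi>r_nonvanishing[OF x0, of l] z by auto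
  obtain M where M: "\<And>s. s \<in> {0..1} \<Longrightarrow> \<bar>\<mu> s\<bar> \<le> M"
    using \<mu>_measurable(1) unfolding bounded_measurable_def bounded_iff by fastforce
  have M0: "M \<ge> 0" using M[of 0] abs_ge_zero order_trans by fastforce
  note pc = primitive_on_continuous[OF \<psi>r_primitive[of l]] and rc = primitive_on_continuous[OF \<psi>qr_primitive[of l]]
  have e1: "?c / 4 / (M + 1) > 0" using c M0 by simp
  obtain d1 where d1: "d1 > 0" "\<And>s t. s \<in> {0..1} \<Longrightarrow> t \<in> {0..1} \<Longrightarrow> \<bar>t - s\<bar> < d1 \<Longrightarrow> norm (\<psi>r l t - \<psi>r l s) < ?c / 4 / (M + 1)"
    using uniform_continuityD[OF pc e1] by blast
  have e2: "?c / 4 > 0" using c by simp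
  obtain d2 where d2: "d2 > 0" "\<And>s t. s \<in> {0..1} \<Longrightarrow> t \<in> {0..1} \<Longrightarrow> \<bar>t - s\<bar> < d2 \<Longrightarrow> norm (\<psi>qr l t - \<psi>qr l s) < ?c / 4"
    using uniform_continuityD[OF rc e2] by blast
  define v where "v = (\<lambda>s. \<psi>qr l s + \<mu> s * \<psi>r l s)"
  have P: "primitive_on 0 1 (\<psi>r l) v" using \<psi>r_primitive by (simp add: v_def)
  have "0 < (\<psi>r l t - \<psi>r l s) * \<psi>qr l x0"
    if st: "0 \<le> s" "s < t" "t \<le> 1" "\<bar>s - x0\<bar> < min d1 d2" "\<bar>t - x0\<bar> < min d1 d2" for s t
  proof -
    have near: "\<bar>v q - \<psi>qr l x0\<bar> \<le> ?c / 2" if q: "q \<in> {s..t}" for q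
    proof -
      have q': "q \<in> {0..1}" "\<bar>q - x0\<bar> < d1" "\<bar>q - x0\<bar> < d2" using q st by auto
      have "\<bar>\<mu> q * \<psi>r l q\<bar> \<le> M * (?c / 4 / (M + 1))"
        using d1(2)[OF x0 q'(1,2)] z M[OF q'(1)] M0 unfolding abs_mult by (intro mult_mono) auto
      also have "\<dots> \<le> (M + 1) * (?c / 4 / (M + 1))" using e1 by (intro mult_right_mono) auto
      also have "\<dots> = ?c / 4"
      proof -
        have "M + 1 \<noteq> 0" using M0 by linarith
        then show ?thesis by (metis nonzero_mult_div_cancel_left times_divide_eq_right)
      qed
      finally have "\<bar>\<mu> q * \<psi>r l q\<bar> \<le> ?c / 4" .
      moreover have "\<bar>\<psi>qr l q - \<psi>qr l x0\<bar> < ?c / 4" using d2(2)[OF x0 q'(1,3)] by simp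
      ultimately show ?thesis unfolding v_def by linarith
    qed
    have iv: "v absolutely_integrable_on {s..t}"
      using abs_integrable_subD(1)[OF primitive_onD(1)[OF P], of s t] st by auto
    have "integral {s..t} (\<lambda>q. v q - \<psi>qr l x0) = integral {s..t} v - integral {s..t} (\<lambda>q. \<psi>qr l x0)"
      using iv unfolding absolutely_integrable_on_def by (intro Henstock_Kurzweil_Integration.integral_diff) auto
    also have "\<dots> = (\<psi>r l t - \<psi>r l s) - (t - s) * \<psi>qr l x0"
      using primitive_on_diff[OF P, of s t] st by simp
    finally have "\<bar>(\<psi>r l t - \<psi>r l s) - (t - s) * \<psi>qr l x0\<bar> = norm (integral {s..t} (\<lambda>q. v q - \<psi>qr l x0))" by simp
    also have "\<dots> \<le> integral {s..t} (\<lambda>q. ?c / 2)"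
    proof (rule norm_integral_le)
      show "(\<lambda>q. v q - \<psi>qr l x0) absolutely_integrable_on {s..t}"
        by (intro set_integral_diff(1) iv absolutely_integrable_continuous_real continuous_on_const)
      show "(\<lambda>q. ?c / 2) absolutely_integrable_on {s..t}"
        by (intro absolutely_integrable_continuous_real continuous_on_const)
    qed (use near in simp)
    also have "\<dots> = (t - s) * (?c / 2)" using st by simp
    finally have A: "\<bar>(\<psi>r l t - \<psi>r l s) - (t - s) * \<psi>qr l x0\<bar> \<le> (t - s) * (?c / 2)" .
    have pos: "(t - s) * (?c / 2) > 0" using st c by simp
    show ?thesis
    proof (cases "\<psi>qr l x0 > 0")
      case True
      then have "(t - s) * (?c / 2) = (t - s) * \<psi>qr l x0 / 2" by simp
      then have "\<psi>r l t - \<psi>r l s > 0" using A pos by linarith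
      then show ?thesis using True by simp
    next
      case False
      then have "(t - s) * (?c / 2) = - ((t - s) * \<psi>qr l x0) / 2" by simp
      then have "\<psi>r l t - \<psi>r l s < 0" using A pos by linarith
      then show ?thesis using False c by (intro mult_neg_neg) auto
    qed
  qed
  note main = this
  show ?thesis
  proof (intro exI[of _ "min d1 d2"] conjI allI impI)
    show "0 < min d1 d2" using d1(1) d2(1) by simp
  qed (rule main; simp)
qed

text \<open>Near a point where the angle equals \<open>k * pi\<close>, the product of \<open>\<psi>r\<close> with the value of \<open>\<psi>qr\<close> at that point has the sign
  of \<open>sin (angle - k * pi)\<close>, and it changes from negative to positive there.\<close>
lemma angle_crosses_upward:
  assumes x0: "x0 \<in> {0..1}" and k: "angle x0 l = of_int k * pi" and x: "x \<in> {x0<..1}"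
  shows "of_int k * pi < angle x l"
proof -
  let ?a = "\<lambda>x. angle x l - of_int k * pi"
  have ac: "continuous_on {0..1} ?a" by (intro continuous_intros angle_cont_x)
  have "0 < ?a x"
  proof (rule positive_after_upward_zero[where a = ?a and s = x0 and b = 1])
    show "continuous_on {x0..1} ?a" using x0 by (intro continuous_on_subset[OF ac]) auto
    show "?a x0 = 0" using k by simp
    show "x \<in> {x0<..1}" by (rule x)
  next
    fix y assume "y \<in> {x0..1}" and ay: "?a y = 0"
    then have y: "y \<in> {0..1}" using x0 by auto
    have ky: "angle y l = of_int k * pi" using ay by simp
    then have py: "\<psi>r l y = 0" using \<psi>r_zero_iff[OF y] by blast
    obtain d1 where d1: "d1 > 0" "\<And>s t. 0 \<le> s \<Longrightarrow> s < t \<Longrightarrow> t \<le> 1 \<Longrightarrow> \<bar>s - y\<bar> < d1 \<Longrightarrow> \<bar>t - y\<bar> < d1 \<Longrightarrow> 0 < (\<psi>r l t - \<psi>r l s) * \<psi>qr l y"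
      using \<psi>r_increment_at_zero[OF y py] by blast
    obtain d2 where d2: "d2 > 0" "\<And>s t. s \<in> {0..1} \<Longrightarrow> t \<in> {0..1} \<Longrightarrow> \<bar>t - s\<bar> < d2 \<Longrightarrow> norm (?a t - ?a s) < pi"
      using uniform_continuityD[OF ac pi_gt_zero] by blast
    have sgn: "\<exists>c>0. \<psi>r l t * \<psi>qr l y = c * sin (?a t)" if t: "t \<in> {0..1}" for t
    proof -
      obtain \<rho> where \<rho>: "\<rho> > 0" "\<psi>r l t = \<rho> * sin (angle t l)" using angle(3)[OF t] by blast
      obtain \<sigma> where \<sigma>: "\<sigma> > 0" "\<psi>qr l y = \<sigma> * cos (angle y l)" using angle(3)[OF y] by blast
      have "sin (of_int k * pi) = 0" by (simp add: sin_zero_iff_int2)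
      then have cc: "cos (of_int k * pi) * cos (of_int k * pi) = 1"
        using sin_cos_squared_add3[of "of_int k * pi"] by simp
      have "sin (angle t l) = sin (?a t + of_int k * pi)" by simp
      also have "\<dots> = sin (?a t) * cos (of_int k * pi)"
        unfolding sin_add using \<open>sin (of_int k * pi) = 0\<close> by simp
      finally have "\<psi>r l t * \<psi>qr l y = \<rho> * \<sigma> * sin (?a t)"
        unfolding \<rho>(2) \<sigma>(2) ky using cc by (simp add: algebra_simps)
      then show ?thesis using \<rho>(1) \<sigma>(1) by (intro exI[of _ "\<rho> * \<sigma>"]) simp
    qed
    show "\<exists>d>0. \<forall>t\<in>{x0..1}. (y < t \<and> t < y + d \<longrightarrow> 0 < ?a t) \<and> (y - d < t \<and> t < y \<longrightarrow> ?a t < 0)"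
    proof (intro exI[of _ "min d1 d2"] conjI ballI impI)
      show "0 < min d1 d2" using d1(1) d2(1) by simp
    next
      fix t assume "t \<in> {x0..1}" and t: "y < t \<and> t < y + min d1 d2"
      then have t': "t \<in> {0..1}" using x0 by auto
      have bound: "\<bar>?a t\<bar> < pi" using d2(2)[OF y t'] t ay by auto
      have "0 < \<psi>r l t * \<psi>qr l y" using d1(2)[of y t] t t' y py by auto
      then have "0 < sin (?a t)" using sgn[OF t'] zero_less_mult_pos by metis
      then show "0 < ?a t" using bound sin_ge_zero[of "- ?a t"] unfolding sin_minus by (cases "0 < ?a t") auto
    next
      fix t assume "t \<in> {x0..1}" and t: "y - min d1 d2 < t \<and> t < y"
      then have t': "t \<in> {0..1}" using x0 by auto
      have bound: "\<bar>?a t\<bar> < pi" using d2(2)[OF y t'] t ay by auto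
      have "\<psi>r l t * \<psi>qr l y < 0" using d1(2)[of t y] t t' y py by auto
      moreover obtain c where "c > 0" "\<psi>r l t * \<psi>qr l y = c * sin (?a t)" using sgn[OF t'] by blast
      ultimately have "sin (?a t) < 0" by (simp add: mult_less_0_iff)
      then show "?a t < 0" using bound sin_ge_zero[of "?a t"] by (cases "?a t < 0") auto
    qed
  qed
  then show ?thesis by simp
qed

lemma angle_endpoint_pos: "0 < angle 1 l"
  using angle_crosses_upward[of 0 l 0 1] by (simp add: angle)

text \<open>The Lagrange identity for two real parameters \<open>l' > l\<close> reads
  \<open>\<rho> \<sigma> sin (angle 1 l' - angle 1 l) = (l' - l) * \<integral> w (\<psi> l') (\<psi> l)\<close> with \<open>\<rho>, \<sigma> > 0\<close>, and for \<open>l'\<close> near \<open>l\<close> the integral is close to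
  the positive number \<open>\<integral> w (\<psi> l)\<^sup>2\<close>.\<close>
lemma angle_endpoint_strict_mono: "strict_mono (angle 1)"
proof (rule strict_mono_of_locally_increasing)
  show c: "continuous_on UNIV (angle 1)" using angle_cont_l[of 1] by simp
  fix l :: real
  let ?G = "\<lambda>\<zeta>. integral {0..1} (\<lambda>x. of_real (w x) * (\<psi> \<zeta> x * \<psi> (of_real l) x))"
  obtain I where I: "I > 0" "?G (of_real l) = complex_of_real I"
    using weighted_\<psi>_square_pos[of "of_real l"] by auto
  have "((\<lambda>\<zeta>. Re (?G \<zeta>)) \<longlongrightarrow> I) (at (of_real l))"
    using tendsto_Re[OF weighted_integral_tendsto[OF \<psi>_cont[of "of_real l"], of "of_real l"]] I(2) by simp
  then have "eventually (\<lambda>\<zeta>. 0 < Re (?G \<zeta>)) (at (of_real l))"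
    using I(1) by (rule order_tendstoD(1))
  then obtain d1 where d1: "d1 > 0" "\<And>\<zeta>. \<zeta> \<noteq> of_real l \<Longrightarrow> dist \<zeta> (of_real l) < d1 \<Longrightarrow> 0 < Re (?G \<zeta>)"
    unfolding eventually_at by blast
  have "isCont (angle 1) l" using c by (simp add: continuous_on_eq_continuous_at)
  then obtain d2 where d2: "d2 > 0" "\<And>l'. dist l' l < d2 \<Longrightarrow> dist (angle 1 l') (angle 1 l) < pi"
    unfolding continuous_at_eps_delta using pi_gt_zero by blast
  have "angle 1 l < angle 1 l'" if l': "l < l'" "l' < l + min d1 d2" for l'
  proof -
    have "dist (complex_of_real l') (of_real l) < d1"
      unfolding dist_of_real using l' by (simp add: dist_real_def)
    then have G: "0 < Re (?G (of_real l'))" using d1(2)[of "of_real l'"] l'(1) by simp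
    have "of_real (\<psi>r l' 1 * \<psi>qr l 1 - \<psi>qr l' 1 * \<psi>r l 1) = of_real (l' - l) * ?G (of_real l')"
      using lagrange_integral[OF \<psi>(1)[of "of_real l'"] \<psi>(1)[of "of_real l"], of 1]
      by (simp add: \<psi> \<psi>_of_real)
    then have "Re (of_real (\<psi>r l' 1 * \<psi>qr l 1 - \<psi>qr l' 1 * \<psi>r l 1)) = Re (of_real (l' - l) * ?G (of_real l'))"
      by (rule arg_cong)
    then have "\<psi>r l' 1 * \<psi>qr l 1 - \<psi>qr l' 1 * \<psi>r l 1 = (l' - l) * Re (?G (of_real l'))"
      by simp
    moreover obtain \<rho> where \<rho>: "\<rho> > 0" "\<psi>r l 1 = \<rho> * sin (angle 1 l)" "\<psi>qr l 1 = \<rho> * cos (angle 1 l)"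
      using angle(3)[of 1 l] by auto
    moreover obtain \<sigma> where \<sigma>: "\<sigma> > 0" "\<psi>r l' 1 = \<sigma> * sin (angle 1 l')" "\<psi>qr l' 1 = \<sigma> * cos (angle 1 l')"
      using angle(3)[of 1 l'] by auto
    ultimately have "\<rho> * \<sigma> * sin (angle 1 l' - angle 1 l) = (l' - l) * Re (?G (of_real l'))"
      by (simp add: sin_diff algebra_simps)
    then have "0 < \<rho> * \<sigma> * sin (angle 1 l' - angle 1 l)"
      using G l'(1) by simp
    then have s: "0 < sin (angle 1 l' - angle 1 l)"
      using zero_less_mult_pos[of "\<rho> * \<sigma>"] mult_pos_pos[OF \<rho>(1) \<sigma>(1)] by blast
    have "\<bar>angle 1 l' - angle 1 l\<bar> < pi"
      using d2(2)[of l'] l' by (simp add: dist_real_def)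
    then show ?thesis
      using s sin_ge_zero[of "angle 1 l - angle 1 l'"] sin_minus[of "angle 1 l' - angle 1 l"]
      by (cases "angle 1 l < angle 1 l'") auto
  qed
  then show "\<exists>d>0. \<forall>l'. l < l' \<and> l' < l + d \<longrightarrow> angle 1 l < angle 1 l'"
    using d1(1) d2(1) by (intro exI[of _ "min d1 d2"]) simp
qed

section \<open>Oscillation for large parameters\<close>

text \<open>Picone's identity. Where \<open>y = \<psi>r l\<close> has no zero, let \<open>u\<close> be its quasi-derivative and \<open>v = u + \<mu> y\<close>. Then
  \<open>(\<phi>\<^sup>2 u / y)' = \<phi>'\<^sup>2 - 2 \<phi> \<phi>' \<mu> - l w \<phi>\<^sup>2 - (\<phi> v / y - \<phi>')\<^sup>2\<close>. Integrating over \<open>[a,b]\<close> with a test function \<open>\<phi>\<close>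
  that vanishes at both ends bounds \<open>l\<close> by \<open>K / m\<close>, which involves neither \<open>l\<close> nor \<open>y\<close>.\<close>
lemma picone_zero:
  assumes ab: "0 \<le> a" "a < b" "b \<le> 1"
  shows "\<exists>L. \<forall>l>L. \<exists>x\<in>{a..b}. \<psi>r l x = 0"
proof -
  define \<phi> where "\<phi> = (\<lambda>x. (x - a) * (b - x))"
  define \<phi>' where "\<phi>' = (\<lambda>x. a + b - 2 * x)"
  have \<phi>c: "continuous_on S \<phi>" "continuous_on S \<phi>'" for S
    unfolding \<phi>_def \<phi>'_def by (intro continuous_intros)+
  have \<phi>P: "primitive_on a b \<phi> \<phi>'"
  proof (rule primitive_on_intro_diff)
    show "\<phi>' absolutely_integrable_on {a..b}" by (intro absolutely_integrable_continuous_real \<phi>c)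
    fix x assume "x \<in> {a..b}"
    then have "(\<phi>' has_integral (\<phi> x - \<phi> a)) {a..x}"
      by (intro fundamental_theorem_of_calculus)
        (auto simp: \<phi>_def \<phi>'_def has_real_derivative_iff_has_vector_derivative[symmetric] intro!: derivative_eq_intros)
    then show "\<phi> x - \<phi> a = integral {a..x} \<phi>'" by (simp add: integral_unique)
  qed
  define m where "m = integral {a..b} (\<lambda>x. w x * (\<phi> x)\<^sup>2)"
  have "\<phi> ((a + b) / 2) = (b - a) / 2 * ((b - a) / 2)" by (simp add: \<phi>_def field_simps)
  moreover have "(b - a) / 2 * ((b - a) / 2) \<noteq> 0" using ab(2) by simp
  ultimately have "\<phi> ((a + b) / 2) \<noteq> 0" by (simp only: not_False_eq_True)
  then have m: "m > 0"
    unfolding m_def using ab by (intro weighted_integral_pos[OF ab, of _ "(a + b) / 2"] continuous_intros \<phi>c) auto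
  have i\<mu>: "(\<lambda>x. \<phi> x * \<phi>' x * \<mu> x) absolutely_integrable_on {a..b}"
    by (intro abs_integrable_continuous_mult continuous_intros \<phi>c
        abs_integrable_subD(1)[OF bounded_measurable_imp_abs_integrable[OF \<mu>_measurable(1)] ab(1,3)])
  have iK: "(\<lambda>x. (\<phi>' x)\<^sup>2 - 2 * (\<phi> x * \<phi>' x * \<mu> x)) absolutely_integrable_on {a..b}"
    by (intro set_integral_diff(1) set_integrable_mult_right i\<mu> absolutely_integrable_continuous_real continuous_intros \<phi>c)
  have iw: "(\<lambda>x. w x * (\<phi> x)\<^sup>2) absolutely_integrable_on {a..b}"
    using abs_integrable_continuous_mult[OF _ abs_integrable_subD(1)[OF w_integrable ab(1,3)], of "\<lambda>x. (\<phi> x)\<^sup>2"]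
    by (simp add: mult.commute continuous_intros \<phi>c)
  define K where "K = integral {a..b} (\<lambda>x. (\<phi>' x)\<^sup>2 - 2 * (\<phi> x * \<phi>' x * \<mu> x))"
  have "l \<le> K / m" if nz: "\<forall>x\<in>{a..b}. \<psi>r l x \<noteq> 0" for l
  proof -
    define v where "v = (\<lambda>s. \<psi>qr l s + \<mu> s * \<psi>r l s)"
    have P: "primitive_on a b (\<psi>r l) v"
      using primitive_on_subinterval[OF \<psi>r_primitive ab(1,3)] by (simp add: v_def)
    have R: "primitive_on a b (\<psi>qr l) (\<lambda>s. - (\<mu> s * v s) - l * (w s * \<psi>r l s))"
      using primitive_on_subinterval[OF \<psi>qr_primitive ab(1,3)] by (simp add: v_def)
    have nz': "z \<noteq> 0" if "z \<in> \<psi>r l ` {a..b}" for z using nz that by auto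
    have Q: "primitive_on a b (\<lambda>x. inverse (\<psi>r l x)) (\<lambda>x. - inverse ((\<psi>r l x)\<^sup>2) * v x)"
    proof (rule primitive_on_chain[OF P])
      show "(inverse has_real_derivative - inverse (x\<^sup>2)) (at x)" if "x \<in> \<psi>r l ` {a..b}" for x
        using DERIV_inverse[OF nz'[OF that]] by (simp add: numeral_2_eq_2)
      show "continuous_on (\<psi>r l ` {a..b}) (\<lambda>x. - inverse (x\<^sup>2))"
        using nz' by (intro continuous_intros) auto
    qed
    note T = primitive_on_mult[OF primitive_on_mult[OF \<phi>P \<phi>P] primitive_on_mult[OF R Q]]
    let ?D = "\<lambda>x. (\<phi>' x * \<phi> x + \<phi> x * \<phi>' x) * (\<psi>qr l x * inverse (\<psi>r l x)) +
       \<phi> x * \<phi> x * ((- (\<mu> x * v x) - l * (w x * \<psi>r l x)) * inverse (\<psi>r l x) + \<psi>qr l x * (- inverse ((\<psi>r l x)\<^sup>2) * v x))"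
    have "\<phi> a = 0" "\<phi> b = 0" by (simp_all add: \<phi>_def)
    then have "0 = integral {a..b} ?D"
      using primitive_on_diff[OF T, of a b] ab by simp
    also have "\<dots> \<le> integral {a..b} (\<lambda>x. ((\<phi>' x)\<^sup>2 - 2 * (\<phi> x * \<phi>' x * \<mu> x)) - l * (w x * (\<phi> x)\<^sup>2))"
    proof (rule integral_mono_on_Icc[OF primitive_onD(1)[OF T]])
      show "(\<lambda>x. ((\<phi>' x)\<^sup>2 - 2 * (\<phi> x * \<phi>' x * \<mu> x)) - l * (w x * (\<phi> x)\<^sup>2)) absolutely_integrable_on {a..b}"
        by (intro set_integral_diff(1) iK set_integrable_mult_right iw)
      fix x assume x: "x \<in> {a..b}"
      define c where "c = inverse (\<psi>r l x)"
      have pc: "\<psi>r l x * c = 1" using nz x by (simp add: c_def)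
      have rv: "\<psi>qr l x = v x - \<mu> x * \<psi>r l x" by (simp add: v_def)
      have "?D x = (2 * \<phi> x * \<phi>' x) * (v x * c - \<mu> x * (\<psi>r l x * c)) +
         (\<phi> x)\<^sup>2 * (- (\<mu> x * v x * c) - l * w x * (\<psi>r l x * c) - (v x * c - \<mu> x * (\<psi>r l x * c)) * (v x * c))"
        unfolding rv c_def[symmetric] power_inverse[symmetric] by (simp add: power2_eq_square algebra_simps)
      also have "\<dots> = ((\<phi>' x)\<^sup>2 - 2 * (\<phi> x * \<phi>' x * \<mu> x)) - l * (w x * (\<phi> x)\<^sup>2) - (\<phi> x * (v x * c) - \<phi>' x)\<^sup>2"
        unfolding pc by (simp add: power2_eq_square algebra_simps)
      finally show "?D x \<le> ((\<phi>' x)\<^sup>2 - 2 * (\<phi> x * \<phi>' x * \<mu> x)) - l * (w x * (\<phi> x)\<^sup>2)"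
        by simp
    qed
    also have "\<dots> = K - integral {a..b} (\<lambda>x. l * (w x * (\<phi> x)\<^sup>2))"
      unfolding K_def using iK iw unfolding absolutely_integrable_on_def
      by (intro Henstock_Kurzweil_Integration.integral_diff) (auto intro: integrable_on_mult_right)
    also have "\<dots> = K - l * m"
      unfolding m_def by (simp only: Henstock_Kurzweil_Integration.integral_mult_right)
    finally show ?thesis using m by (simp add: field_simps)
  qed
  then show ?thesis by (intro exI[of _ "K / m"]) force
qed

text \<open>Each further zero, found beyond the previous one by Picone's identity, lies on a strictly higher level of the
  angle, because levels are crossed only upwards. The step keeps the half \<open>[0,c/2)\<close> for the induction hypothesis and
  looks for the new zero in \<open>[c/2,3c/4]\<close>.\<close>
lemma many_zeros:
  assumes "0 < c" "c \<le> 1"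
  shows "\<exists>L. \<forall>l>L. \<exists>z\<in>{0..<c}. \<exists>k::int. int N \<le> k \<and> angle z l = of_int k * pi"
  using assms
proof (induction N arbitrary: c)
  case 0
  then show ?case by (intro exI allI impI bexI[of _ 0] exI[of _ 0]) (auto simp: angle)
next
  case (Suc N)
  obtain L1 where L1: "\<And>l. l > L1 \<Longrightarrow> \<exists>z\<in>{0..<c/2}. \<exists>k::int. int N \<le> k \<and> angle z l = of_int k * pi"
    using Suc.IH[of "c/2"] Suc.prems by auto
  obtain L2 where L2: "\<And>l. l > L2 \<Longrightarrow> \<exists>x\<in>{c/2..3*c/4}. \<psi>r l x = 0"
    using picone_zero[of "c/2" "3*c/4"] Suc.prems by auto
  have "\<exists>z\<in>{0..<c}. \<exists>k::int. int (Suc N) \<le> k \<and> angle z l = of_int k * pi" if l: "l > max L1 L2" for l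
  proof -
    obtain z k where z: "z \<in> {0..<c/2}" "int N \<le> k" "angle z l = of_int k * pi" using L1[of l] l by auto
    obtain x where x: "x \<in> {c/2..3*c/4}" "\<psi>r l x = 0" using L2[of l] l by auto
    have x': "x \<in> {0..1}" using x Suc.prems by auto
    obtain j :: int where j: "angle x l = of_int j * pi" using \<psi>r_zero_iff[OF x'] x(2) by blast
    have "of_int k * pi < of_int j * pi"
      using angle_crosses_upward[OF _ z(3), of x] z(1) x(1) x' j by auto
    then have "k < j" by simp
    then show ?thesis using x j z(2) Suc.prems by (intro bexI[of _ x] exI[of _ j]) auto
  qed
  then show ?case by blast
qed

lemma angle_endpoint_unbounded: "\<exists>l. real N * pi < angle 1 l"
proof -
  obtain L where "\<And>l. l > L \<Longrightarrow> \<exists>z\<in>{0..<1}. \<exists>k::int. int N \<le> k \<and> angle z l = of_int k * pi"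
    using many_zeros[of 1 N] by auto
  then obtain z k where z: "z \<in> {0..<1}" "int N \<le> k" "angle z (L + 1) = of_int k * pi"
    by (meson less_add_one)
  have "real N * pi \<le> of_int k * pi" using z(2) by (intro mult_right_mono) auto
  also have "\<dots> < angle 1 (L + 1)"
    using angle_crosses_upward[OF _ z(3), of 1] z(1) by auto
  finally show ?thesis by blast
qed

end

section \<open>The sequence of eigenvalues\<close>

text \<open>By the intermediate value theorem the attained levels are the multiples \<open>k * c\<close> with \<open>k \<ge> k0\<close>, where \<open>k0\<close> is the
  least one; positivity of \<open>A\<close> is what makes the levels bounded below.\<close>
lemma increasing_level_sequence:
  fixes A :: "real \<Rightarrow> real"
  assumes cont: "continuous_on UNIV A" and mono: "strict_mono A" and pos: "\<And>l. 0 < A l"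
    and unb: "\<And>N. \<exists>l. real N * c < A l" and c: "c > 0"
  shows "\<exists>ev :: nat \<Rightarrow> real. strict_mono ev \<and> filterlim ev at_top sequentially \<and>
     range ev = {l. \<exists>k::int. A l = of_int k * c}"
proof -
  have ivt: "\<exists>l. A l = real N * c" if "A l0 \<le> real N * c" for N l0
  proof -
    obtain l1 where l1: "real N * c < A l1" using unb by blast
    then have "l0 \<le> l1" using that mono by (metis linear not_le order_trans strict_mono_less_eq)
    then show ?thesis
      using IVT'[of A l0 "real N * c" l1] that l1 continuous_on_subset[OF cont] by force
  qed
  obtain N where "A 0 / c < real N" using reals_Archimedean2 by blast
  then have "A 0 \<le> real N * c" using c by (simp add: field_simps)
  then have ex: "\<exists>k. \<exists>l. A l = real k * c" using ivt by blast
  define k0 where "k0 = (LEAST k. \<exists>l. A l = real k * c)"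
  obtain l0 where l0: "A l0 = real k0 * c"
    using LeastI_ex[OF ex] unfolding k0_def by blast
  have "\<exists>l. A l = real (k0 + n) * c" for n
    using l0 c by (intro ivt[of l0]) (simp add: mult_right_mono)
  then obtain ev where ev: "\<And>n. A (ev n) = real (k0 + n) * c" by metis
  have "strict_mono ev"
    unfolding strict_mono_Suc_iff
  proof
    fix n
    have "A (ev n) < A (ev (Suc n))" unfolding ev using c by (intro mult_strict_right_mono) auto
    then show "ev n < ev (Suc n)" using strict_mono_less[OF mono] by blast
  qed
  moreover have "filterlim ev at_top sequentially"
    unfolding filterlim_at_top
  proof
    fix Z
    obtain N where N: "A Z / c < real N" using reals_Archimedean2 by blast
    have "Z \<le> ev n" if "n \<ge> N" for n
    proof -
      have "A Z < real N * c" using N c by (simp add: field_simps)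
      also have "\<dots> \<le> real (k0 + n) * c" using that c by (intro mult_right_mono) auto
      finally have "A Z < A (ev n)" by (simp only: ev)
      then show ?thesis using strict_mono_less[OF mono] by (simp add: less_imp_le)
    qed
    then show "eventually (\<lambda>n. Z \<le> ev n) sequentially"
      by (rule eventually_sequentiallyI)
  qed
  moreover have "range ev = {l. \<exists>k::int. A l = of_int k * c}"
  proof (intro equalityI subsetI)
    fix l assume "l \<in> range ev"
    then obtain n where "l = ev n" by blast
    then have "A l = of_int (int (k0 + n)) * c" using ev by simp
    then show "l \<in> {l. \<exists>k::int. A l = of_int k * c}" by blast
  next
    fix l assume "l \<in> {l. \<exists>k::int. A l = of_int k * c}"
    then obtain k :: int where k: "A l = of_int k * c" by blast
    then have "0 < of_int k * c" using pos[of l] by simp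
    then have "k > 0" using c by (simp add: zero_less_mult_iff)
    then have nk: "A l = real (nat k) * c" using k by simp
    then have "k0 \<le> nat k" unfolding k0_def by (intro Least_le) blast
    then have "A l = A (ev (nat k - k0))" using nk ev by simp
    then have "l = ev (nat k - k0)" using strict_mono_eq[OF mono] by simp
    then show "l \<in> range ev" by blast
  qed
  ultimately show ?thesis by blast
qed

theorem theoremA6:
  fixes w \<mu> :: "real \<Rightarrow> real"
  assumes "set_integrable lebesgue {0..1} w"
    and "AE x in lebesgue. x \<in> {0..1} \<longrightarrow> w x > 0"
    and "\<mu> \<in> normalized_bv"
  shows "\<exists>ev :: nat \<Rightarrow> real.
           strict_mono ev \<and>
           filterlim ev at_top sequentially \<and>
           {\<zeta>. mde_eigenvalue w \<mu> \<zeta>} = range (\<lambda>n. complex_of_real (ev n)) \<and>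
           (\<forall>n. algebraically_simple w \<mu> (complex_of_real (ev n)))"
proof -
  interpret measure_sturm_liouville w \<mu>
    using assms by unfold_locales (auto simp: normalized_bv_def)
  have "continuous_on UNIV (angle 1)"
    using angle_cont_l[of 1] by simp
  then obtain ev where ev: "strict_mono ev" "filterlim ev at_top sequentially"
    and range: "range ev = {l. \<exists>k::int. angle 1 l = of_int k * pi}"
    using increasing_level_sequence[OF _ angle_endpoint_strict_mono angle_endpoint_pos angle_endpoint_unbounded pi_gt_zero]
    by blast
  have "\<psi> (of_real l) 1 = 0 \<longleftrightarrow> l \<in> range ev" for l
    using \<psi>r_zero_iff[of 1 l] by (simp add: range \<psi>_of_real)
  moreover have "\<psi> \<zeta> 1 = 0 \<Longrightarrow> \<exists>l. \<zeta> = of_real l" for \<zeta>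
    using discriminant_zero_real by (metis Reals_cases)
  ultimately have spec: "\<psi> \<zeta> 1 = 0 \<longleftrightarrow> \<zeta> \<in> range (\<lambda>n. complex_of_real (ev n))" for \<zeta>
    by (metis (no_types, lifting) rangeE rangeI)
  then have "{\<zeta>. mde_eigenvalue w \<mu> \<zeta>} = range (\<lambda>n. complex_of_real (ev n))"
    by (auto simp: eigenvalue_iff)
  moreover have "algebraically_simple w \<mu> (complex_of_real (ev n))" for n
    using spec by (intro eigenvalue_algebraically_simple) blast
  ultimately show ?thesis using ev by blast
qed

end
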